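(* Let $P$ be a probability distribution on $\mathcal{X}=\mathbb{F}_d^2$, $\mathcal{A}\sim\{\sqrt{P(u)}N_u\}_{u\in\mathcal{X}}$, let $1\le k\le n$, let $L\subset\mathbb{F}^{2n}$ be a self-orthogonal subspace with $\dim L=n-k$, and let $P_L$ be the associated distribution on $\mathbb{F}^{n-k}\times\mathbb{F}^{2k}$. Define $$E_{n,k}(R,P_L)=\min_{P'}\big[D(P'\|P_L)+|k-kR-H(\overleftarrow{P'}\,|\,\bar{P'})|^+\big],$$ where $|x|^+=\max\{x,0\}$ and the minimum is over all probability distributions $P'$ on $\mathbb{F}^{n-k}\times\mathbb{F}^{2k}$. Then for every $R'$ with $0\le R'\le1$, $$\limsup_{M\to\infty}\ -\frac{\log_d\big[1-F^\star_{M,R'M}(\mathcal{A}^{\otimes M})\big]}{M}\ \ge\ \frac{E_{n,k}(R'n/k,\,P_L)}{n}.$$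
   Context: Let $d$ be a prime, $\mathbb{F}=\mathbb{F}_d$, $\mathcal{H}$ a $d$-dimensional Hilbert space with orthonormal basis $\{|0\rangle,\dots,|d-1\rangle\}$, $\omega$ a primitive $d$-th root of unity, $X|j\rangle=|(j-1)\bmod d\rangle$, $Z|j\rangle=\omega^j|j\rangle$, $\mathcal{X}=\mathbb{F}^2$, $N_{(i,j)}=X^iZ^j$. For $x=((u_1,v_1),\dots,(u_n,v_n))\in\mathcal{X}^n$, identified with $(u_1,v_1,\dots,u_n,v_n)\in\mathbb{F}^{2n}$, $N_x=N_{(u_1,v_1)}\otimes\cdots\otimes N_{(u_n,v_n)}$. The symplectic form on $\mathbb{F}^{2n}$ is $\langle x,y\rangle=\sum_i(u_iv_i'-v_iu_i')$; $L^\perp=\{y:\langle x,y\rangle=0\ \forall x\in L\}$; $L$ is self-orthogonal if $L\subset L^\perp$. The channel $\mathcal{A}\sim\{\sqrt{P(u)}N_u\}$ maps $\rho\mapsto\sum_uP(u)N_u\rho N_u^\dagger$, and $\mathcal{A}^{\otimes M}(\rho)=\sum_{x\in\mathcal{X}^M}P^M(x)N_x\rho N_x^\dagger$, $P^M(x)=\prod_iP(x_i)$. Codes and fidelity: a code is $(\mathcal{C},\mathcal{R})$ with $\mathcal{C}\subset\mathcal{H}^{\otimes M}$ a subspace and $\mathcal{R}$ a trace-preserving completely positive map; $F(\mathcal{C},\mathcal{R}\mathcal{A}^{\otimes M})=\min_{\text{unit }\psi\in\mathcal{C}}\langle\psi|\mathcal{R}(\mathcal{A}^{\otimes M}(|\psi\rangle\langle\psi|))|\psi\rangle$;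 for integer $M\ge1$ and real $0\le K\le M$, $F^\star_{M,K}(\mathcal{A}^{\otimes M})$ is the supremum of this over codes with $\log_d\dim\mathcal{C}\ge K$. Definition of $P_L$: with $\dim L=n-k$ and a basis $g_1,\dots,g_{n-k}$ of $L$, choose (such exist) $g_{n-k+1},\dots,g_n,h_1,\dots,h_n\in\mathbb{F}^{2n}$ with $\langle g_i,h_j\rangle=\delta_{ij}$, $\langle g_i,g_j\rangle=\langle h_i,h_j\rangle=0$, and fix such a choice. For $x=\sum_i(w_ig_i+z_ih_i)$ put $\varphi_{2i-1}(x)=w_i$, $\varphi_{2i}(x)=z_i$. Then $P_L(s,(u_1,u_1',\dots,u_k,u_k'))=\sum P^n(x)$, summed over $x\in\mathbb{F}^{2n}$ with $\varphi_{2i}(x)=s_i$ for $1\le i\le n-k$ and $\varphi_{2i-1}(x)=u_{i-n+k}$, $\varphi_{2i}(x)=u'_{i-n+k}$ for $n-k<i\le n$, where $s=(s_1,\dots,s_{n-k})$. Entropic notation (all logarithms base $d$): for $Q$ on $\mathcal{Y}\times\mathcal{Z}$, $\bar Q(u)=\sum_vQ(u,v)$ and $\overleftarrow{Q}(v|u)=Q(u,v)/\bar Q(u)$ when $\bar Q(u)>0$ (undefined otherwise); for a stochastic matrix $W$ and distribution $p$, $H(W|p)=-\sum_{u:p(u)>0}\sum_vp(u)W(v|u)\log_dW(v|u)$; $D(P\|Q)=\sum_uP(u)\log_d[P(u)/Q(u)]$; conventions $0\log0=0\log(0/0)=0$, $\log(a/0)=\infty$ for $a>0$. *)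

theory Defs
  imports Complex_Main "HOL-Library.Extended_Real" "HOL-Library.Liminf_Limsup"
    "HOL-Computational_Algebra.Primes"
begin

text \<open>An element of F_d^m is a function nat => nat with values < d on indices < m
  and 0 elsewhere. A vector (u_1,v_1,...,u_n,v_n) of F^{2n} has u_{i+1} at index 2i
  and v_{i+1} at index 2i+1.\<close>

definition vecs :: "nat \<Rightarrow> nat \<Rightarrow> (nat \<Rightarrow> nat) set" where
  "vecs d m = {v. (\<forall>i<m. v i < d) \<and> (\<forall>i\<ge>m. v i = 0)}"

definition vzero :: "nat \<Rightarrow> nat" where "vzero = (\<lambda>i. 0)"

definition vadd :: "nat \<Rightarrow> nat \<Rightarrow> (nat \<Rightarrow> nat) \<Rightarrow> (nat \<Rightarrow> nat) \<Rightarrow> (nat \<Rightarrow> nat)" where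
  "vadd d m x y = (\<lambda>i. if i < m then (x i + y i) mod d else 0)"

definition vscale :: "nat \<Rightarrow> nat \<Rightarrow> nat \<Rightarrow> (nat \<Rightarrow> nat) \<Rightarrow> (nat \<Rightarrow> nat)" where
  "vscale d m c x = (\<lambda>i. if i < m then (c * x i) mod d else 0)"

definition lincomb :: "nat \<Rightarrow> nat \<Rightarrow> (nat \<Rightarrow> nat) \<Rightarrow> (nat \<Rightarrow> nat \<Rightarrow> nat) \<Rightarrow> nat \<Rightarrow> (nat \<Rightarrow> nat)" where
  "lincomb d m cs vs N = (\<lambda>i. if i < m then (\<Sum>j<N. cs j * vs j i) mod d else 0)"

definition fspan :: "nat \<Rightarrow> nat \<Rightarrow> (nat \<Rightarrow> nat \<Rightarrow> nat) \<Rightarrow> nat \<Rightarrow> (nat \<Rightarrow> nat) set" where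
  "fspan d m vs N = {lincomb d m cs vs N | cs. \<forall>j<N. cs j < d}"

definition lin_indep :: "nat \<Rightarrow> nat \<Rightarrow> (nat \<Rightarrow> nat \<Rightarrow> nat) \<Rightarrow> nat \<Rightarrow> bool" where
  "lin_indep d m vs N \<longleftrightarrow>
     (\<forall>cs. (\<forall>j<N. cs j < d) \<and> lincomb d m cs vs N = vzero \<longrightarrow> (\<forall>j<N. cs j = 0))"

definition is_subspace :: "nat \<Rightarrow> nat \<Rightarrow> (nat \<Rightarrow> nat) set \<Rightarrow> bool" where
  "is_subspace d m L \<longleftrightarrow> L \<subseteq> vecs d m \<and> vzero \<in> L \<and>
     (\<forall>x\<in>L. \<forall>y\<in>L. vadd d m x y \<in> L) \<and> (\<forall>c<d. \<forall>x\<in>L. vscale d m c x \<in> L)"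

definition symp :: "nat \<Rightarrow> nat \<Rightarrow> (nat \<Rightarrow> nat) \<Rightarrow> (nat \<Rightarrow> nat) \<Rightarrow> int" where
  "symp d n x y = (\<Sum>i<n. int (x (2*i)) * int (y (2*i+1)) - int (x (2*i+1)) * int (y (2*i))) mod int d"

definition self_orthogonal :: "nat \<Rightarrow> nat \<Rightarrow> (nat \<Rightarrow> nat) set \<Rightarrow> bool" where
  "self_orthogonal d n L \<longleftrightarrow> L \<subseteq> {y \<in> vecs d (2*n). \<forall>x\<in>L. symp d n x y = 0}"

definition symplectic_ext :: "nat \<Rightarrow> nat \<Rightarrow> (nat \<Rightarrow> nat \<Rightarrow> nat) \<Rightarrow> (nat \<Rightarrow> nat \<Rightarrow> nat) \<Rightarrow> bool" where
  "symplectic_ext d n g h \<longleftrightarrow>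
     (\<forall>i<n. g i \<in> vecs d (2*n) \<and> h i \<in> vecs d (2*n)) \<and>
     (\<forall>i<n. \<forall>j<n. symp d n (g i) (h j) = (if i = j then 1 else 0)
                 \<and> symp d n (g i) (g j) = 0 \<and> symp d n (h i) (h j) = 0)"

text \<open>Coordinates (w,z) of x = sum_i (w_i g_i + z_i h_i); phi_{2i-1} = w_i, phi_{2i} = z_i
  (0-based indices here).\<close>
definition coords :: "nat \<Rightarrow> nat \<Rightarrow> (nat \<Rightarrow> nat \<Rightarrow> nat) \<Rightarrow> (nat \<Rightarrow> nat \<Rightarrow> nat) \<Rightarrow> (nat \<Rightarrow> nat)
     \<Rightarrow> (nat \<Rightarrow> nat) \<times> (nat \<Rightarrow> nat)" where
  "coords d n g h x = (THE wz. fst wz \<in> vecs d n \<and> snd wz \<in> vecs d n \<and>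
      x = (\<lambda>i. if i < 2*n then (\<Sum>j<n. fst wz j * g j i + snd wz j * h j i) mod d else 0))"

definition prodP :: "(nat \<times> nat \<Rightarrow> real) \<Rightarrow> nat \<Rightarrow> (nat \<Rightarrow> nat) \<Rightarrow> real" where
  "prodP P n x = (\<Prod>i<n. P (x (2*i), x (2*i+1)))"

text \<open>P_L(s, (u_1,u_1',...,u_k,u_k')) with s \<in> vecs d (n-k), u \<in> vecs d (2k), u_{j+1} = u(2j),
  u'_{j+1} = u(2j+1).\<close>
definition PL :: "nat \<Rightarrow> nat \<Rightarrow> nat \<Rightarrow> (nat \<times> nat \<Rightarrow> real) \<Rightarrow> (nat \<Rightarrow> nat \<Rightarrow> nat) \<Rightarrow> (nat \<Rightarrow> nat \<Rightarrow> nat)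
     \<Rightarrow> (nat \<Rightarrow> nat) \<times> (nat \<Rightarrow> nat) \<Rightarrow> real" where
  "PL d n k P g h su = (\<Sum>x\<in>{x \<in> vecs d (2*n).
       (\<forall>i<n-k. snd (coords d n g h x) i = fst su i) \<and>
       (\<forall>j<k. fst (coords d n g h x) (n-k+j) = snd su (2*j) \<and>
              snd (coords d n g h x) (n-k+j) = snd su (2*j+1))}. prodP P n x)"

definition qbar :: "('a \<times> 'b \<Rightarrow> real) \<Rightarrow> 'b set \<Rightarrow> 'a \<Rightarrow> real" where
  "qbar Q Z u = (\<Sum>v\<in>Z. Q (u, v))"

definition cond_rev :: "('a \<times> 'b \<Rightarrow> real) \<Rightarrow> 'b set \<Rightarrow> 'b \<Rightarrow> 'a \<Rightarrow> real" where
  "cond_rev Q Z v u = Q (u, v) / qbar Q Z u"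

definition cond_ent :: "real \<Rightarrow> 'a set \<Rightarrow> 'b set \<Rightarrow> ('b \<Rightarrow> 'a \<Rightarrow> real) \<Rightarrow> ('a \<Rightarrow> real) \<Rightarrow> real" where
  "cond_ent b Y Z W p = - (\<Sum>u\<in>{u\<in>Y. p u > 0}. \<Sum>v\<in>Z.
       p u * W v u * (if W v u = 0 then 0 else log b (W v u)))"

definition kl_div :: "real \<Rightarrow> 'a set \<Rightarrow> ('a \<Rightarrow> real) \<Rightarrow> ('a \<Rightarrow> real) \<Rightarrow> ereal" where
  "kl_div b S P Q = (\<Sum>u\<in>S. if P u = 0 then 0 else if Q u = 0 then \<infinity>
                        else ereal (P u * log b (P u / Q u)))"

definition distributions :: "'a set \<Rightarrow> ('a \<Rightarrow> real) set" where
  "distributions S = {p. (\<forall>x\<in>S. p x \<ge> 0) \<and> sum p S = 1}"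

definition posp :: "real \<Rightarrow> real" where "posp x = max x 0"

definition E_nk :: "nat \<Rightarrow> nat \<Rightarrow> nat \<Rightarrow> real \<Rightarrow> ((nat \<Rightarrow> nat) \<times> (nat \<Rightarrow> nat) \<Rightarrow> real) \<Rightarrow> ereal" where
  "E_nk d n k R Q = (let Y = vecs d (n-k); Z = vecs d (2*k) in
     (INF P' \<in> distributions (Y \<times> Z). kl_div (real d) (Y \<times> Z) P' Q +
        ereal (posp (real k - real k * R - cond_ent (real d) Y Z (cond_rev P' Z) (qbar P' Z)))))"

text \<open>Basis index c < d^M of H^{\<otimes>M} corresponds to |j_1 ... j_M> with j_{i+1} = digit d c i.\<close>
definition digit :: "nat \<Rightarrow> nat \<Rightarrow> nat \<Rightarrow> nat" where
  "digit d c i = c div d ^ i mod d"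

type_synonym cmat = "nat \<Rightarrow> nat \<Rightarrow> complex"
type_synonym cvec = "nat \<Rightarrow> complex"

definition mmul :: "nat \<Rightarrow> cmat \<Rightarrow> cmat \<Rightarrow> cmat" where
  "mmul D A B = (\<lambda>i j. \<Sum>l<D. A i l * B l j)"

definition adj :: "cmat \<Rightarrow> cmat" where
  "adj A = (\<lambda>i j. cnj (A j i))"

text \<open>N_x = X^{u_1} Z^{v_1} \<otimes> ... \<otimes> X^{u_M} Z^{v_M}, with X|j> = |j-1 mod d>, Z|j> = \<omega>^j |j>.
  Entry (r,c) is <r|N_x|c>.\<close>
definition pauli :: "nat \<Rightarrow> complex \<Rightarrow> nat \<Rightarrow> (nat \<Rightarrow> nat) \<Rightarrow> cmat" where
  "pauli d \<omega> M x = (\<lambda>r c. if (\<forall>i<M. digit d r i = (digit d c i + d - x (2*i)) mod d)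
                          then \<omega> ^ (\<Sum>i<M. x (2*i+1) * digit d c i) else 0)"

definition chan :: "nat \<Rightarrow> complex \<Rightarrow> (nat \<times> nat \<Rightarrow> real) \<Rightarrow> nat \<Rightarrow> cmat \<Rightarrow> cmat" where
  "chan d \<omega> P M \<rho> = (\<lambda>i j. \<Sum>x\<in>vecs d (2*M).
      complex_of_real (prodP P M x) *
      mmul (d^M) (mmul (d^M) (pauli d \<omega> M x) \<rho>) (adj (pauli d \<omega> M x)) i j)"

definition is_tpcp_kraus :: "nat \<Rightarrow> cmat list \<Rightarrow> bool" where
  "is_tpcp_kraus D Ks \<longleftrightarrow> (\<forall>i<D. \<forall>j<D.
      (\<Sum>K\<leftarrow>Ks. mmul D (adj K) K i j) = (if i = j then 1 else 0))"

definition kraus_apply :: "nat \<Rightarrow> cmat list \<Rightarrow> cmat \<Rightarrow> cmat" where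
  "kraus_apply D Ks \<rho> = (\<lambda>i j. \<Sum>K\<leftarrow>Ks. mmul D (mmul D K \<rho>) (adj K) i j)"

text \<open>A code subspace C is given by an orthonormal basis B (list of vectors in C^D).\<close>
definition orthonormal :: "nat \<Rightarrow> cvec list \<Rightarrow> bool" where
  "orthonormal D B \<longleftrightarrow> (\<forall>a<length B. \<forall>b<length B.
      (\<Sum>i<D. cnj ((B!a) i) * (B!b) i) = (if a = b then 1 else 0))"

definition unit_vecs_of_code :: "nat \<Rightarrow> cvec list \<Rightarrow> cvec set" where
  "unit_vecs_of_code D B = {\<psi>. (\<exists>c. \<psi> = (\<lambda>i. \<Sum>a<length B. c a * (B!a) i)) \<and>
                               (\<Sum>i<D. (cmod (\<psi> i))\<^sup>2) = 1}"

definition fidelity :: "nat \<Rightarrow> (cmat \<Rightarrow> cmat) \<Rightarrow> cvec list \<Rightarrow> cmat list \<Rightarrow> real" where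
  "fidelity D ch B Ks = Inf ((\<lambda>\<psi>. Re (\<Sum>i<D. \<Sum>j<D.
      cnj (\<psi> i) * kraus_apply D Ks (ch (\<lambda>a b. \<psi> a * cnj (\<psi> b))) i j * \<psi> j))
      ` unit_vecs_of_code D B)"

definition Fstar :: "nat \<Rightarrow> complex \<Rightarrow> (nat \<times> nat \<Rightarrow> real) \<Rightarrow> nat \<Rightarrow> real \<Rightarrow> real" where
  "Fstar d \<omega> P M K = Sup {fidelity (d^M) (chan d \<omega> P M) B Ks | B Ks.
      orthonormal (d^M) B \<and> is_tpcp_kraus (d^M) Ks \<and> length B > 0 \<and>
      log (real d) (real (length B)) \<ge> K}"

definition err_exp :: "nat \<Rightarrow> complex \<Rightarrow> (nat \<times> nat \<Rightarrow> real) \<Rightarrow> real \<Rightarrow> nat \<Rightarrow> ereal" where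
  "err_exp d \<omega> P R' M = (let F = Fstar d \<omega> P M (R' * real M) in
      if F = 1 then \<infinity> else ereal (- log (real d) (1 - F) / real M))"

end

theory Submission
  imports Defs "HOL-Analysis.Convex" "HOL-Number_Theory.Cong" "HOL-Library.FuncSet"
begin

text \<open>The exponent is handled in Gallager's form. For \<rho> in [0,1] put
  A(s) = (\<Sum>u. P_L(s,u)^(1/(1+\<rho>))) and Z(\<rho>) = (\<Sum>s. A(s)^(1+\<rho>)). The tilted distribution
  Q(s,u) = A(s)^\<rho> P_L(s,u)^(1/(1+\<rho>)) / Z(\<rho>) satisfies D(Q|P_L) - \<rho> H = - log Z(\<rho>), where H is its
  conditional entropy, a continuous function of \<rho>. By the intermediate value theorem some \<rho> has
  |a - H|^+ = \<rho> (a - H) with a = k - kR, so that E_{n,k} is at most \<rho> a - log Z(\<rho>).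

  On m blocks of n systems, the symplectic basis splits an error into a part acting trivially on the
  inner code, a syndrome s and a logical part u, where (s,u) has the product distribution of P_L. The
  logical coordinates (w,z) in F^{2km} are sheared by two random symmetric matrices,
  t = z + S (w + T z), and the outer code fixes all but the first K entries of t. A nonzero (w,z)
  becomes undetectable with probability at most 2 d^{K-km}, and maximum likelihood decoding with
  Gallager's union bound gives an infidelity of at most (2 d^{K-km})^\<rho> Z(\<rho>)^m.

  The quantum code is spanned by the translates N_y v of a joint eigenvector v of the operators N_a,
  a ranging over a self-orthogonal set; eigenvalues decide orthogonality of translates, so no
  stabilizer phases have to be chosen, which treats d = 2 and odd d alike.\<close>

section \<open>The exponent in Gallager form\<close>

text \<open>Averaging over all self-orthogonal spaces would require counting them through the
  transitivity of the symplectic group. Shears by symmetric matrices replace this: they preserve the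
  form, so checks pulled back through them still commute, and the count only asks how often a
  symmetric matrix sends a given nonzero vector to a given value. One shear is not enough: z + S w
  leaves (0, z) where it is, so T first feeds z into the w-part. The factor 2 pays for the two ways
  to fail: w + T z = 0, or S moves t into the part left free. Gallager's bound uses only pairwise
  probabilities, so nothing beyond this count is asked of the family. A limsup needs only the
  lengths M = n m. There K is R' M rounded up; the rounding and the factor 2 add a constant to the
  logarithm, which disappears after division by M. If a <= 0, K may exceed k m and no code is built.
  For that case \<rho> = 0 is demanded, which makes the bound 0, and it is enough that the error
  exponent is nonnegative.\<close>

lemma gallager_exponent:
  fixes p :: "'a \<times> 'b \<Rightarrow> real" and a b :: real
  assumes fin: "finite Y" "finite Z" and nonneg: "\<And>x. x \<in> Y \<times> Z \<Longrightarrow> p x \<ge> 0"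
    and total: "sum p (Y \<times> Z) = 1" and b: "b > 1"
  shows "\<exists>\<rho>. 0 \<le> \<rho> \<and> \<rho> \<le> 1 \<and> (a \<le> 0 \<longrightarrow> \<rho> = 0) \<and>
    (INF P' \<in> distributions (Y \<times> Z). kl_div b (Y \<times> Z) P' p +
        ereal (posp (a - cond_ent b Y Z (cond_rev P' Z) (qbar P' Z))))
     \<le> ereal (\<rho> * a - log b (\<Sum>s\<in>Y. (\<Sum>u\<in>Z. p (s, u) powr (1 / (1 + \<rho>))) powr (1 + \<rho>)))"
proof -
  define A where "A = (\<lambda>\<rho> s. \<Sum>u\<in>Z. p (s, u) powr (1 / (1 + \<rho>)))"
  define N where "N = (\<lambda>\<rho>. \<Sum>s\<in>Y. A \<rho> s powr (1 + \<rho>))"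
  define Q where "Q = (\<lambda>\<rho> (s, u). A \<rho> s powr \<rho> * p (s, u) powr (1 / (1 + \<rho>)) / N \<rho>)"
  define S where "S = {x \<in> Y \<times> Z. p x > 0}"
  \<comment> \<open>\<open>H\<close> is written over the fixed support \<open>S\<close> with
    explicit logarithms, so that continuity in \<rho> can be read off; \<open>ent\<close> identifies
    it with the conditional entropy.\<close>
  define H where "H = (\<lambda>\<rho>. - (\<Sum>x\<in>S. Q \<rho> x * (log b (p x) / (1 + \<rho>) - log b (A \<rho> (fst x)))))"
  have finS: "finite S" unfolding S_def using fin by auto
  have A_nonneg: "A \<rho> s \<ge> 0" for \<rho> s unfolding A_def by (simp add: sum_nonneg)
  have A_ge: "p (s, u) powr (1 / (1 + \<rho>)) \<le> A \<rho> s" if "u \<in> Z" for \<rho> s u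
    unfolding A_def using that fin by (intro member_le_sum) auto
  have A_pos: "A \<rho> (fst x) > 0" if "x \<in> S" for \<rho> x
    using A_ge[of "snd x" "fst x" \<rho>] that less_le_trans[of 0 "p x powr (1 / (1 + \<rho>))"]
    by (auto simp: S_def)
  have S_ne: "S \<noteq> {}"
  proof
    assume "S = {}"
    then have "p x = 0" if "x \<in> Y \<times> Z" for x
      using nonneg[OF that] that unfolding S_def by (metis (mono_tags, lifting) empty_iff mem_Collect_eq order_le_less)
    then have "sum p (Y \<times> Z) = 0" by simp
    then show False using total by simp
  qed
  have N_pos: "N \<rho> > 0" for \<rho>
  proof -
    from S_ne obtain x where x: "x \<in> S" by auto
    have "0 < A \<rho> (fst x) powr (1 + \<rho>)" using A_pos[OF x, of \<rho>] by simp
    also have "\<dots> \<le> N \<rho>" unfolding N_def using x fin by (intro member_le_sum) (auto simp: S_def)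
    finally show ?thesis .
  qed
  have Q_nonneg: "Q \<rho> x \<ge> 0" for \<rho> x
    using N_pos[of \<rho>] by (cases x) (auto simp: Q_def)
  have qbar: "qbar (Q \<rho>) Z s = A \<rho> s powr (1 + \<rho>) / N \<rho>" for \<rho> s
  proof -
    have "qbar (Q \<rho>) Z s = A \<rho> s powr \<rho> * A \<rho> s / N \<rho>"
      unfolding qbar_def Q_def by (simp add: sum_distrib_left sum_divide_distrib A_def)
    also have "A \<rho> s powr \<rho> * A \<rho> s = A \<rho> s powr (1 + \<rho>)"
      using A_nonneg[of \<rho> s] by (cases "A \<rho> s = 0") (auto simp: powr_add)
    finally show ?thesis .
  qed
  have Q_sum: "sum (Q \<rho>) (Y \<times> Z) = 1" for \<rho>
  proof -
    have "sum (Q \<rho>) (Y \<times> Z) = (\<Sum>s\<in>Y. qbar (Q \<rho>) Z s)"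
      unfolding qbar_def by (simp add: sum.cartesian_product)
    also have "\<dots> = N \<rho> / N \<rho>" by (simp only: qbar sum_divide_distrib[symmetric]) (simp add: N_def)
    finally show ?thesis using N_pos[of \<rho>] by simp
  qed
  have Q_dist: "Q \<rho> \<in> distributions (Y \<times> Z)" for \<rho>
    using Q_sum Q_nonneg by (simp add: distributions_def)
  have zero: "p x = 0" if "x \<in> Y \<times> Z" "x \<notin> S" for x
    using that nonneg[OF that(1)] unfolding S_def by force
  have Q_zero: "Q \<rho> x = 0" if "x \<in> Y \<times> Z" "x \<notin> S" for x \<rho>
    using zero[OF that] by (cases x) (simp add: Q_def)
  have Q_pos: "Q \<rho> x > 0" if "x \<in> S" for x \<rho>
    using that A_pos[OF that, of \<rho>] N_pos[of \<rho>] by (cases x) (auto simp: Q_def S_def)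
  have Q_sumS: "sum (Q \<rho>) S = 1" for \<rho>
    using Q_sum[of \<rho>] sum.mono_neutral_left[of "Y \<times> Z" S "Q \<rho>"] fin Q_zero
    by (auto simp: S_def)
  have ent: "cond_ent b Y Z (cond_rev (Q \<rho>) Z) (qbar (Q \<rho>) Z) = H \<rho>" for \<rho>
  proof -
    let ?t = "\<lambda>x. qbar (Q \<rho>) Z (fst x) * cond_rev (Q \<rho>) Z (snd x) (fst x) *
        (if cond_rev (Q \<rho>) Z (snd x) (fst x) = 0 then 0 else log b (cond_rev (Q \<rho>) Z (snd x) (fst x)))"
    have "- cond_ent b Y Z (cond_rev (Q \<rho>) Z) (qbar (Q \<rho>) Z)
        = (\<Sum>x\<in>{u\<in>Y. qbar (Q \<rho>) Z u > 0} \<times> Z. ?t x)"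
      unfolding cond_ent_def by (simp add: sum.cartesian_product case_prod_unfold)
    also have "\<dots> = (\<Sum>x\<in>S. ?t x)"
    proof (rule sum.mono_neutral_right)
      show "finite ({u\<in>Y. qbar (Q \<rho>) Z u > 0} \<times> Z)" using fin by auto
      show "S \<subseteq> {u\<in>Y. qbar (Q \<rho>) Z u > 0} \<times> Z"
      proof
        fix x assume x: "x \<in> S"
        then show "x \<in> {u\<in>Y. qbar (Q \<rho>) Z u > 0} \<times> Z"
          using A_pos[OF x, of \<rho>] N_pos[of \<rho>] by (cases x) (auto simp: S_def qbar)
      qed
      show "\<forall>x\<in>{u\<in>Y. qbar (Q \<rho>) Z u > 0} \<times> Z - S. ?t x = 0"
      proof
        fix x assume "x \<in> {u\<in>Y. qbar (Q \<rho>) Z u > 0} \<times> Z - S"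
        then have "Q \<rho> x = 0" by (intro Q_zero) auto
        then show "?t x = 0" by (cases x) (simp add: cond_rev_def)
      qed
    qed
    also have "\<dots> = (\<Sum>x\<in>S. Q \<rho> x * (log b (p x) / (1 + \<rho>) - log b (A \<rho> (fst x))))"
    proof (rule sum.cong[OF refl])
      fix x assume x: "x \<in> S"
      obtain s u where su: "x = (s, u)" by (cases x)
      have As: "A \<rho> s > 0" using A_pos[OF x, of \<rho>] su by simp
      have px: "p (s, u) > 0" using x su by (simp add: S_def)
      \<comment> \<open>The tilt \<open>A \<rho> s powr \<rho>\<close> depends on s only and cancels
        in the conditional distribution.\<close>
      have c: "cond_rev (Q \<rho>) Z u s = p (s, u) powr (1 / (1 + \<rho>)) / A \<rho> s"
        using As N_pos[of \<rho>] unfolding cond_rev_def qbar by (simp add: Q_def powr_add field_simps)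
      have "qbar (Q \<rho>) Z s * cond_rev (Q \<rho>) Z u s = Q \<rho> (s, u)"
        unfolding cond_rev_def using As N_pos[of \<rho>] qbar[of \<rho> s] by simp
      moreover have "log b (cond_rev (Q \<rho>) Z u s) = log b (p (s, u)) / (1 + \<rho>) - log b (A \<rho> s)"
        unfolding c using As px b by (simp add: log_divide log_powr)
      moreover have "cond_rev (Q \<rho>) Z u s \<noteq> 0" unfolding c using As px by simp
      ultimately show "?t x = Q \<rho> x * (log b (p x) / (1 + \<rho>) - log b (A \<rho> (fst x)))"
        unfolding su by simp
    qed
    finally show ?thesis unfolding H_def by simp
  qed
  have kl: "kl_div b (Y \<times> Z) (Q \<rho>) p = ereal (\<rho> * H \<rho> - log b (N \<rho>))" if \<rho>: "\<rho> \<ge> 0" for \<rho>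
  proof -
    have "kl_div b (Y \<times> Z) (Q \<rho>) p = (\<Sum>x\<in>Y \<times> Z. ereal (if x \<in> S then Q \<rho> x * log b (Q \<rho> x / p x) else 0))"
      unfolding kl_div_def
    proof (rule sum.cong[OF refl])
      fix x assume x: "x \<in> Y \<times> Z"
      show "(if Q \<rho> x = 0 then 0 else if p x = 0 then \<infinity> else ereal (Q \<rho> x * log b (Q \<rho> x / p x)))
          = ereal (if x \<in> S then Q \<rho> x * log b (Q \<rho> x / p x) else 0)"
        using Q_pos[of x \<rho>] Q_zero[OF x] by (cases "x \<in> S") (auto simp: S_def)
    qed
    also have "\<dots> = ereal (\<Sum>x\<in>Y \<times> Z. if x \<in> S then Q \<rho> x * log b (Q \<rho> x / p x) else 0)" by simp
    also have "(\<Sum>x\<in>Y \<times> Z. if x \<in> S then Q \<rho> x * log b (Q \<rho> x / p x) else 0)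
       = (\<Sum>x\<in>S. Q \<rho> x * log b (Q \<rho> x / p x))"
      using fin by (subst sum.inter_restrict[symmetric]) (auto intro!: sum.cong simp: S_def)
    also have "\<dots> = (\<Sum>x\<in>S. - \<rho> * (Q \<rho> x * (log b (p x) / (1 + \<rho>) - log b (A \<rho> (fst x))))
                              - log b (N \<rho>) * Q \<rho> x)"
    proof (rule sum.cong[OF refl])
      fix x assume x: "x \<in> S"
      obtain s u where su: "x = (s, u)" by (cases x)
      have As: "A \<rho> s > 0" using A_pos[OF x, of \<rho>] su by simp
      have px: "p (s, u) > 0" using x su by (simp add: S_def)
      have "log b (Q \<rho> x / p x) = \<rho> * log b (A \<rho> s) + log b (p x) / (1 + \<rho>) - log b (N \<rho>) - log b (p x)"
        unfolding su Q_def using As px N_pos[of \<rho>] b by (simp add: log_divide log_mult log_powr)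
      \<comment> \<open>Since 1/(1+\<rho>) - 1 = -\<rho>/(1+\<rho>), the log ratio is -\<rho> times
        the log of the conditional probability, up to the normalisation; averaging the former gives
        the divergence, the latter the entropy.\<close>
      also have "\<dots> = - \<rho> * (log b (p x) / (1 + \<rho>) - log b (A \<rho> s)) - log b (N \<rho>)"
        using \<rho> by (simp add: field_simps)
      finally have eq: "log b (Q \<rho> x / p x) = - \<rho> * (log b (p x) / (1 + \<rho>) - log b (A \<rho> s)) - log b (N \<rho>)" .
      show "Q \<rho> x * log b (Q \<rho> x / p x) =
         - \<rho> * (Q \<rho> x * (log b (p x) / (1 + \<rho>) - log b (A \<rho> (fst x)))) - log b (N \<rho>) * Q \<rho> x"
        unfolding eq by (simp add: su right_diff_distrib mult_ac)
    qed
    also have "\<dots> = \<rho> * H \<rho> - log b (N \<rho>)"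
      unfolding H_def sum_subtractf using Q_sumS[of \<rho>]
      by (simp flip: sum_distrib_left add: sum_negf)
    finally show ?thesis .
  qed
  \<comment> \<open>With \<open>H 0\<close> nonnegative, a <= 0 forces a <= \<open>H 0\<close>, the
    case in which \<rho> = 0 is chosen.\<close>
  have H0: "H 0 \<ge> 0"
  proof -
    have "Q 0 x * (log b (p x) / (1 + 0) - log b (A 0 (fst x))) \<le> 0" if x: "x \<in> S" for x
    proof -
      have "p x \<le> A 0 (fst x)" using A_ge[of "snd x" "fst x" 0] x by (auto simp: S_def)
      then have "log b (p x) \<le> log b (A 0 (fst x))"
        using x b by (auto simp: S_def)
      then show ?thesis using Q_nonneg[of 0 x] by (simp add: mult_nonneg_nonpos)
    qed
    then have "(\<Sum>x\<in>S. Q 0 x * (log b (p x) / (1 + 0) - log b (A 0 (fst x)))) \<le> 0"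
      by (rule sum_nonpos)
    then show ?thesis unfolding H_def by simp
  qed
  have contA: "continuous_on {0..1} (\<lambda>\<rho>. A \<rho> s)" for s
    unfolding A_def
  proof (rule continuous_on_sum)
    fix u
    show "continuous_on {0..1} (\<lambda>\<rho>. p (s, u) powr (1 / (1 + \<rho>)))"
      by (cases "p (s, u) = 0") (auto intro!: continuous_intros)
  qed
  \<comment> \<open>For each s, \<open>A \<rho> s\<close> is either positive for every \<rho> or
    identically zero, so continuity of \<open>powr\<close> at base 0 never arises.\<close>
  have Apow: "A \<rho> s = 0" if "s \<in> Y" "s \<notin> fst ` S" for \<rho> s
  proof -
    have "p (s, u) = 0" if "u \<in> Z" for u
      using zero[of "(s, u)"] that \<open>s \<in> Y\<close> \<open>s \<notin> fst ` S\<close> by (force simp: image_iff)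
    then show ?thesis by (simp add: A_def)
  qed
  have contN: "continuous_on {0..1} N"
    unfolding N_def
  proof (rule continuous_on_sum)
    fix s assume s: "s \<in> Y"
    show "continuous_on {0..1} (\<lambda>\<rho>. A \<rho> s powr (1 + \<rho>))"
    proof (cases "s \<in> fst ` S")
      case True
      then have "A \<rho> s \<noteq> 0" for \<rho> using A_pos[of _ \<rho>] by force
      then show ?thesis by (intro continuous_intros contA) auto
    qed (use Apow[OF s] in simp)
  qed
  have contH: "continuous_on {0..1} H"
    unfolding H_def
  proof (intro continuous_on_minus continuous_on_sum)
    fix x assume x: "x \<in> S"
    obtain s u where su: "x = (s, u)" by (cases x)
    have As: "A \<rho> s \<noteq> 0" "A \<rho> s > 0" for \<rho> using A_pos[OF x, of \<rho>] su by auto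
    have px: "p (s, u) > 0" using x su by (simp add: S_def)
    show "continuous_on {0..1} (\<lambda>\<rho>. Q \<rho> x * (log b (p x) / (1 + \<rho>) - log b (A \<rho> (fst x))))"
      unfolding su Q_def log_def using As px b N_pos
      by (auto intro!: continuous_intros contA contN simp: less_imp_neq[symmetric])
  qed
  \<comment> \<open>Only an upper bound on the infimum is needed, so a single test distribution
    suffices.\<close>
  have main: "(INF P' \<in> distributions (Y \<times> Z). kl_div b (Y \<times> Z) P' p +
        ereal (posp (a - cond_ent b Y Z (cond_rev P' Z) (qbar P' Z)))) \<le> ereal (\<rho> * a - log b (N \<rho>))"
    if \<rho>: "\<rho> \<ge> 0" and eq: "posp (a - H \<rho>) = \<rho> * (a - H \<rho>)" for \<rho>
  proof -
    have "(INF P' \<in> distributions (Y \<times> Z). kl_div b (Y \<times> Z) P' p +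
        ereal (posp (a - cond_ent b Y Z (cond_rev P' Z) (qbar P' Z))))
       \<le> kl_div b (Y \<times> Z) (Q \<rho>) p + ereal (posp (a - cond_ent b Y Z (cond_rev (Q \<rho>) Z) (qbar (Q \<rho>) Z)))"
      by (rule INF_lower[OF Q_dist])
    also have "\<dots> = ereal (\<rho> * a - log b (N \<rho>))"
      unfolding ent kl[OF \<rho>] eq by (simp add: algebra_simps)
    finally show ?thesis .
  qed
  \<comment> \<open>If a <= \<open>H 0\<close>, the positive part is 0 and \<rho> = 0 works; if a >=
    \<open>H 1\<close>, it may be taken with \<rho> = 1; in between, some \<rho> has
    \<open>H \<rho>\<close> = a and both sides vanish.\<close>
  have "\<exists>\<rho>. 0 \<le> \<rho> \<and> \<rho> \<le> 1 \<and> (a \<le> 0 \<longrightarrow> \<rho> = 0) \<and> posp (a - H \<rho>) = \<rho> * (a - H \<rho>)"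
  proof (cases "a \<le> H 0")
    case True
    then show ?thesis by (intro exI[of _ 0]) (auto simp: posp_def)
  next
    case F: False
    show ?thesis
    proof (cases "H 1 \<le> a")
      case True
      then show ?thesis using F H0 by (intro exI[of _ 1]) (auto simp: posp_def)
    next
      case False
      then obtain \<rho> where "0 \<le> \<rho>" "\<rho> \<le> 1" "H \<rho> = a"
        using IVT'[of H 0 a 1] contH F by auto
      then show ?thesis using F H0 by (intro exI[of _ \<rho>]) (auto simp: posp_def)
    qed
  qed
  then show ?thesis using main unfolding N_def A_def by blast
qed

section \<open>Gallager's union bound averaged over a random code\<close>

lemma min_one_le_powr:
  fixes t \<rho> :: real
  assumes "t > 0" "0 \<le> \<rho>" "\<rho> \<le> 1"
  shows "min 1 t \<le> t powr \<rho>"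
proof (cases "t \<ge> 1")
  case True
  then show ?thesis using ge_one_powr_ge_zero[of t \<rho>] assms by simp
next
  case False
  then have "t powr 1 \<le> t powr \<rho>" using assms by (intro powr_mono') auto
  then show ?thesis using assms False by simp
qed

text \<open>Averaging argument: if every w exceeded the bound, so would the sum over \<Omega>. A
  pair (s, u) counts as a failure when a confusable u' is at least as likely under the same s, and a
  union bound over such u' involves \<open>bad\<close> for one pair at a time.\<close>

lemma random_coding:
  fixes p :: "'a \<times> 'b \<Rightarrow> real" and bad :: "'w \<Rightarrow> 'b \<Rightarrow> 'b \<Rightarrow> bool" and c \<rho> :: real
  assumes fin: "finite A" "finite U" "finite \<Omega>" and ne: "\<Omega> \<noteq> {}"
    and nonneg: "\<And>x. x \<in> A \<times> U \<Longrightarrow> p x \<ge> 0" and c: "c > 0" and \<rho>: "0 \<le> \<rho>" "\<rho> \<le> 1"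
    and bad: "\<And>u u'. u \<in> U \<Longrightarrow> u' \<in> U \<Longrightarrow> u \<noteq> u' \<Longrightarrow>
       real (card {w \<in> \<Omega>. bad w u u'}) \<le> c * real (card \<Omega>)"
  shows "\<exists>w\<in>\<Omega>. sum p {(s, u) \<in> A \<times> U. \<exists>u'\<in>U. u' \<noteq> u \<and> p (s, u) \<le> p (s, u') \<and> bad w u u'}
    \<le> c powr \<rho> * (\<Sum>s\<in>A. (\<Sum>u\<in>U. p (s, u) powr (1 / (1 + \<rho>))) powr (1 + \<rho>))"
proof (rule ccontr)
  define \<sigma> where "\<sigma> = 1 / (1 + \<rho>)"
  define B where "B = (\<lambda>s. \<Sum>u\<in>U. p (s, u) powr \<sigma>)"
  define fail where "fail = (\<lambda>w x. \<exists>u'\<in>U. u' \<noteq> snd x \<and> p x \<le> p (fst x, u') \<and> bad w (snd x) u')"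
  let ?R = "c powr \<rho> * (\<Sum>s\<in>A. B s powr (1 + \<rho>))"
  let ?n = "real (card \<Omega>)"
  assume "\<not> ?thesis"
  then have gt: "?R < sum p {x \<in> A \<times> U. fail w x}" if "w \<in> \<Omega>" for w
    using that unfolding fail_def B_def \<sigma>_def by (auto simp: case_prod_unfold not_le mem_Times_iff)
  have pt: "p x * real (card {w \<in> \<Omega>. fail w x})
      \<le> ?n * c powr \<rho> * (B (fst x) powr \<rho> * p x powr \<sigma>)" if x: "x \<in> A \<times> U" for x
  proof (cases "p x = 0")
    case True
    then show ?thesis by simp
  next
    case False
    then have px: "p x > 0" using nonneg[OF x] by simp
    obtain s u where su: "x = (s, u)" "s \<in> A" "u \<in> U" using x by auto
    define t where "t = c * B s / p x powr \<sigma>"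
    have "0 < p x powr \<sigma>" using px by simp
    also have "\<dots> \<le> B s" unfolding B_def su(1) using su fin by (intro member_le_sum) auto
    finally have Bpos: "B s > 0" .
    have tpos: "t > 0" unfolding t_def using c Bpos px by simp
    have "card {w \<in> \<Omega>. fail w x} \<le> card (\<Union>u'\<in>{u'\<in>U. u' \<noteq> u \<and> p x \<le> p (s, u')}. {w \<in> \<Omega>. bad w u u'})"
      unfolding fail_def su by (rule card_mono) (use fin in auto)
    also have "\<dots> \<le> (\<Sum>u'\<in>{u'\<in>U. u' \<noteq> u \<and> p x \<le> p (s, u')}. card {w \<in> \<Omega>. bad w u u'})"
      by (rule card_UN_le) (use fin in auto)
    finally have "real (card {w \<in> \<Omega>. fail w x})
       \<le> real (\<Sum>u'\<in>{u'\<in>U. u' \<noteq> u \<and> p x \<le> p (s, u')}. card {w \<in> \<Omega>. bad w u u'})"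
      by (simp only: of_nat_le_iff)
    also have "\<dots> = (\<Sum>u'\<in>{u'\<in>U. u' \<noteq> u \<and> p x \<le> p (s, u')}. real (card {w \<in> \<Omega>. bad w u u'}))"
      by (rule of_nat_sum)
    \<comment> \<open>A competitor is at least as likely as x, so the inserted ratio is at least 1.
      It makes it possible to extend the sum to all of \<open>U\<close> without losing the
      exponent.\<close>
    also have "\<dots> \<le> (\<Sum>u'\<in>{u'\<in>U. u' \<noteq> u \<and> p x \<le> p (s, u')}. c * ?n * (p (s, u') powr \<sigma> / p x powr \<sigma>))"
    proof (rule sum_mono)
      fix u' assume u': "u' \<in> {u'\<in>U. u' \<noteq> u \<and> p x \<le> p (s, u')}"
      have "p x powr \<sigma> \<le> p (s, u') powr \<sigma>"
        using u' px \<rho> by (intro powr_mono2) (auto simp: \<sigma>_def)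
      then have "1 \<le> p (s, u') powr \<sigma> / p x powr \<sigma>" using px by simp
      then have "c * ?n * 1 \<le> c * ?n * (p (s, u') powr \<sigma> / p x powr \<sigma>)"
        using c by (intro mult_left_mono) auto
      moreover have "real (card {w \<in> \<Omega>. bad w u u'}) \<le> c * ?n" using u' su by (intro bad) auto
      ultimately show "real (card {w \<in> \<Omega>. bad w u u'}) \<le> c * ?n * (p (s, u') powr \<sigma> / p x powr \<sigma>)"
        by simp
    qed
    also have "\<dots> \<le> (\<Sum>u'\<in>U. c * ?n * (p (s, u') powr \<sigma> / p x powr \<sigma>))"
      using c fin by (intro sum_mono2) auto
    also have "\<dots> = ?n * t" unfolding t_def B_def
      by (simp add: sum_distrib_left sum_divide_distrib mult_ac)
    finally have le1: "real (card {w \<in> \<Omega>. fail w x}) \<le> ?n * t" .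
    have "card {w \<in> \<Omega>. fail w x} \<le> card \<Omega>" using fin by (intro card_mono) auto
    with le1 have "real (card {w \<in> \<Omega>. fail w x}) \<le> ?n * min 1 t" by (simp add: min_def)
    \<comment> \<open>A probability is at most min(1, t), and \<rho> interpolates between the
      trivial bound (\<rho> = 0) and the union bound (\<rho> = 1).\<close>
    also have "\<dots> \<le> ?n * t powr \<rho>" using min_one_le_powr[OF tpos \<rho>] by (intro mult_left_mono) auto
    finally have "p x * real (card {w \<in> \<Omega>. fail w x}) \<le> p x * (?n * t powr \<rho>)"
      using px by (intro mult_left_mono) auto
    also have "t powr \<rho> = c powr \<rho> * B s powr \<rho> / p x powr (\<sigma> * \<rho>)"
      unfolding t_def using c Bpos px by (simp add: powr_divide powr_mult powr_powr)
    also have "p x * (?n * (c powr \<rho> * B s powr \<rho> / p x powr (\<sigma> * \<rho>)))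
       = ?n * c powr \<rho> * (B s powr \<rho> * (p x powr 1 / p x powr (\<sigma> * \<rho>)))"
      using px by simp
    also have "p x powr 1 / p x powr (\<sigma> * \<rho>) = p x powr (1 - \<sigma> * \<rho>)"
      by (rule powr_diff[symmetric])
    \<comment> \<open>The value \<sigma> = 1/(1+\<rho>) is the one for which the remaining exponent
      of \<open>p x\<close> is again \<sigma>, so that summing over u reproduces
      \<open>B s\<close>.\<close>
    also have "1 - \<sigma> * \<rho> = \<sigma>" unfolding \<sigma>_def using \<rho> by (simp add: field_simps)
    finally show ?thesis unfolding su by simp
  qed
  have "?n * ?R = (\<Sum>w\<in>\<Omega>. ?R)" by simp
  also have "\<dots> < (\<Sum>w\<in>\<Omega>. sum p {x \<in> A \<times> U. fail w x})"
    using fin ne gt by (intro sum_strict_mono) auto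
  also have "\<dots> = (\<Sum>w\<in>\<Omega>. \<Sum>x\<in>A \<times> U. if fail w x then p x else 0)"
    by (rule sum.cong[OF refl sum.inter_filter]) (use fin in simp)
  also have "\<dots> = (\<Sum>x\<in>A \<times> U. \<Sum>w\<in>\<Omega>. if fail w x then p x else 0)" by (rule sum.swap)
  also have "\<dots> = (\<Sum>x\<in>A \<times> U. p x * real (card {w \<in> \<Omega>. fail w x}))"
    using fin by (intro sum.cong[OF refl]) (simp add: sum.inter_filter[symmetric])
  also have "\<dots> \<le> (\<Sum>x\<in>A \<times> U. ?n * c powr \<rho> * (B (fst x) powr \<rho> * p x powr \<sigma>))"
    by (rule sum_mono[OF pt])
  also have "\<dots> = ?n * c powr \<rho> * (\<Sum>s\<in>A. \<Sum>u\<in>U. B s powr \<rho> * p (s, u) powr \<sigma>)"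
    by (simp add: sum_distrib_left sum.cartesian_product case_prod_unfold)
  also have "(\<Sum>s\<in>A. \<Sum>u\<in>U. B s powr \<rho> * p (s, u) powr \<sigma>) = (\<Sum>s\<in>A. B s powr (1 + \<rho>))"
  proof (rule sum.cong[OF refl])
    fix s
    have "B s \<ge> 0" unfolding B_def by (simp add: sum_nonneg)
    then have "B s powr \<rho> * B s = B s powr (1 + \<rho>)" by (cases "B s = 0") (auto simp: powr_add)
    then show "(\<Sum>u\<in>U. B s powr \<rho> * p (s, u) powr \<sigma>) = B s powr (1 + \<rho>)"
      unfolding B_def by (simp add: sum_distrib_left)
  qed
  finally show False by simp
qed

section \<open>Random symmetric matrices over the prime field\<close>

lemma finite_vecs [simp]: "finite (vecs d m)"
  and card_vecs: "card (vecs d m) = d ^ m"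
proof -
  have b: "bij_betw (\<lambda>v. restrict v {..<m}) (vecs d m) (PiE {..<m} (\<lambda>_. {..<d}))"
    by (rule bij_betw_byWitness[where f' = "\<lambda>f i. if i < m then f i else 0"])
      (auto simp: vecs_def fun_eq_iff PiE_def extensional_def)
  show "finite (vecs d m)" using bij_betw_finite[OF b] by (simp add: finite_PiE)
  show "card (vecs d m) = d ^ m" using bij_betw_same_card[OF b] by (simp add: card_PiE)
qed

text \<open>Entries are canonical residues and vanish off the N by N square, so these functions
  correspond one to one to symmetric matrices over the field and can be counted.\<close>

definition sym_mats :: "nat \<Rightarrow> nat \<Rightarrow> (nat \<Rightarrow> nat \<Rightarrow> int) set" where
  "sym_mats d N = {S. (\<forall>i j. S i j = S j i) \<and> (\<forall>i<N. \<forall>j<N. 0 \<le> S i j \<and> S i j < int d)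
     \<and> (\<forall>i j. N \<le> i \<or> N \<le> j \<longrightarrow> S i j = 0)}"

definition matvec :: "nat \<Rightarrow> (nat \<Rightarrow> nat \<Rightarrow> int) \<Rightarrow> (nat \<Rightarrow> int) \<Rightarrow> nat \<Rightarrow> int" where
  "matvec N S x i = (\<Sum>j<N. S i j * x j)"

lemma finite_sym_mats: "finite (sym_mats d N)"
proof -
  have inj: "inj_on (\<lambda>S. \<lambda>(i, j)\<in>{..<N} \<times> {..<N}. S i j) (sym_mats d N)"
  proof (rule inj_onI, intro ext)
    fix S T i j assume *: "S \<in> sym_mats d N" "T \<in> sym_mats d N"
      and eq: "(\<lambda>(i, j)\<in>{..<N} \<times> {..<N}. S i j) = (\<lambda>(i, j)\<in>{..<N} \<times> {..<N}. T i j)"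
    show "S i j = T i j"
    proof (cases "i < N \<and> j < N")
      case True
      then show ?thesis using fun_cong[OF eq, of "(i, j)"] by simp
    next
      case False
      then have "N \<le> i \<or> N \<le> j" by auto
      then have "S i j = 0" "T i j = 0" using * unfolding sym_mats_def by blast+
      then show ?thesis by simp
    qed
  qed
  have sub: "(\<lambda>S. \<lambda>(i, j)\<in>{..<N} \<times> {..<N}. S i j) ` sym_mats d N
      \<subseteq> PiE ({..<N} \<times> {..<N}) (\<lambda>_. {0..<int d})"
    by (intro image_subsetI PiE_I) (auto simp: sym_mats_def)
  show ?thesis
    by (rule finite_imageD[OF finite_subset[OF sub finite_PiE] inj]) auto
qed

lemma zero_in_sym_mats: "d > 0 \<Longrightarrow> (\<lambda>_ _. 0) \<in> sym_mats d N"
  by (simp add: sym_mats_def)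

text \<open>With e the unit vector at \<open>i0\<close> and y the inverse of \<open>x i0\<close>,
  the matrix y (v e^T + e v^T) - y^2 (v . x) e e^T works: its first term sends x to v, and the last
  one cancels the multiple of e that symmetrising has added.\<close>

lemma symmetric_matvec_surj:
  assumes d: "prime d" and i0: "i0 < N" "\<not> int d dvd x i0"
  obtains S :: "nat \<Rightarrow> nat \<Rightarrow> int"
  where "\<And>i j. S i j = S j i" "\<And>i. i < N \<Longrightarrow> [matvec N S x i = v i] (mod int d)"
proof -
  have "coprime (x i0) (int d)"
    using d i0 by (metis coprime_commute prime_imp_coprime prime_nat_int_transfer)
  then obtain y where y: "[x i0 * y = 1] (mod int d)"
    using cong_solve_coprime_int by blast
  define q where "q = (\<Sum>j<N. v j * x j)"
  define S where "S = (\<lambda>i j. y * (v i * of_bool (j = i0) + of_bool (i = i0) * v j)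
      - y * y * q * of_bool (i = i0) * of_bool (j = i0))"
  have "[matvec N S x i = v i] (mod int d)" if "i < N" for i
  proof -
    have "matvec N S x i = (\<Sum>j<N. y * v i * (of_bool (j = i0) * x j) + y * of_bool (i = i0) * (v j * x j)
         - y * y * q * of_bool (i = i0) * (of_bool (j = i0) * x j))"
      unfolding matvec_def S_def by (intro sum.cong refl) (simp add: algebra_simps)
    also have "\<dots> = y * v i * x i0 + y * of_bool (i = i0) * q - y * y * q * of_bool (i = i0) * x i0"
      unfolding sum.distrib sum_subtractf sum_distrib_left[symmetric] q_def[symmetric]
      using i0 by (simp add: of_bool_def if_distrib[of "\<lambda>t. t * _"] cong: if_cong)
    also have "\<dots> = (x i0 * y) * v i + (1 - x i0 * y) * (y * of_bool (i = i0) * q)"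
      by (simp add: algebra_simps)
    also have "[\<dots> = 1 * v i + (1 - 1) * (y * of_bool (i = i0) * q)] (mod int d)"
      by (intro cong_add cong_mult cong_diff cong_refl y)
    finally show ?thesis by simp
  qed
  then show thesis by (intro that[of S]) (auto simp: S_def algebra_simps)
qed

text \<open>Adding a symmetric V with V x = v maps the fibre over t injectively into the fibre over
  t + v. The d^N fibres obtained this way are disjoint, and none is smaller than the one over
  t.\<close>

lemma card_sym_mats_matvec_eq:
  assumes d: "prime d" and i0: "i0 < N" "\<not> int d dvd x i0"
  shows "card {S \<in> sym_mats d N. \<forall>i<N. [matvec N S x i = t i] (mod int d)} * d ^ N \<le> card (sym_mats d N)"
proof -
  define F where "F = (\<lambda>t. {S \<in> sym_mats d N. \<forall>i<N. [matvec N S x i = t i] (mod int d)})"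
  have d0: "int d > 0" using d prime_gt_0_nat by simp
  have finF: "finite (F t)" for t unfolding F_def using finite_sym_mats by auto
  have le: "card (F t) \<le> card (F (\<lambda>i. t i + int (v i)))" for v :: "nat \<Rightarrow> nat"
  proof -
    obtain V where Vs: "\<And>i j. V i j = V j i"
      and V: "\<And>i. i < N \<Longrightarrow> [matvec N V x i = int (v i)] (mod int d)"
      using symmetric_matvec_surj[OF d, of i0 N x "\<lambda>i. int (v i)"] i0 by blast
    define f where "f = (\<lambda>(S :: nat \<Rightarrow> nat \<Rightarrow> int) i j. if i < N \<and> j < N then (S i j + V i j) mod int d else 0)"
    have "inj_on f (F t)"
    proof (rule inj_onI, intro ext)
      fix S T i j assume ST: "S \<in> F t" "T \<in> F t" and eq: "f S = f T"
      show "S i j = T i j"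
      proof (cases "i < N \<and> j < N")
        case True
        have "[S i j + V i j = T i j + V i j] (mod int d)"
          using fun_cong[OF fun_cong[OF eq, of i], of j] True by (simp add: f_def cong_def)
        then have "[S i j = T i j] (mod int d)" by (simp add: cong_add_rcancel)
        moreover have "0 \<le> S i j" "S i j < int d" "0 \<le> T i j" "T i j < int d"
          using ST True unfolding F_def sym_mats_def by blast+
        ultimately show ?thesis by (simp add: cong_def)
      next
        case False
        then have "N \<le> i \<or> N \<le> j" by auto
        then have "S i j = 0" "T i j = 0" using ST unfolding F_def sym_mats_def by blast+
        then show ?thesis by simp
      qed
    qed
    moreover have "f ` F t \<subseteq> F (\<lambda>i. t i + int (v i))"
    proof
      fix T assume "T \<in> f ` F t"
      then obtain S where S: "S \<in> F t" and T: "T = f S" by auto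
      have "T \<in> sym_mats d N"
        using S d0 Vs unfolding T f_def F_def sym_mats_def by auto
      moreover have "[matvec N T x i = t i + int (v i)] (mod int d)" if i: "i < N" for i
      proof -
        have "[matvec N T x i = (\<Sum>j<N. (S i j + V i j) * x j)] (mod int d)"
          unfolding matvec_def T f_def using i by (intro cong_sum cong_mult) (auto simp: cong_def)
        also have "(\<Sum>j<N. (S i j + V i j) * x j) = matvec N S x i + matvec N V x i"
          by (simp add: matvec_def algebra_simps sum.distrib)
        also have "[\<dots> = t i + int (v i)] (mod int d)"
          using S i V by (intro cong_add) (auto simp: F_def)
        finally show ?thesis .
      qed
      ultimately show "T \<in> F (\<lambda>i. t i + int (v i))" by (simp add: F_def)
    qed
    ultimately show ?thesis using finF card_inj_on_le by blast
  qed
  have disj: "F (\<lambda>i. t i + int (v i)) \<inter> F (\<lambda>i. t i + int (v' i)) = {}"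
    if "v \<in> vecs d N" "v' \<in> vecs d N" "v \<noteq> v'" for v v'
  proof (rule ccontr)
    assume "\<not> ?thesis"
    then obtain S where S: "S \<in> F (\<lambda>i. t i + int (v i))" "S \<in> F (\<lambda>i. t i + int (v' i))" by blast
    have "v i = v' i" for i
    proof (cases "i < N")
      case True
      have "[t i + int (v i) = t i + int (v' i)] (mod int d)"
        using S True cong_trans[OF cong_sym] unfolding F_def by blast
      then have "[int (v i) = int (v' i)] (mod int d)" by (simp add: cong_add_lcancel)
      then show ?thesis using that True by (auto simp: vecs_def cong_int_iff cong_def)
    qed (use that in \<open>auto simp: vecs_def\<close>)
    then have "v = v'" by (rule ext)
    then show False using that by simp
  qed
  have "card (F t) * d ^ N = (\<Sum>v\<in>vecs d N. card (F t))" by (simp add: card_vecs)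
  also have "\<dots> \<le> (\<Sum>v\<in>vecs d N. card (F (\<lambda>i. t i + int (v i))))" by (rule sum_mono[OF le])
  also have "\<dots> = card (\<Union>v\<in>vecs d N. F (\<lambda>i. t i + int (v i)))"
    by (rule card_UN_disjoint[symmetric]) (use finF disj finite_vecs in blast)+
  also have "\<dots> \<le> card (sym_mats d N)"
    by (rule card_mono[OF finite_sym_mats]) (auto simp: F_def)
  finally show ?thesis unfolding F_def .
qed

text \<open>The second component of (w, z) after the maps (w, z) -> (w + T z, z) and (w, z) -> (w, z
  + S w), each symplectic for symmetric matrices. Values are left unreduced.\<close>

definition shear :: "nat \<Rightarrow> (nat \<Rightarrow> nat \<Rightarrow> int) \<Rightarrow> (nat \<Rightarrow> nat \<Rightarrow> int) \<Rightarrow> (nat \<Rightarrow> int) \<Rightarrow> (nat \<Rightarrow> int) \<Rightarrow> nat \<Rightarrow> int" where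
  "shear N S T w z i = z i + matvec N S (\<lambda>j. w j + matvec N T z j) i"

text \<open>For z nonzero, T z hits -w for at most a fraction d^-N of the T; for z = 0, w + T z = w
  is nonzero anyway. Once w + T z is nonzero, S sends it to each value with frequency at most d^-N,
  and d^K values leave only the first K entries of t free.\<close>

lemma card_shear_vanishing:
  assumes d: "prime d" and K: "K \<le> N"
    and nz: "\<exists>i<N. \<not> int d dvd w i \<or> \<not> int d dvd z i"
  shows "real (card {(S, T) \<in> sym_mats d N \<times> sym_mats d N. \<forall>i. K \<le> i \<and> i < N \<longrightarrow> int d dvd shear N S T w z i})
     \<le> 2 * real d ^ K / real d ^ N * real (card (sym_mats d N \<times> sym_mats d N))"
proof -
  let ?M = "sym_mats d N"
  let ?Y = "\<lambda>T j. w j + matvec N T z j"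
  let ?Bad = "{(S, T) \<in> ?M \<times> ?M. \<forall>i. K \<le> i \<and> i < N \<longrightarrow> int d dvd shear N S T w z i}"
  define V where "V = {T \<in> ?M. \<forall>i<N. int d dvd ?Y T i}"
  define G where "G = (\<lambda>T. {S \<in> ?M. \<forall>i. K \<le> i \<and> i < N \<longrightarrow> int d dvd shear N S T w z i})"
  have d0: "d > 0" using d prime_gt_0_nat by simp
  have fin: "finite ?M" by (rule finite_sym_mats)
  have cV: "card V * d ^ N \<le> card ?M"
  proof (cases "\<exists>i<N. \<not> int d dvd z i")
    case True
    then obtain i0 where i0: "i0 < N" "\<not> int d dvd z i0" by auto
    have "V \<subseteq> {S \<in> ?M. \<forall>i<N. [matvec N S z i = - w i] (mod int d)}"
      unfolding V_def by (auto simp: cong_iff_dvd_diff add.commute)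
    then have "card V \<le> card {S \<in> ?M. \<forall>i<N. [matvec N S z i = - w i] (mod int d)}"
      using fin by (intro card_mono) auto
    then show ?thesis using card_sym_mats_matvec_eq[OF d, of i0 N z "\<lambda>i. - w i"] i0
      by (meson le_trans mult_le_mono1)
  next
    case False
    then obtain i0 where i0: "i0 < N" "\<not> int d dvd w i0" using nz by auto
    have "int d dvd matvec N T z i0" for T
      unfolding matvec_def using False by (intro dvd_sum) auto
    then have "\<not> int d dvd ?Y T i0" for T using i0 by (simp add: dvd_add_left_iff)
    then have "V = {}" using i0 unfolding V_def by auto
    then show ?thesis by simp
  qed
  have cG: "card (G T) * d ^ N \<le> d ^ K * card ?M" if T: "T \<in> ?M - V" for T
  proof -
    from T obtain i0 where i0: "i0 < N" "\<not> int d dvd ?Y T i0" unfolding V_def by auto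
    let ?F = "\<lambda>t. {S \<in> ?M. \<forall>i<N. [matvec N S (?Y T) i = int (t i) - z i] (mod int d)}"
    have "G T \<subseteq> (\<Union>t\<in>vecs d K. ?F t)"
    proof
      fix S assume S: "S \<in> G T"
      \<comment> \<open>The shear of a bad S is determined by its first K residues; they index the
        d^K fibres that cover \<open>G T\<close>.\<close>
      define t where "t = (\<lambda>i. if i < K then nat (shear N S T w z i mod int d) else 0)"
      have "t \<in> vecs d K" unfolding t_def vecs_def using d0 by (auto simp: nat_less_iff)
      moreover have "[matvec N S (?Y T) i = int (t i) - z i] (mod int d)" if "i < N" for i
      proof -
        have "[shear N S T w z i = int (t i)] (mod int d)"
          using S that d0 by (cases "i < K") (auto simp: t_def G_def cong_def)
        then have "[shear N S T w z i - z i = int (t i) - z i] (mod int d)" by (intro cong_diff) auto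
        then show ?thesis by (simp add: shear_def)
      qed
      ultimately show "S \<in> (\<Union>t\<in>vecs d K. ?F t)" using S by (auto simp: G_def)
    qed
    then have "card (G T) \<le> card (\<Union>t\<in>vecs d K. ?F t)" using fin by (intro card_mono) auto
    also have "\<dots> \<le> (\<Sum>t\<in>vecs d K. card (?F t))" by (rule card_UN_le) simp
    finally have "card (G T) * d ^ N \<le> (\<Sum>t\<in>vecs d K. card (?F t) * d ^ N)"
      by (simp flip: sum_distrib_right)
    also have "\<dots> \<le> (\<Sum>t\<in>vecs d K. card ?M)"
      using i0 by (intro sum_mono card_sym_mats_matvec_eq[OF d])
    finally show ?thesis by (simp add: card_vecs)
  qed
  have "?Bad \<subseteq> (?M \<times> V) \<union> (\<Union>T\<in>?M - V. G T \<times> {T})" by (auto simp: G_def)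
  then have "card ?Bad \<le> card ((?M \<times> V) \<union> (\<Union>T\<in>?M - V. G T \<times> {T}))"
    using fin by (intro card_mono) (auto simp: V_def G_def)
  also have "\<dots> \<le> card (?M \<times> V) + card (\<Union>T\<in>?M - V. G T \<times> {T})" by (rule card_Un_le)
  also have "\<dots> \<le> card ?M * card V + (\<Sum>T\<in>?M - V. card (G T \<times> {T}))"
    using fin by (intro add_mono card_UN_le) (auto simp: card_cartesian_product)
  also have "\<dots> = card ?M * card V + (\<Sum>T\<in>?M - V. card (G T))"
    by (simp add: card_cartesian_product)
  finally have "card ?Bad * d ^ N \<le> (card ?M * card V + (\<Sum>T\<in>?M - V. card (G T))) * d ^ N"
    by (rule mult_le_mono1)
  also have "\<dots> = card ?M * (card V * d ^ N) + (\<Sum>T\<in>?M - V. card (G T) * d ^ N)"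
    by (simp add: add_mult_distrib sum_distrib_right mult.assoc)
  also have "\<dots> \<le> card ?M * card ?M + (\<Sum>T\<in>?M - V. d ^ K * card ?M)"
    by (intro add_mono mult_left_mono cV sum_mono cG) auto
  also have "(\<Sum>T\<in>?M - V. d ^ K * card ?M) \<le> card ?M * (d ^ K * card ?M)"
    using fin by (simp add: card_mono)
  \<comment> \<open>Source of the factor 2: the two failure counts have relative sizes 1 and d^K,
    and 1 + d^K <= 2 d^K.\<close>
  also have "card ?M * card ?M + card ?M * (d ^ K * card ?M) \<le> 2 * d ^ K * (card ?M * card ?M)"
  proof -
    have "1 * (card ?M * card ?M) \<le> d ^ K * (card ?M * card ?M)"
      using d0 by (intro mult_le_mono1) simp
    then show ?thesis by (simp add: mult_ac)
  qed
  finally have "card ?Bad * d ^ N \<le> 2 * d ^ K * (card ?M * card ?M)" by simp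
  then have "real (card ?Bad * d ^ N) \<le> real (2 * d ^ K * (card ?M * card ?M))"
    by (simp only: of_nat_le_iff)
  then have "real (card ?Bad) * real d ^ N \<le> 2 * real d ^ K * real (card (?M \<times> ?M))"
    by (simp only: card_cartesian_product of_nat_mult of_nat_power of_nat_numeral)
  then show ?thesis using d0 by (simp add: field_simps)
qed

section \<open>Fidelity of Kraus recoveries\<close>

lemma sum_rotate3: "(\<Sum>l\<in>A. \<Sum>i\<in>B. \<Sum>j\<in>C. f l i j) = (\<Sum>i\<in>B. \<Sum>j\<in>C. \<Sum>l\<in>A. f l i j)"
proof -
  have "(\<Sum>l\<in>A. \<Sum>i\<in>B. \<Sum>j\<in>C. f l i j) = (\<Sum>i\<in>B. \<Sum>l\<in>A. \<Sum>j\<in>C. f l i j)" by (rule sum.swap)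
  also have "\<dots> = (\<Sum>i\<in>B. \<Sum>j\<in>C. \<Sum>l\<in>A. f l i j)" by (rule sum.cong[OF refl sum.swap])
  finally show ?thesis .
qed

definition ip :: "nat \<Rightarrow> cvec \<Rightarrow> cvec \<Rightarrow> complex" where
  "ip D \<phi> \<psi> = (\<Sum>i<D. cnj (\<phi> i) * \<psi> i)"

definition mv :: "nat \<Rightarrow> cmat \<Rightarrow> cvec \<Rightarrow> cvec" where
  "mv D A \<psi> = (\<lambda>i. \<Sum>j<D. A i j * \<psi> j)"

lemma ip_self: "ip D \<psi> \<psi> = complex_of_real (\<Sum>i<D. (cmod (\<psi> i))\<^sup>2)"
  by (simp only: ip_def of_real_sum complex_norm_square mult.commute)

lemma ip_scale_right: "ip D \<phi> (\<lambda>r. c * \<psi> r) = c * ip D \<phi> \<psi>"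
  by (simp add: ip_def sum_distrib_left mult_ac)

lemma ip_scale_left: "ip D (\<lambda>r. c * \<phi> r) \<psi> = cnj c * ip D \<phi> \<psi>"
  by (simp add: ip_def sum_distrib_left mult_ac)

lemma ip_sum_right: "ip D \<phi> (\<lambda>r. \<Sum>a\<in>A. f a r) = (\<Sum>a\<in>A. ip D \<phi> (f a))"
  unfolding ip_def by (simp only: sum_distrib_left) (rule sum.swap)

lemma ip_cong: "(\<And>i. i < D \<Longrightarrow> \<phi> i = \<phi>' i) \<Longrightarrow> (\<And>i. i < D \<Longrightarrow> \<psi> i = \<psi>' i) \<Longrightarrow> ip D \<phi> \<psi> = ip D \<phi>' \<psi>'"
  by (simp add: ip_def)

lemma mv_cong: "(\<And>i. i < D \<Longrightarrow> \<psi> i = \<psi>' i) \<Longrightarrow> mv D A \<psi> = mv D A \<psi>'"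
  by (simp add: mv_def)

lemma ip_cauchy_schwarz:
  "(cmod (ip D \<phi> \<psi>))\<^sup>2 \<le> (\<Sum>i<D. (cmod (\<phi> i))\<^sup>2) * (\<Sum>i<D. (cmod (\<psi> i))\<^sup>2)"
proof -
  have "cmod (ip D \<phi> \<psi>) \<le> (\<Sum>i<D. cmod (\<phi> i) * cmod (\<psi> i))"
    unfolding ip_def by (rule order_trans[OF norm_sum]) (simp add: norm_mult)
  then have "(cmod (ip D \<phi> \<psi>))\<^sup>2 \<le> (\<Sum>i<D. cmod (\<phi> i) * cmod (\<psi> i))\<^sup>2"
    by (rule power_mono) simp
  also have "\<dots> \<le> (\<Sum>i<D. (cmod (\<phi> i))\<^sup>2) * (\<Sum>i<D. (cmod (\<psi> i))\<^sup>2)"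
    by (rule Cauchy_Schwarz_ineq_sum)
  finally show ?thesis .
qed

text \<open>Reduces conjugation of density matrices to the action on vectors; it serves both the
  channel and the Kraus recovery.\<close>

lemma conjugate_mixture:
  "mmul D (mmul D A (\<lambda>i j. \<Sum>x\<in>X. c x * (\<phi> x i * cnj (\<phi> x j)))) (adj A) i j
     = (\<Sum>x\<in>X. c x * (mv D A (\<phi> x) i * cnj (mv D A (\<phi> x) j)))"
proof -
  have 1: "mmul D A (\<lambda>i j. \<Sum>x\<in>X. c x * (\<phi> x i * cnj (\<phi> x j))) i l
      = (\<Sum>x\<in>X. c x * mv D A (\<phi> x) i * cnj (\<phi> x l))" for l
    unfolding mmul_def mv_def sum_distrib_left sum_distrib_right
    by (subst sum.swap) (simp add: mult_ac)
  have "mmul D (mmul D A (\<lambda>i j. \<Sum>x\<in>X. c x * (\<phi> x i * cnj (\<phi> x j)))) (adj A) i j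
     = (\<Sum>l<D. (\<Sum>x\<in>X. c x * mv D A (\<phi> x) i * cnj (\<phi> x l)) * cnj (A j l))"
    unfolding mmul_def[of D "mmul D A _"] 1 adj_def ..
  also have "\<dots> = (\<Sum>x\<in>X. \<Sum>l<D. c x * mv D A (\<phi> x) i * cnj (\<phi> x l) * cnj (A j l))"
    unfolding sum_distrib_right by (rule sum.swap)
  also have "\<dots> = (\<Sum>x\<in>X. c x * (mv D A (\<phi> x) i * cnj (mv D A (\<phi> x) j)))"
    unfolding mv_def by (simp add: sum_distrib_left mult_ac)
  finally show ?thesis .
qed

lemma chan_pure:
  "chan d \<omega> P M (\<lambda>a b. \<psi> a * cnj (\<psi> b)) = (\<lambda>i j. \<Sum>x\<in>vecs d (2*M). complex_of_real (prodP P M x) *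
     (mv (d^M) (pauli d \<omega> M x) \<psi> i * cnj (mv (d^M) (pauli d \<omega> M x) \<psi> j)))"
  \<comment> \<open>A pure state is the mixture over the one-element index set \<open>{()}\<close>
    with weight 1.\<close>
  unfolding chan_def using conjugate_mixture[of "d^M" _ "\<lambda>_. 1" "\<lambda>_. \<psi>" "{()}"] by simp

text \<open>The quantity minimised in the fidelity, rewritten as a weighted sum of squared
  amplitudes. For a nonnegative \<open>P\<close> all terms are nonnegative, so a lower bound may
  keep a single Kraus operator for each error.\<close>

definition fid_at :: "nat \<Rightarrow> complex \<Rightarrow> (nat \<times> nat \<Rightarrow> real) \<Rightarrow> nat \<Rightarrow> cmat list \<Rightarrow> cvec \<Rightarrow> real" where
  "fid_at d \<omega> P M Ks \<psi> = (\<Sum>x\<in>vecs d (2*M). prodP P M x *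
     (\<Sum>K\<leftarrow>Ks. (cmod (ip (d^M) \<psi> (mv (d^M) K (mv (d^M) (pauli d \<omega> M x) \<psi>))))\<^sup>2))"

lemma quadratic_form_pure:
  "(\<Sum>i<D. \<Sum>j<D. cnj (\<psi> i) * (u i * cnj (u j)) * \<psi> j) = complex_of_real ((cmod (ip D \<psi> u))\<^sup>2)"
proof -
  have "(\<Sum>i<D. \<Sum>j<D. cnj (\<psi> i) * (u i * cnj (u j)) * \<psi> j) = ip D \<psi> u * cnj (ip D \<psi> u)"
    unfolding ip_def cnj_sum sum_product by (intro sum.cong refl) (simp add: mult_ac)
  then show ?thesis by (simp only: complex_norm_square)
qed

lemma sum_list_sum_swap: "(\<Sum>K\<leftarrow>Ks. \<Sum>x\<in>X. f K x) = (\<Sum>x\<in>X. \<Sum>K\<leftarrow>Ks. f K x)"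
  by (induction Ks) (simp_all add: sum.distrib)

lemma of_real_sum_list: "complex_of_real (\<Sum>K\<leftarrow>Ks. f K) = (\<Sum>K\<leftarrow>Ks. complex_of_real (f K))"
  by (induction Ks) simp_all

lemma fidelity_eq:
  "fidelity (d^M) (chan d \<omega> P M) B Ks = Inf (fid_at d \<omega> P M Ks ` unit_vecs_of_code (d^M) B)"
proof -
  let ?D = "d^M"
  have "Re (\<Sum>i<?D. \<Sum>j<?D. cnj (\<psi> i) * kraus_apply ?D Ks (chan d \<omega> P M (\<lambda>a b. \<psi> a * cnj (\<psi> b))) i j * \<psi> j)
     = fid_at d \<omega> P M Ks \<psi>" for \<psi>
  proof -
    let ?\<phi> = "\<lambda>x. mv ?D (pauli d \<omega> M x) \<psi>"
    have ka: "kraus_apply ?D Ks (chan d \<omega> P M (\<lambda>a b. \<psi> a * cnj (\<psi> b))) i j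
       = (\<Sum>x\<in>vecs d (2*M). \<Sum>K\<leftarrow>Ks. complex_of_real (prodP P M x) * (mv ?D K (?\<phi> x) i * cnj (mv ?D K (?\<phi> x) j)))" for i j
      unfolding kraus_apply_def chan_pure conjugate_mixture by (rule sum_list_sum_swap)
    have "(\<Sum>i<?D. \<Sum>j<?D. cnj (\<psi> i) * kraus_apply ?D Ks (chan d \<omega> P M (\<lambda>a b. \<psi> a * cnj (\<psi> b))) i j * \<psi> j)
      = (\<Sum>i<?D. \<Sum>j<?D. \<Sum>x\<in>vecs d (2*M). \<Sum>K\<leftarrow>Ks. complex_of_real (prodP P M x) *
           (cnj (\<psi> i) * (mv ?D K (?\<phi> x) i * cnj (mv ?D K (?\<phi> x) j)) * \<psi> j))"
      unfolding ka by (simp add: sum_distrib_left sum_distrib_right sum_list_const_mult sum_list_mult_const mult_ac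
          flip: sum_list_const_mult)
    also have "\<dots> = (\<Sum>x\<in>vecs d (2*M). \<Sum>K\<leftarrow>Ks. complex_of_real (prodP P M x) *
           (\<Sum>i<?D. \<Sum>j<?D. cnj (\<psi> i) * (mv ?D K (?\<phi> x) i * cnj (mv ?D K (?\<phi> x) j)) * \<psi> j))"
      unfolding sum_distrib_left sum_list_sum_swap
      by (rule sum_rotate3[symmetric])
    also have "\<dots> = complex_of_real (fid_at d \<omega> P M Ks \<psi>)"
      unfolding quadratic_form_pure fid_at_def
      by (simp add: sum_list_const_mult of_real_sum_list)
    finally show ?thesis by simp
  qed
  then show ?thesis unfolding fidelity_def by simp
qed

lemma prodP_nonneg:
  assumes "\<forall>u<d. \<forall>v<d. P (u, v) \<ge> 0" "x \<in> vecs d (2*M)"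
  shows "prodP P M x \<ge> 0"
  using assms unfolding prodP_def vecs_def by (intro prod_nonneg) auto

lemma fid_at_nonneg:
  assumes "\<forall>u<d. \<forall>v<d. P (u, v) \<ge> 0"
  shows "fid_at d \<omega> P M Ks \<psi> \<ge> 0"
  unfolding fid_at_def using prodP_nonneg[OF assms]
  by (intro sum_nonneg mult_nonneg_nonneg sum_list_nonneg) auto

lemma fidelity_ge:
  assumes ne: "unit_vecs_of_code (d^M) B \<noteq> {}"
    and ge: "\<And>\<psi>. \<psi> \<in> unit_vecs_of_code (d^M) B \<Longrightarrow> c \<le> fid_at d \<omega> P M Ks \<psi>"
  shows "c \<le> fidelity (d^M) (chan d \<omega> P M) B Ks"
  unfolding fidelity_eq using ne ge by (intro cINF_greatest)

lemma first_in_unit_vecs: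
  assumes "orthonormal D B" "length B > 0"
  shows "B ! 0 \<in> unit_vecs_of_code D B"
proof -
  have "complex_of_real (\<Sum>i<D. (cmod ((B!0) i))\<^sup>2) = complex_of_real 1"
    using assms unfolding orthonormal_def ip_self[symmetric] ip_def by auto
  then have "(\<Sum>i<D. (cmod ((B!0) i))\<^sup>2) = 1" unfolding of_real_eq_iff .
  moreover have "B ! 0 = (\<lambda>i. \<Sum>a<length B. (if a = 0 then 1 else 0) * (B!a) i)"
    using assms by (auto simp: if_distrib[of "\<lambda>t. t * _"] cong: if_cong)
  ultimately show ?thesis
    unfolding unit_vecs_of_code_def by (intro CollectI conjI exI[of _ "\<lambda>a. if a = 0 then 1 else 0"])
qed

text \<open>The completeness relation of the Kraus operators, evaluated as a quadratic form at
  \<phi>.\<close>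

lemma tpcp_norm:
  assumes "is_tpcp_kraus D Ks"
  shows "(\<Sum>K\<leftarrow>Ks. \<Sum>i<D. (cmod (mv D K \<phi> i))\<^sup>2) = (\<Sum>i<D. (cmod (\<phi> i))\<^sup>2)"
proof -
  have 1: "complex_of_real (\<Sum>i<D. (cmod (mv D K \<phi> i))\<^sup>2)
     = (\<Sum>i<D. \<Sum>j<D. cnj (\<phi> i) * \<phi> j * mmul D (adj K) K i j)" for K
  proof -
    have "complex_of_real (\<Sum>i<D. (cmod (mv D K \<phi> i))\<^sup>2)
      = (\<Sum>l<D. \<Sum>i<D. \<Sum>j<D. cnj (\<phi> i) * \<phi> j * (cnj (K l i) * K l j))"
      unfolding ip_self[symmetric] ip_def mv_def cnj_sum sum_product
      by (intro sum.cong refl) (simp add: mult_ac)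
    also have "\<dots> = (\<Sum>i<D. \<Sum>j<D. \<Sum>l<D. cnj (\<phi> i) * \<phi> j * (cnj (K l i) * K l j))"
      by (rule sum_rotate3)
    finally show ?thesis unfolding mmul_def adj_def by (simp add: sum_distrib_left)
  qed
  have "complex_of_real (\<Sum>K\<leftarrow>Ks. \<Sum>i<D. (cmod (mv D K \<phi> i))\<^sup>2)
     = (\<Sum>K\<leftarrow>Ks. \<Sum>i<D. \<Sum>j<D. cnj (\<phi> i) * \<phi> j * mmul D (adj K) K i j)"
    unfolding 1[symmetric] by (simp add: of_real_sum_list)
  also have "\<dots> = (\<Sum>i<D. \<Sum>j<D. cnj (\<phi> i) * \<phi> j * (\<Sum>K\<leftarrow>Ks. mmul D (adj K) K i j))"
    unfolding sum_list_sum_swap sum_list_const_mult ..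
  also have "\<dots> = (\<Sum>i<D. \<Sum>j<D. cnj (\<phi> i) * \<phi> j * (if i = j then 1 else 0))"
    using assms unfolding is_tpcp_kraus_def by (intro sum.cong refl) auto
  also have "\<dots> = ip D \<phi> \<phi>" unfolding ip_def
    by (intro sum.cong refl) (simp add: if_distrib[of "\<lambda>t. _ * t"] cong: if_cong)
  finally show ?thesis unfolding ip_self of_real_eq_iff .
qed

text \<open>The vectors \<open>f e y\<close> are the code basis after error e. The operator for e
  sends \<open>f e y\<close> to \<open>\<beta> y\<close>, and its K^* K is the projection onto the
  span of the \<open>f e y\<close>. These projections add up to the orthogonal projection
  \<open>Pm\<close>; the extra operator 1 - \<open>Pm\<close> restores trace preservation.\<close>

lemma recovery_tpcp:
  fixes \<beta> :: "'y \<Rightarrow> cvec" and f :: "'e \<Rightarrow> 'y \<Rightarrow> cvec"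
  assumes fin: "finite Y" and es: "distinct es"
    and \<beta>: "\<And>y y'. y \<in> Y \<Longrightarrow> y' \<in> Y \<Longrightarrow> ip D (\<beta> y) (\<beta> y') = (if y = y' then 1 else 0)"
    and f: "\<And>e e' y y'. e \<in> set es \<Longrightarrow> e' \<in> set es \<Longrightarrow> y \<in> Y \<Longrightarrow> y' \<in> Y \<Longrightarrow>
       ip D (f e y) (f e' y') = (if e = e' \<and> y = y' then 1 else 0)"
  shows "is_tpcp_kraus D ((\<lambda>i j. (if i = j then 1 else 0) - (\<Sum>e\<in>set es. \<Sum>y\<in>Y. f e y i * cnj (f e y j)))
      # map (\<lambda>e i j. \<Sum>y\<in>Y. \<beta> y i * cnj (f e y j)) es)"
  unfolding is_tpcp_kraus_def
proof (intro allI impI)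
  fix i j assume ij: "i < D" "j < D"
  define Pm where "Pm = (\<lambda>i j. \<Sum>q\<in>set es \<times> Y. f (fst q) (snd q) i * cnj (f (fst q) (snd q) j))"
  have Pm: "(\<Sum>e\<in>set es. \<Sum>y\<in>Y. f e y i * cnj (f e y j)) = Pm i j" for i j
    unfolding Pm_def by (simp add: sum.cartesian_product case_prod_unfold)
  have herm: "cnj (Pm i j) = Pm j i" for i j unfolding Pm_def by (simp add: mult.commute)
  have sq: "(\<Sum>l<D. Pm i l * Pm l j) = Pm i j"
  proof -
    let ?F = "\<lambda>q. f (fst q) (snd q)"
    have "(\<Sum>l<D. Pm i l * Pm l j)
       = (\<Sum>l<D. \<Sum>q\<in>set es \<times> Y. \<Sum>q'\<in>set es \<times> Y. ?F q i * cnj (?F q' j) * (cnj (?F q l) * ?F q' l))"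
      unfolding Pm_def sum_product by (simp add: mult_ac)
    also have "\<dots> = (\<Sum>q\<in>set es \<times> Y. \<Sum>q'\<in>set es \<times> Y. ?F q i * cnj (?F q' j) * ip D (?F q) (?F q'))"
      unfolding ip_def sum_distrib_left by (rule sum_rotate3)
    also have "\<dots> = (\<Sum>q\<in>set es \<times> Y. \<Sum>q'\<in>set es \<times> Y. if q = q' then ?F q i * cnj (?F q' j) else 0)"
      by (intro sum.cong refl) (auto simp: f split: if_splits)
    also have "\<dots> = Pm i j" unfolding Pm_def using fin by (intro sum.cong refl) simp
    finally show ?thesis .
  qed
  let ?R = "\<lambda>i j. (if i = j then 1 else 0) - Pm i j"
  have R: "mmul D (adj ?R) ?R i j = (if i = j then 1 else 0) - Pm i j"
  proof -
    have "mmul D (adj ?R) ?R i j = (\<Sum>l<D. ((if l = i then 1 else 0) - Pm i l) * ((if l = j then 1 else 0) - Pm l j))"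
      unfolding mmul_def adj_def by (intro sum.cong refl) (simp add: herm)
    also have "\<dots> = (\<Sum>l<D. (if l = i then (if i = j then 1 else 0) - Pm i j else 0) - (if l = j then Pm i j else 0) + Pm i l * Pm l j)"
      by (intro sum.cong refl) (auto simp: algebra_simps)
    also have "\<dots> = (if i = j then 1 else 0) - Pm i j"
      unfolding sum.distrib sum_subtractf sq using ij by simp
    finally show ?thesis .
  qed
  have K: "mmul D (adj (\<lambda>i j. \<Sum>y\<in>Y. \<beta> y i * cnj (f e y j))) (\<lambda>i j. \<Sum>y\<in>Y. \<beta> y i * cnj (f e y j)) i j
     = (\<Sum>y\<in>Y. f e y i * cnj (f e y j))" for e
  proof -
    have "mmul D (adj (\<lambda>i j. \<Sum>y\<in>Y. \<beta> y i * cnj (f e y j))) (\<lambda>i j. \<Sum>y\<in>Y. \<beta> y i * cnj (f e y j)) i j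
      = (\<Sum>l<D. \<Sum>y\<in>Y. \<Sum>y'\<in>Y. f e y i * cnj (f e y' j) * (cnj (\<beta> y l) * \<beta> y' l))"
      unfolding mmul_def adj_def cnj_sum sum_product by (intro sum.cong refl) (simp add: mult_ac)
    also have "\<dots> = (\<Sum>y\<in>Y. \<Sum>y'\<in>Y. f e y i * cnj (f e y' j) * ip D (\<beta> y) (\<beta> y'))"
      unfolding ip_def sum_distrib_left by (rule sum_rotate3)
    also have "\<dots> = (\<Sum>y\<in>Y. \<Sum>y'\<in>Y. if y = y' then f e y i * cnj (f e y' j) else 0)"
      by (intro sum.cong refl) (auto simp: \<beta> split: if_splits)
    also have "\<dots> = (\<Sum>y\<in>Y. f e y i * cnj (f e y j))" using fin by (intro sum.cong refl) simp
    finally show ?thesis .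
  qed
  have "(\<Sum>K\<leftarrow>map (\<lambda>e i j. \<Sum>y\<in>Y. \<beta> y i * cnj (f e y j)) es. mmul D (adj K) K i j) = Pm i j"
    unfolding Pm[symmetric] map_map comp_def K using es by (simp add: sum_list_distinct_conv_sum_set)
  then show "(\<Sum>K\<leftarrow>(\<lambda>i j. (if i = j then 1 else 0) - (\<Sum>e\<in>set es. \<Sum>y\<in>Y. f e y i * cnj (f e y j)))
      # map (\<lambda>e i j. \<Sum>y\<in>Y. \<beta> y i * cnj (f e y j)) es. mmul D (adj K) K i j) = (if i = j then 1 else 0)"
    unfolding Pm using R by simp
qed

section \<open>Pauli operators and stabilizer codes\<close>

lemma digit_expansion:
  assumes f: "\<And>i. i < M \<Longrightarrow> f i < d"
  shows "(\<Sum>i<M. f i * d ^ i) < d ^ M \<and> (\<forall>j<M. digit d (\<Sum>i<M. f i * d ^ i) j = f j)"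
  using f
proof (induction M)
  case (Suc M)
  define s where "s = (\<Sum>i<M. f i * d ^ i)"
  have IH: "s < d ^ M" "\<And>j. j < M \<Longrightarrow> digit d s j = f j" using Suc unfolding s_def by auto
  have fM: "f M < d" using Suc.prems by simp
  then have d0: "d > 0" by simp
  have "s + f M * d ^ M < d ^ M + f M * d ^ M" using IH by simp
  also have "\<dots> = Suc (f M) * d ^ M" by simp
  also have "\<dots> \<le> d * d ^ M" using fM by (intro mult_le_mono1) simp
  finally have 1: "s + f M * d ^ M < d ^ Suc M" by simp
  have 2: "digit d (s + f M * d ^ M) j = f j" if "j < Suc M" for j
  proof (cases "j = M")
    case True
    then show ?thesis using IH(1) fM d0 by (simp add: digit_def)
  next
    case False
    then have j: "j < M" using that by simp
    have eq: "f M * d ^ M = (f M * d ^ (M - j - 1) * d) * d ^ j"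
      using j by (simp flip: power_add power_Suc add: mult.assoc)
    have "(s + f M * d ^ M) div d ^ j = f M * d ^ (M - j - 1) * d + s div d ^ j"
      unfolding eq by (rule div_mult_self1) (use d0 in simp)
    then show ?thesis using IH(2)[OF j] by (simp add: digit_def)
  qed
  show ?case using 1 2 unfolding s_def by simp
qed simp

lemma digit_sum: "(\<Sum>i<M. digit d r i * d ^ i) = r mod d ^ M"
proof (induction M)
  case (Suc M)
  have "r mod d ^ Suc M = d ^ M * (r div d ^ M mod d) + r mod d ^ M"
    unfolding power_Suc2 by (rule mod_mult2_eq)
  then show ?case using Suc by (simp add: digit_def mult.commute)
qed simp

text \<open>The symplectic form on integer vectors without reduction; \<open>symp\<close> is its
  residue.\<close>

definition sform :: "nat \<Rightarrow> (nat \<Rightarrow> int) \<Rightarrow> (nat \<Rightarrow> int) \<Rightarrow> int" where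
  "sform M x y = (\<Sum>i<M. x (2*i) * y (2*i+1) - x (2*i+1) * y (2*i))"

lemma exists_complex_root:
  assumes "n > 0"
  obtains w :: complex where "w ^ n = z"
proof
  have "rcis (root n (cmod z)) (Arg z / real n) ^ n = rcis (root n (cmod z) ^ n) (real n * (Arg z / real n))"
    by (rule DeMoivre2)
  also have "\<dots> = z" using assms by (simp add: rcis_cmod_Arg)
  finally show "rcis (root n (cmod z)) (Arg z / real n) ^ n = z" .
qed

lemma member_le_sum_list_nonneg:
  fixes f :: "'a \<Rightarrow> real"
  assumes "x \<in> set xs" "\<And>y. f y \<ge> 0"
  shows "f x \<le> (\<Sum>y\<leftarrow>xs. f y)"
proof -
  have "0 \<le> (\<Sum>y\<leftarrow>ys. f y)" for ys using assms(2) by (intro sum_list_nonneg) auto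
  then show ?thesis using assms by (induction xs) (auto intro: add_increasing add_increasing2)
qed

locale pauli_group =
  fixes d M :: nat and \<omega> :: complex
  assumes prime_d: "prime d" and root_unity: "\<omega> ^ d = 1"
    and primitive: "\<forall>j. 0 < j \<and> j < d \<longrightarrow> \<omega> ^ j \<noteq> 1"
begin

lemma d_pos: "d > 0" using prime_d prime_gt_0_nat by blast

lemma omega_nonzero: "\<omega> \<noteq> 0" using root_unity d_pos by (metis power_eq_0_iff zero_neq_one)

lemma norm_omega: "cmod \<omega> = 1"
  using root_unity d_pos by (metis norm_ge_zero norm_one norm_power power_eq_1_iff real_norm_def zero_less_iff_neq_zero abs_norm_cancel)

lemma omega_powi_add: "\<omega> powi (a + b) = \<omega> powi a * \<omega> powi b"
  using omega_nonzero by (simp add: power_int_add)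

lemma omega_powi_cong:
  assumes "[a = b] (mod int d)"
  shows "\<omega> powi a = \<omega> powi b"
proof -
  obtain k where "a = b + int d * k"
    using assms by (metis cong_iff_lin mult.commute cong_sym)
  then have "\<omega> powi a = \<omega> powi b * (\<omega> powi int d) powi k"
    using omega_nonzero by (simp add: power_int_add power_int_mult)
  then show ?thesis using root_unity by simp
qed

lemma omega_powi_eq_1_iff: "\<omega> powi a = 1 \<longleftrightarrow> int d dvd a"
proof
  assume 1: "\<omega> powi a = 1"
  have "\<omega> ^ nat (a mod int d) = \<omega> powi (a mod int d)"
    using d_pos by (simp add: power_int_def)
  also have "\<dots> = \<omega> powi a" by (rule omega_powi_cong) (simp add: cong_def)
  finally have "\<omega> ^ nat (a mod int d) = 1" using 1 by simp
  moreover have "nat (a mod int d) < d" using d_pos by (simp add: nat_less_iff)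
  ultimately have "nat (a mod int d) = 0" using primitive by (meson gr_zeroI)
  then have "a mod int d \<le> 0" by simp
  moreover have "a mod int d \<ge> 0" using d_pos by simp
  ultimately have "a mod int d = 0" by (rule order_antisym)
  then show "int d dvd a" by (rule dvd_eq_mod_eq_0[THEN iffD2])
next
  assume "int d dvd a"
  then have "\<omega> powi a = \<omega> powi 0" by (intro omega_powi_cong) (simp add: cong_0_iff)
  then show "\<omega> powi a = 1" by simp
qed

lemma cmod_omega_powi [simp]: "cmod (\<omega> powi a) = 1"
  by (simp add: norm_power_int norm_omega)

lemma cnj_omega_powi: "cnj (\<omega> powi a) = \<omega> powi (- a)"
proof -
  have "\<omega> powi a * cnj (\<omega> powi a) = 1"
    using complex_norm_square[of "\<omega> powi a"] by simp
  then show ?thesis using omega_nonzero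
    by (simp add: power_int_minus inverse_unique)
qed

section \<open>Pauli operators acting on functions of the basis index\<close>

definition idx :: "(nat \<Rightarrow> int) \<Rightarrow> nat" where
  "idx v = (\<Sum>i<M. nat (v i mod int d) * d ^ i)"

abbreviation dig :: "nat \<Rightarrow> nat \<Rightarrow> int" where "dig r i \<equiv> int (digit d r i)"

lemma idx_less: "idx v < d ^ M"
  and dig_idx: "i < M \<Longrightarrow> dig (idx v) i = v i mod int d"
  using digit_expansion[of M "\<lambda>i. nat (v i mod int d)" d] d_pos
  unfolding idx_def by (auto simp: nat_less_iff)

lemma idx_cong: "(\<And>i. i < M \<Longrightarrow> [v i = v' i] (mod int d)) \<Longrightarrow> idx v = idx v'"
  unfolding idx_def cong_def by simp

lemma idx_dig: "r < d ^ M \<Longrightarrow> idx (dig r) = r"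
  unfolding idx_def using digit_sum[where M = M and d = d and r = r] d_pos by (simp add: digit_def nat_mod_distrib)

text \<open>Integer representatives make the composition law hold without any reductions modulo d.\<close>

definition Nop :: "(nat \<Rightarrow> int) \<Rightarrow> cvec \<Rightarrow> cvec" where
  "Nop x \<psi> = (\<lambda>r. \<omega> powi (\<Sum>i<M. x (2*i+1) * (dig r i + x (2*i))) * \<psi> (idx (\<lambda>i. dig r i + x (2*i))))"

lemma Nop_cong:
  assumes "\<And>i. i < 2*M \<Longrightarrow> [x i = y i] (mod int d)"
  shows "Nop x = Nop y"
proof (intro ext)
  fix \<psi> r
  have "\<omega> powi (\<Sum>i<M. x (2*i+1) * (dig r i + x (2*i))) = \<omega> powi (\<Sum>i<M. y (2*i+1) * (dig r i + y (2*i)))"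
    using assms by (intro omega_powi_cong cong_sum cong_mult cong_add) auto
  moreover have "idx (\<lambda>i. dig r i + x (2*i)) = idx (\<lambda>i. dig r i + y (2*i))"
    using assms by (intro idx_cong cong_add) auto
  ultimately show "Nop x \<psi> r = Nop y \<psi> r" by (simp add: Nop_def)
qed

text \<open>The phase of x is evaluated after the shift of x alone, while in the operator of the sum
  it is evaluated after both shifts; the scalar corrects for the missing shift by y.\<close>

lemma Nop_comp:
  "Nop x (Nop y \<psi>) = (\<lambda>r. \<omega> powi (- (\<Sum>i<M. x (2*i+1) * y (2*i))) * Nop (\<lambda>i. x i + y i) \<psi> r)"
proof
  fix r
  let ?s = "idx (\<lambda>i. dig r i + x (2*i))"
  have s: "[dig ?s i = dig r i + x (2*i)] (mod int d)" if "i < M" for i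
    using dig_idx[OF that] by (simp add: cong_def)
  have 1: "idx (\<lambda>i. dig ?s i + y (2*i)) = idx (\<lambda>i. dig r i + (x (2*i) + y (2*i)))"
    by (rule idx_cong) (use cong_add[OF s cong_refl] in \<open>simp add: add.assoc\<close>)
  have "\<omega> powi (\<Sum>i<M. y (2*i+1) * (dig ?s i + y (2*i)))
      = \<omega> powi (\<Sum>i<M. y (2*i+1) * (dig r i + x (2*i) + y (2*i)))"
    by (intro omega_powi_cong cong_sum cong_mult cong_add cong_refl s) auto
  then have "\<omega> powi (\<Sum>i<M. x (2*i+1) * (dig r i + x (2*i))) * \<omega> powi (\<Sum>i<M. y (2*i+1) * (dig ?s i + y (2*i)))
     = \<omega> powi ((\<Sum>i<M. x (2*i+1) * (dig r i + x (2*i))) + (\<Sum>i<M. y (2*i+1) * (dig r i + x (2*i) + y (2*i))))"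
    using omega_nonzero by (simp add: power_int_add)
  also have "(\<Sum>i<M. x (2*i+1) * (dig r i + x (2*i))) + (\<Sum>i<M. y (2*i+1) * (dig r i + x (2*i) + y (2*i)))
     = - (\<Sum>i<M. x (2*i+1) * y (2*i)) + (\<Sum>i<M. (x (2*i+1) + y (2*i+1)) * (dig r i + (x (2*i) + y (2*i))))"
    by (simp add: algebra_simps sum.distrib)
  finally have 2: "\<omega> powi (\<Sum>i<M. x (2*i+1) * (dig r i + x (2*i))) * \<omega> powi (\<Sum>i<M. y (2*i+1) * (dig ?s i + y (2*i)))
     = \<omega> powi (- (\<Sum>i<M. x (2*i+1) * y (2*i))) *
       \<omega> powi (\<Sum>i<M. (x (2*i+1) + y (2*i+1)) * (dig r i + (x (2*i) + y (2*i))))"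
    by (simp only: omega_powi_add)
  show "Nop x (Nop y \<psi>) r = \<omega> powi (- (\<Sum>i<M. x (2*i+1) * y (2*i))) * Nop (\<lambda>i. x i + y i) \<psi> r"
    unfolding Nop_def 1 using 2 by (simp only: mult.assoc[symmetric])
qed

lemma Nop_scale: "Nop x (\<lambda>r. c * \<psi> r) = (\<lambda>r. c * Nop x \<psi> r)"
  by (simp add: Nop_def mult_ac)

lemma Nop_sum: "Nop x (\<lambda>r. \<Sum>a\<in>A. f a r) = (\<lambda>r. \<Sum>a\<in>A. Nop x (f a) r)"
  by (simp add: Nop_def sum_distrib_left)

text \<open>Both products are multiples of the operator of x + y, and the difference of their two
  exponents is the symplectic form.\<close>

lemma Nop_commute: "Nop x (Nop y \<psi>) = (\<lambda>r. \<omega> powi (sform M x y) * Nop y (Nop x \<psi>) r)"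
proof -
  have eq: "- (\<Sum>i<M. x (2*i+1) * y (2*i)) = sform M x y + - (\<Sum>i<M. y (2*i+1) * x (2*i))"
    by (simp add: sform_def sum_subtractf mult.commute)
  have "\<omega> powi (- (\<Sum>i<M. x (2*i+1) * y (2*i))) =
      \<omega> powi (sform M x y) * \<omega> powi (- (\<Sum>i<M. y (2*i+1) * x (2*i)))"
    unfolding eq omega_powi_add ..
  then show ?thesis unfolding Nop_comp by (simp add: add.commute mult.assoc)
qed

text \<open>Unitarity: a permutation of the basis indices combined with phases of modulus 1.\<close>

lemma ip_Nop: "ip (d^M) (Nop x \<phi>) (Nop x \<psi>) = ip (d^M) \<phi> \<psi>"
proof -
  let ?t = "\<lambda>r. idx (\<lambda>i. dig r i + x (2*i))"
  have b: "bij_betw ?t {..<d^M} {..<d^M}"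
  proof (rule bij_betw_byWitness[where f' = "\<lambda>r. idx (\<lambda>i. dig r i - x (2*i))"])
    show "\<forall>r\<in>{..<d^M}. idx (\<lambda>i. dig (?t r) i - x (2*i)) = r"
    proof
      fix r assume r: "r \<in> {..<d^M}"
      have "idx (\<lambda>i. dig (?t r) i - x (2*i)) = idx (dig r)"
        by (rule idx_cong) (simp add: dig_idx cong_def mod_diff_left_eq)
      then show "idx (\<lambda>i. dig (?t r) i - x (2*i)) = r" using r idx_dig by simp
    qed
    show "\<forall>r\<in>{..<d^M}. ?t (idx (\<lambda>i. dig r i - x (2*i))) = r"
    proof
      fix r assume r: "r \<in> {..<d^M}"
      have "?t (idx (\<lambda>i. dig r i - x (2*i))) = idx (dig r)"
        by (rule idx_cong) (simp add: dig_idx cong_def mod_add_left_eq)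
      then show "?t (idx (\<lambda>i. dig r i - x (2*i))) = r" using r idx_dig by simp
    qed
  qed (use idx_less in auto)
  have "ip (d^M) (Nop x \<phi>) (Nop x \<psi>) = (\<Sum>r<d^M. cnj (\<phi> (?t r)) * \<psi> (?t r))"
    unfolding ip_def
  proof (rule sum.cong[OF refl])
    fix r
    let ?c = "\<omega> powi (\<Sum>i<M. x (2*i+1) * (dig r i + x (2*i)))"
    have "cnj ?c * ?c = 1" using complex_norm_square[of ?c] by (simp add: mult.commute)
    then show "cnj (Nop x \<phi> r) * Nop x \<psi> r = cnj (\<phi> (?t r)) * \<psi> (?t r)"
      unfolding Nop_def by (simp add: mult_ac)
  qed
  also have "\<dots> = ip (d^M) \<phi> \<psi>" unfolding ip_def
    by (rule sum.reindex_bij_betw[OF b, of "\<lambda>r. cnj (\<phi> r) * \<psi> r"])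
  finally show ?thesis .
qed

text \<open>X lowers digits, so row r of the matrix has its only nonzero entry in the column whose
  digits are those of r raised by the X-exponents.\<close>

lemma mv_pauli:
  assumes x: "x \<in> vecs d (2*M)" and r: "r < d ^ M"
  shows "mv (d^M) (pauli d \<omega> M x) \<psi> r = Nop (\<lambda>i. int (x i)) \<psi> r"
proof -
  let ?c = "idx (\<lambda>i. dig r i + int (x (2*i)))"
  have iff: "(\<forall>i<M. digit d r i = (digit d c i + d - x (2*i)) mod d) \<longleftrightarrow> c = ?c" if c: "c < d ^ M" for c
  proof -
    have pt: "digit d r i = (digit d c i + d - x (2*i)) mod d \<longleftrightarrow> dig c i = dig ?c i" if i: "i < M" for i
    proof -
      have lt: "x (2*i) < d" using x i by (simp add: vecs_def)
      have lt2: "digit d r i < d" "digit d c i < d" using d_pos by (auto simp: digit_def)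
      have "int ((digit d c i + d - x (2*i)) mod d) = (dig c i + int d - int (x (2*i))) mod int d"
        using lt by (simp only: zmod_int of_nat_diff of_nat_add less_imp_le trans_le_add2)
      then have "digit d r i = (digit d c i + d - x (2*i)) mod d \<longleftrightarrow> dig r i = (dig c i + int d - int (x (2*i))) mod int d"
        by (metis of_nat_eq_iff)
      also have "\<dots> \<longleftrightarrow> [dig r i = dig c i + int d - int (x (2*i))] (mod int d)"
        using lt2 by (simp add: cong_def)
      \<comment> \<open>The summand \<open>int d\<close>, which keeps the natural-number subtraction
        from truncating, is split off as a multiple of the modulus.\<close>
      also have "\<dots> \<longleftrightarrow> int d dvd - (dig c i - (dig r i + int (x (2*i)))) + (-1) * int d"
        unfolding cong_iff_dvd_diff by (simp add: algebra_simps)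
      also have "\<dots> \<longleftrightarrow> [dig c i = dig r i + int (x (2*i))] (mod int d)"
        unfolding cong_iff_dvd_diff dvd_add_times_triv_right_iff dvd_minus_iff ..
      also have "\<dots> \<longleftrightarrow> dig c i = dig ?c i"
        using lt2 by (simp add: cong_def dig_idx[OF i])
      finally show ?thesis .
    qed
    show ?thesis
    proof
      assume *: "\<forall>i<M. digit d r i = (digit d c i + d - x (2*i)) mod d"
      have "c = idx (dig c)" using idx_dig[OF c] by simp
      also have "\<dots> = idx (dig ?c)" using * pt by (intro idx_cong) simp
      also have "\<dots> = ?c" using idx_dig[OF idx_less] .
      finally show "c = ?c" .
    qed (use pt in simp)
  qed
  have "mv (d^M) (pauli d \<omega> M x) \<psi> r = (\<Sum>c<d^M. if c = ?c then \<omega> ^ (\<Sum>i<M. x (2*i+1) * digit d c i) * \<psi> c else 0)"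
    unfolding mv_def pauli_def by (intro sum.cong refl) (auto simp: iff)
  also have "\<dots> = \<omega> ^ (\<Sum>i<M. x (2*i+1) * digit d ?c i) * \<psi> ?c"
    using idx_less by simp
  also have "\<omega> ^ (\<Sum>i<M. x (2*i+1) * digit d ?c i) = \<omega> powi (\<Sum>i<M. int (x (2*i+1)) * dig ?c i)"
    by (simp flip: power_int_of_nat)
  also have "\<dots> = \<omega> powi (\<Sum>i<M. int (x (2*i+1)) * (dig r i + int (x (2*i))))"
    by (intro omega_powi_cong cong_sum cong_mult cong_refl) (simp add: dig_idx cong_def)
  finally show ?thesis by (simp add: Nop_def)
qed

section \<open>Joint eigenvectors of commuting Pauli operators\<close>

lemma omega_geometric: "0 < j \<Longrightarrow> j < d \<Longrightarrow> (\<Sum>l<d. (\<omega> ^ l) ^ j) = 0"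
proof -
  assume j: "0 < j" "j < d"
  then have "\<omega> ^ j \<noteq> 1" using primitive by blast
  then have "(\<Sum>l<d. (\<omega> ^ j) ^ l) = ((\<omega> ^ j) ^ d - 1) / (\<omega> ^ j - 1)" by (rule geometric_sum)
  also have "(\<omega> ^ j) ^ d = 1" using root_unity by (metis power_commutes power_mult mult.commute power_one)
  finally show ?thesis by (simp add: power_mult[symmetric] mult.commute)
qed

text \<open>\<open>Nop (\<lambda>_. 0)\<close> is not the identity on all functions: it replaces
  \<psi> by the d^M-periodic extension of its first d^M values. The premise singles out the \<psi>
  for which the power 0 causes no trouble.\<close>

lemma Nop_funpow: "\<exists>c. c \<noteq> 0 \<and> (\<forall>\<psi>. Nop (\<lambda>_. 0) \<psi> = \<psi> \<longrightarrow> (Nop a ^^ j) \<psi> = (\<lambda>r. c * Nop (\<lambda>i. int j * a i) \<psi> r))"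
proof (induction j)
  case 0
  show ?case by (intro exI[of _ 1]) (auto simp: eq_commute)
next
  case (Suc j)
  then obtain c where c: "c \<noteq> 0"
    "\<And>\<psi>. Nop (\<lambda>_. 0) \<psi> = \<psi> \<Longrightarrow> (Nop a ^^ j) \<psi> = (\<lambda>r. c * Nop (\<lambda>i. int j * a i) \<psi> r)" by blast
  let ?c = "c * \<omega> powi (- (\<Sum>i<M. a (2*i+1) * (int j * a (2*i))))"
  have "(Nop a ^^ Suc j) \<psi> = (\<lambda>r. ?c * Nop (\<lambda>i. int (Suc j) * a i) \<psi> r)" if "Nop (\<lambda>_. 0) \<psi> = \<psi>" for \<psi>
    by (simp add: c(2)[OF that] Nop_scale Nop_comp distrib_right mult.assoc)
  moreover have "?c \<noteq> 0" using c omega_nonzero by simp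
  ultimately show ?case by blast
qed

text \<open>Induction on \<Lambda>. The d-th power of the new operator acts on v as a scalar c, so
  the discrete Fourier transforms \<open>V l\<close> of the orbit of v are eigenvectors of it, with
  the d-th roots of c as eigenvalues. The old operators commute with the new one, hence each acts on
  \<open>V l\<close> by its old eigenvalue.\<close>

lemma joint_eigenvector_nonzero:
  assumes "finite \<Lambda>" "\<And>a b. a \<in> \<Lambda> \<Longrightarrow> b \<in> \<Lambda> \<Longrightarrow> int d dvd sform M a b"
  shows "\<exists>v. Nop (\<lambda>_. 0) v = v \<and> v \<noteq> (\<lambda>_. 0) \<and> (\<forall>a\<in>\<Lambda>. \<exists>l. Nop a v = (\<lambda>r. l * v r))"
  using assms
proof (induction \<Lambda> rule: finite_induct)
  case empty
  show ?case by (intro exI[of _ "\<lambda>_. 1"]) (simp add: Nop_def fun_eq_iff)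
next
  case (insert a \<Lambda>)
  then obtain v where v: "Nop (\<lambda>_. 0) v = v" "v \<noteq> (\<lambda>_. 0)"
    and ev: "\<And>b. b \<in> \<Lambda> \<Longrightarrow> \<exists>l. Nop b v = (\<lambda>r. l * v r)" by (metis insert_iff)
  define w where "w = (\<lambda>j. (Nop a ^^ j) v)"
  obtain c where c: "c \<noteq> 0" "w d = (\<lambda>r. c * Nop (\<lambda>i. int d * a i) v r)"
    using Nop_funpow[where a = a and j = d] v(1) unfolding w_def by blast
  have "Nop (\<lambda>i. int d * a i) = Nop (\<lambda>_. 0)" by (rule Nop_cong) (simp add: cong_0_iff)
  then have wd: "w d = (\<lambda>r. c * v r)" using c v(1) by simp
  \<comment> \<open>The scalar c need not be 1: for d = 2 the square of XZ is -1. Taking any d-th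
    root of c avoids a correcting phase in the operator.\<close>
  obtain \<nu> where \<nu>: "\<nu> ^ d = c" using exists_complex_root[OF d_pos] by blast
  have \<nu>0: "\<nu> \<noteq> 0" using \<nu> c d_pos by auto
  define V where "V = (\<lambda>l r. \<Sum>j<d. inverse (\<nu> * \<omega> ^ l) ^ j * w j r)"
  have commute: "Nop b (V l) = (\<lambda>r. m * V l r)"
    if m: "Nop b v = (\<lambda>r. m * v r)" and ba: "int d dvd sform M b a" for b m l
  proof -
    have Nw: "Nop b (w j) = (\<lambda>r. m * w j r)" for j
    proof (induction j)
      case 0
      then show ?case using m by (simp add: w_def)
    next
      case (Suc j)
      have "\<omega> powi (sform M b a) = 1" using ba omega_powi_eq_1_iff by simp
      then have "Nop b (w (Suc j)) = Nop a (Nop b (w j))"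
        unfolding w_def using Nop_commute[of b a] by simp
      then show ?case using Suc by (simp add: Nop_scale) (simp add: w_def)
    qed
    have "Nop b (\<lambda>r. inverse (\<nu> * \<omega> ^ l) ^ j * w j r) = (\<lambda>r. m * (inverse (\<nu> * \<omega> ^ l) ^ j * w j r))" for j
      unfolding Nop_scale Nw by (simp only: mult.left_commute)
    then show ?thesis unfolding V_def Nop_sum by (simp add: sum_distrib_left)
  qed
  have eig: "Nop a (V l) = (\<lambda>r. \<nu> * \<omega> ^ l * V l r)" for l
  proof
    fix r
    define n where "n = \<nu> * \<omega> ^ l"
    have n0: "n \<noteq> 0" unfolding n_def using \<nu>0 omega_nonzero by simp
    have nd: "n ^ d = c"
      unfolding n_def using \<nu> root_unity by (simp add: power_mult_distrib) (metis power_mult mult.commute power_one mult_1_right)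
    have Nw: "Nop a (w j) = w (Suc j)" for j by (simp add: w_def)
    have "Nop a (V l) r = (\<Sum>j<d. inverse n ^ j * w (Suc j) r)"
      unfolding V_def Nop_sum Nop_scale Nw n_def ..
    also have "\<dots> = n * (\<Sum>j<d. inverse n ^ Suc j * w (Suc j) r)"
      using n0 by (simp add: sum_distrib_left field_simps)
    \<comment> \<open>Applying the operator shifts the sum by one step; the two boundary terms
      cancel because \<open>n ^ d = c\<close> and \<open>w d\<close> is c times v.\<close>
    also have "(\<Sum>j<d. inverse n ^ Suc j * w (Suc j) r) = (\<Sum>j<d. inverse n ^ j * w j r) + inverse n ^ d * w d r - inverse n ^ 0 * w 0 r"
      using sum.lessThan_Suc_shift[of "\<lambda>j. inverse n ^ j * w j r" d] by simp
    also have "inverse n ^ d * w d r = w 0 r"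
      using nd c wd by (simp add: power_inverse w_def )
    finally show "Nop a (V l) r = \<nu> * \<omega> ^ l * V l r" unfolding V_def n_def by simp
  qed
  \<comment> \<open>Summing \<open>V l\<close> over all l kills every term except j = 0 and leaves d
    times v, so the \<open>V l\<close> cannot all vanish.\<close>
  have "\<exists>l. V l \<noteq> (\<lambda>_. 0)"
  proof (rule ccontr)
    assume "\<not> ?thesis"
    then have 0: "V l r = 0" for l r by (metis (full_types))
    have "v r = 0" for r
    proof -
      have "0 = (\<Sum>l<d. V l r)" by (simp add: 0)
      also have "\<dots> = (\<Sum>l<d. \<Sum>j<d. inverse \<nu> ^ j * w j r * inverse ((\<omega> ^ l) ^ j))"
        unfolding V_def by (simp add: power_mult_distrib power_inverse mult_ac)
      also have "\<dots> = (\<Sum>j<d. inverse \<nu> ^ j * w j r * (\<Sum>l<d. inverse ((\<omega> ^ l) ^ j)))"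
        unfolding sum_distrib_left by (rule sum.swap)
      also have "\<dots> = (\<Sum>j<d. if j = 0 then w 0 r * of_nat d else 0)"
      proof (rule sum.cong[OF refl])
        fix j assume j: "j \<in> {..<d}"
        show "inverse \<nu> ^ j * w j r * (\<Sum>l<d. inverse ((\<omega> ^ l) ^ j)) = (if j = 0 then w 0 r * of_nat d else 0)"
        proof (cases "j = 0")
          case False
          have inv: "inverse ((\<omega> ^ l) ^ j) = cnj ((\<omega> ^ l) ^ j)" for l
            by (rule inverse_unique)
              (use complex_norm_square[of "(\<omega> ^ l) ^ j"] norm_omega in \<open>simp add: norm_power\<close>)
          have "(\<Sum>l<d. inverse ((\<omega> ^ l) ^ j)) = cnj (\<Sum>l<d. (\<omega> ^ l) ^ j)"
            unfolding inv by (rule cnj_sum[symmetric])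
          also have "\<dots> = 0" using omega_geometric[of j] j False by simp
          finally show ?thesis using False by simp
        qed simp
      qed
      also have "\<dots> = w 0 r * of_nat d" using d_pos by simp
      finally show "v r = 0" using d_pos by (simp add: w_def)
    qed
    then show False using v(2) by auto
  qed
  then obtain l where l: "V l \<noteq> (\<lambda>_. 0)" by blast
  have "Nop (\<lambda>_. 0) (V l) = V l"
    using commute[of "\<lambda>_. 0" 1 l] v(1) by (simp add: sform_def)
  moreover have "\<exists>m. Nop b (V l) = (\<lambda>r. m * V l r)" if "b \<in> insert a \<Lambda>" for b
    using that eig ev commute[of b _ l] insert.prems by blast
  ultimately show ?case using l by blast
qed

lemma joint_eigenvector:
  assumes "finite \<Lambda>" "\<And>a b. a \<in> \<Lambda> \<Longrightarrow> b \<in> \<Lambda> \<Longrightarrow> int d dvd sform M a b"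
  obtains v where "ip (d^M) v v = 1" "\<And>a. a \<in> \<Lambda> \<Longrightarrow> \<exists>l. Nop a v = (\<lambda>r. l * v r)"
proof -
  obtain v where v: "Nop (\<lambda>_. 0) v = v" "v \<noteq> (\<lambda>_. 0)"
    and ev: "\<And>a. a \<in> \<Lambda> \<Longrightarrow> \<exists>l. Nop a v = (\<lambda>r. l * v r)"
    using joint_eigenvector_nonzero[OF assms] by blast
  obtain r where "v r \<noteq> 0" using v(2) by auto
  \<comment> \<open>By periodicity v is already nonzero at an index below d^M, where the inner
    product can see it.\<close>
  moreover have "v r = v (idx (dig r))" using fun_cong[OF v(1), of r] by (simp add: Nop_def)
  ultimately have "0 < (cmod (v (idx (dig r))))\<^sup>2" by simp
  also have "\<dots> \<le> (\<Sum>i<d^M. (cmod (v i))\<^sup>2)"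
    by (rule member_le_sum) (use idx_less in auto)
  finally have pos: "0 < (\<Sum>i<d^M. (cmod (v i))\<^sup>2)" .
  define n where "n = (\<Sum>i<d^M. (cmod (v i))\<^sup>2)"
  define c where "c = complex_of_real (1 / sqrt n)"
  have "ip (d^M) (\<lambda>r. c * v r) (\<lambda>r. c * v r) = cnj c * c * ip (d^M) v v"
    by (simp add: ip_scale_left ip_scale_right)
  also have "\<dots> = complex_of_real ((1 / sqrt n)\<^sup>2 * n)"
    unfolding ip_self c_def n_def[symmetric] by (simp only: complex_cnj_complex_of_real power2_eq_square of_real_mult)
  also have "\<dots> = 1" using pos unfolding n_def[symmetric] by (simp add: power_divide)
  finally have "ip (d^M) (\<lambda>r. c * v r) (\<lambda>r. c * v r) = 1" .
  moreover have "\<exists>l. Nop a (\<lambda>r. c * v r) = (\<lambda>r. l * (c * v r))" if a: "a \<in> \<Lambda>" for a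
  proof -
    obtain l where "Nop a v = (\<lambda>r. l * v r)" using ev[OF a] by blast
    then have "Nop a (\<lambda>r. c * v r) = (\<lambda>r. l * (c * v r))" by (simp add: Nop_scale mult_ac)
    then show ?thesis by blast
  qed
  ultimately show thesis by (rule that)
qed

text \<open>Both translates are eigenvectors of the unitary \<open>Nop a\<close>, with eigenvalues
  of modulus 1 that differ by a nontrivial power of \<omega>.\<close>

lemma ip_Nop_eigenvector_eq_0:
  assumes v: "ip (d^M) v v = 1" and a: "Nop a v = (\<lambda>r. l * v r)"
    and nd: "\<not> int d dvd sform M a x - sform M a y"
  shows "ip (d^M) (Nop x v) (Nop y v) = 0"
proof -
  have shift: "Nop a (Nop z v) = (\<lambda>r. \<omega> powi (sform M a z) * l * Nop z v r)" for z
    unfolding Nop_commute[of a z] a Nop_scale by (simp add: mult.assoc)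
  have "1 = ip (d^M) (Nop a v) (Nop a v)" using v by (simp add: ip_Nop)
  also have "\<dots> = cnj l * l" unfolding a ip_scale_left ip_scale_right v by simp
  finally have l: "cnj l * l = 1" by simp
  have "ip (d^M) (Nop x v) (Nop y v) = ip (d^M) (Nop a (Nop x v)) (Nop a (Nop y v))"
    by (rule ip_Nop[symmetric])
  also have "\<dots> = \<omega> powi (- sform M a x) * \<omega> powi (sform M a y) * (cnj l * l) * ip (d^M) (Nop x v) (Nop y v)"
    unfolding shift ip_scale_left ip_scale_right complex_cnj_mult cnj_omega_powi by (simp only: mult_ac)
  also have "\<omega> powi (- sform M a x) * \<omega> powi (sform M a y) = \<omega> powi (- (sform M a x - sform M a y))"
    using omega_nonzero by (simp flip: power_int_add)
  finally have "(1 - \<omega> powi (- (sform M a x - sform M a y))) * ip (d^M) (Nop x v) (Nop y v) = 0"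
    unfolding l by (simp add: algebra_simps)
  moreover have "\<omega> powi (- (sform M a x - sform M a y)) \<noteq> 1"
    using nd omega_powi_eq_1_iff dvd_minus_iff by blast
  ultimately show ?thesis by simp
qed

text \<open>An error correction criterion in terms of values of the form alone: \<open>yv\<close>
  gives the translates spanning the code, \<open>ev\<close> the representatives of correctable
  errors, and \<Lambda> the operators of which v is a joint eigenvector. By \<open>esep\<close>
  distinct representatives move the code to orthogonal spaces; an error in \<open>G\<close> differs
  from a representative by an a that acts on the whole code as one scalar.\<close>

lemma stabilizer_code:
  fixes ev :: "'e \<Rightarrow> nat \<Rightarrow> int" and yv :: "'y \<Rightarrow> nat \<Rightarrow> int"
  assumes P: "\<forall>u<d. \<forall>v<d. P (u, v) \<ge> 0"
    and \<Lambda>: "finite \<Lambda>" "\<And>a b. a \<in> \<Lambda> \<Longrightarrow> b \<in> \<Lambda> \<Longrightarrow> int d dvd sform M a b"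
    and Y: "finite Y" "Y \<noteq> {}" and J: "finite J"
    and ysep: "\<And>y y'. y \<in> Y \<Longrightarrow> y' \<in> Y \<Longrightarrow> y \<noteq> y' \<Longrightarrow>
        \<exists>a\<in>\<Lambda>. \<not> int d dvd sform M a (yv y) - sform M a (yv y')"
    and esep: "\<And>e e' y y'. e \<in> J \<Longrightarrow> e' \<in> J \<Longrightarrow> e \<noteq> e' \<Longrightarrow> y \<in> Y \<Longrightarrow> y' \<in> Y \<Longrightarrow>
        \<exists>a\<in>\<Lambda>. \<not> int d dvd sform M a (\<lambda>i. ev e i + yv y i) - sform M a (\<lambda>i. ev e' i + yv y' i)"
    and G: "G \<subseteq> vecs d (2*M)" "\<And>x. x \<in> G \<Longrightarrow> \<exists>e\<in>J. \<exists>a\<in>\<Lambda>.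
        (\<forall>i<2*M. [int (x i) = ev e i + a i] (mod int d)) \<and> (\<forall>y\<in>Y. int d dvd sform M a (yv y))"
  shows "\<exists>B Ks. orthonormal (d^M) B \<and> is_tpcp_kraus (d^M) Ks \<and> length B = card Y \<and>
     sum (prodP P M) G \<le> fidelity (d^M) (chan d \<omega> P M) B Ks"
proof -
  obtain v where v: "ip (d^M) v v = 1" and eig: "\<And>a. a \<in> \<Lambda> \<Longrightarrow> \<exists>l. Nop a v = (\<lambda>r. l * v r)"
    using joint_eigenvector[OF \<Lambda>] by blast
  define \<beta> where "\<beta> = (\<lambda>y. Nop (yv y) v)"
  define f where "f = (\<lambda>e y. Nop (ev e) (\<beta> y))"
  obtain ys where ys: "set ys = Y" "distinct ys" using finite_distinct_list[OF Y(1)] by blast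
  obtain es where es: "set es = J" "distinct es" using finite_distinct_list[OF J] by blast
  have \<beta>: "ip (d^M) (\<beta> y) (\<beta> y') = (if y = y' then 1 else 0)" if yy: "y \<in> Y" "y' \<in> Y" for y y'
  proof (cases "y = y'")
    case True
    then show ?thesis using v by (simp add: \<beta>_def ip_Nop)
  next
    case False
    obtain a where "a \<in> \<Lambda>" and a: "\<not> int d dvd sform M a (yv y) - sform M a (yv y')"
      using ysep[OF yy False] by blast
    obtain l where l: "Nop a v = (\<lambda>r. l * v r)" using eig[OF \<open>a \<in> \<Lambda>\<close>] by blast
    show ?thesis unfolding \<beta>_def ip_Nop_eigenvector_eq_0[OF v l a] using False by simp
  qed
  have f: "ip (d^M) (f e y) (f e' y') = (if e = e' \<and> y = y' then 1 else 0)"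
    if ee: "e \<in> J" "e' \<in> J" "y \<in> Y" "y' \<in> Y" for e e' y y'
  proof (cases "e = e'")
    case True
    then show ?thesis using \<beta> ee by (simp add: f_def ip_Nop)
  next
    case False
    obtain a where "a \<in> \<Lambda>" and a: "\<not> int d dvd sform M a (\<lambda>i. ev e i + yv y i) - sform M a (\<lambda>i. ev e' i + yv y' i)"
      using esep[OF ee(1,2) False ee(3,4)] by blast
    obtain l where l: "Nop a v = (\<lambda>r. l * v r)" using eig[OF \<open>a \<in> \<Lambda>\<close>] by blast
    show ?thesis
      unfolding f_def \<beta>_def Nop_comp ip_scale_left ip_scale_right ip_Nop_eigenvector_eq_0[OF v l a]
      using False by simp
  qed
  define rec where "rec = (\<lambda>e i j. \<Sum>y\<in>Y. \<beta> y i * cnj (f e y j))"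
  define Ks where "Ks = (\<lambda>i j. (if i = j then 1 else 0) - (\<Sum>e\<in>set es. \<Sum>y\<in>Y. f e y i * cnj (f e y j))) # map rec es"
  define B where "B = map \<beta> ys"
  have tpcp: "is_tpcp_kraus (d^M) Ks"
    unfolding Ks_def rec_def by (rule recovery_tpcp[OF Y(1) es(2)]) (use \<beta> f es in auto)
  have on: "orthonormal (d^M) B"
    unfolding orthonormal_def B_def ip_def[symmetric]
    using \<beta> ys by (auto simp: nth_eq_iff_index_eq)
  have len: "length B = card Y" unfolding B_def using ys distinct_card by fastforce
  have "sum (prodP P M) G \<le> fid_at d \<omega> P M Ks \<psi>" if \<psi>: "\<psi> \<in> unit_vecs_of_code (d^M) B" for \<psi>
  proof -
    obtain c where c: "\<psi> = (\<lambda>i. \<Sum>a<length B. c a * (B!a) i)"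
      and "(\<Sum>i<d^M. (cmod (\<psi> i))\<^sup>2) = 1" using \<psi> unfolding unit_vecs_of_code_def by blast
    then have unit: "ip (d^M) \<psi> \<psi> = 1" unfolding ip_self by simp
    define k where "k = (\<lambda>y. c (the_inv_into {..<length ys} ((!) ys) y))"
    have bij: "bij_betw ((!) ys) {..<length ys} Y" using bij_betw_nth[OF ys(2)] ys(1) by blast
    have k: "k (ys ! a) = c a" if "a < length ys" for a
      unfolding k_def using that bij by (subst the_inv_into_f_f) (auto simp: bij_betw_def)
    have \<psi>_eq: "\<psi> = (\<lambda>r. \<Sum>y\<in>Y. k y * \<beta> y r)"
    proof
      fix r
      have "\<psi> r = (\<Sum>a<length ys. k (ys ! a) * \<beta> (ys ! a) r)"
        unfolding c B_def by (simp add: k)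
      also have "\<dots> = (\<Sum>y\<in>Y. k y * \<beta> y r)" by (rule sum.reindex_bij_betw[OF bij])
      finally show "\<psi> r = (\<Sum>y\<in>Y. k y * \<beta> y r)" .
    qed
    let ?term = "\<lambda>x K. (cmod (ip (d^M) \<psi> (mv (d^M) K (mv (d^M) (pauli d \<omega> M x) \<psi>))))\<^sup>2"
    \<comment> \<open>On the code, x acts as its representative e up to a scalar of modulus 1, so
      \<open>rec e\<close> alone restores \<psi> with squared overlap 1.\<close>
    have one: "1 \<le> (\<Sum>K\<leftarrow>Ks. ?term x K)" if x: "x \<in> G" for x
    proof -
      obtain e a where e: "e \<in> J" and a: "a \<in> \<Lambda>"
        and xe: "\<forall>i<2*M. [int (x i) = ev e i + a i] (mod int d)" and ay: "\<forall>y\<in>Y. int d dvd sform M a (yv y)"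
        using G(2)[OF x] by blast
      obtain l where l: "Nop a v = (\<lambda>r. l * v r)" using eig[OF a] by blast
      have "1 = ip (d^M) (Nop a v) (Nop a v)" using v by (simp add: ip_Nop)
      also have "\<dots> = cnj l * l" unfolding l ip_scale_left ip_scale_right v by simp
      finally have "complex_of_real ((cmod l)\<^sup>2) = complex_of_real 1"
        unfolding complex_norm_square by (simp add: mult.commute)
      then have nl: "(cmod l)\<^sup>2 = 1" unfolding of_real_eq_iff .
      \<comment> \<open>The inverse of the scalar that \<open>Nop_comp\<close> produces for the
        product of e and a.\<close>
      define q where "q = \<omega> powi (\<Sum>i<M. ev e (2*i+1) * a (2*i))"
      have Nx: "Nop (\<lambda>i. int (x i)) \<phi> = (\<lambda>r. q * Nop (ev e) (Nop a \<phi>) r)" for \<phi>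
      proof -
        have "Nop (\<lambda>i. int (x i)) = Nop (\<lambda>i. ev e i + a i)" by (rule Nop_cong) (use xe in blast)
        then show ?thesis
          unfolding Nop_comp q_def mult.assoc[symmetric] omega_powi_add[symmetric] by simp
      qed
      have N\<beta>: "Nop (\<lambda>i. int (x i)) (\<beta> y) = (\<lambda>r. q * l * f e y r)" if y: "y \<in> Y" for y
      proof -
        have "\<omega> powi sform M a (yv y) = 1" using ay y omega_powi_eq_1_iff by blast
        then have "Nop a (\<beta> y) = (\<lambda>r. l * \<beta> y r)"
          unfolding \<beta>_def Nop_commute[of a "yv y"] l Nop_scale by simp
        then show ?thesis unfolding Nx f_def by (simp add: Nop_scale mult.assoc)
      qed
      have N\<psi>: "Nop (\<lambda>i. int (x i)) \<psi> = (\<lambda>r. \<Sum>y\<in>Y. q * l * k y * f e y r)"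
        unfolding \<psi>_eq Nop_sum Nop_scale using N\<beta> by (simp add: mult_ac)
      have "mv (d^M) (rec e) (Nop (\<lambda>i. int (x i)) \<psi>) i = q * l * \<psi> i" for i
      proof -
        have "mv (d^M) (rec e) (Nop (\<lambda>i. int (x i)) \<psi>) i
           = (\<Sum>y\<in>Y. \<beta> y i * ip (d^M) (f e y) (Nop (\<lambda>i. int (x i)) \<psi>))"
          unfolding mv_def rec_def ip_def sum_distrib_left sum_distrib_right
          by (subst sum.swap) (simp add: mult.assoc)
        also have "\<dots> = (\<Sum>y\<in>Y. \<beta> y i * (q * l * k y))"
        proof (rule sum.cong[OF refl])
          fix y assume y: "y \<in> Y"
          have "ip (d^M) (f e y) (Nop (\<lambda>i. int (x i)) \<psi>) = (\<Sum>y'\<in>Y. q * l * k y' * (if y = y' then 1 else 0))"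
            unfolding N\<psi> ip_sum_right ip_scale_right using f[OF e e y] by simp
          then show "\<beta> y i * ip (d^M) (f e y) (Nop (\<lambda>i. int (x i)) \<psi>) = \<beta> y i * (q * l * k y)"
            using y Y(1) by (simp add: if_distrib[of "\<lambda>t. _ * t"] cong: if_cong)
        qed
        also have "\<dots> = q * l * \<psi> i" unfolding \<psi>_eq by (simp add: sum_distrib_left mult_ac)
        finally show ?thesis .
      qed
      then have rec_eq: "mv (d^M) (rec e) (Nop (\<lambda>i. int (x i)) \<psi>) = (\<lambda>i. q * l * \<psi> i)" by (rule ext)
      have "mv (d^M) (rec e) (mv (d^M) (pauli d \<omega> M x) \<psi>) = mv (d^M) (rec e) (Nop (\<lambda>i. int (x i)) \<psi>)"
        by (rule mv_cong, rule mv_pauli) (use x G(1) in auto)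
      also note rec_eq
      finally have "mv (d^M) (rec e) (mv (d^M) (pauli d \<omega> M x) \<psi>) = (\<lambda>i. q * l * \<psi> i)" .
      then have "?term x (rec e) = 1"
        using nl unit by (simp add: ip_scale_right norm_mult power_mult_distrib q_def)
      moreover have "?term x (rec e) \<le> (\<Sum>K\<leftarrow>Ks. ?term x K)"
      proof -
        have "rec e \<in> set Ks" using e es unfolding Ks_def by simp
        then show ?thesis by (rule member_le_sum_list_nonneg) simp
      qed
      ultimately show ?thesis by simp
    qed
    have "sum (prodP P M) G \<le> (\<Sum>x\<in>G. prodP P M x * (\<Sum>K\<leftarrow>Ks. ?term x K))"
    proof (rule sum_mono)
      fix x assume x: "x \<in> G"
      then have "prodP P M x * 1 \<le> prodP P M x * (\<Sum>K\<leftarrow>Ks. ?term x K)"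
        using one[OF x] prodP_nonneg[OF P] G(1) by (intro mult_left_mono) auto
      then show "prodP P M x \<le> prodP P M x * (\<Sum>K\<leftarrow>Ks. ?term x K)" by simp
    qed
    also have "\<dots> \<le> fid_at d \<omega> P M Ks \<psi>"
      unfolding fid_at_def using prodP_nonneg[OF P] G(1)
      by (intro sum_mono2 mult_nonneg_nonneg sum_list_nonneg) auto
    finally show ?thesis .
  qed
  moreover have "unit_vecs_of_code (d^M) B \<noteq> {}"
    using first_in_unit_vecs[OF on] len Y by (metis card_gt_0_iff empty_iff)
  ultimately have "sum (prodP P M) G \<le> fidelity (d^M) (chan d \<omega> P M) B Ks"
    by (intro fidelity_ge)
  then show ?thesis using on tpcp len by blast
qed

text \<open>Needed for the supremum over codes to be meaningful. The fidelity is an infimum, so one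
  unit vector is enough; Cauchy-Schwarz and trace preservation bound its value.\<close>

lemma fidelity_le_1:
  assumes P: "\<forall>u<d. \<forall>v<d. P (u, v) \<ge> 0" and total: "sum (prodP P M) (vecs d (2*M)) = 1"
    and on: "orthonormal (d^M) B" and len: "length B > 0" and tpcp: "is_tpcp_kraus (d^M) Ks"
  shows "fidelity (d^M) (chan d \<omega> P M) B Ks \<le> 1"
proof -
  let ?\<psi> = "B ! 0"
  have mem: "?\<psi> \<in> unit_vecs_of_code (d^M) B" by (rule first_in_unit_vecs[OF on len])
  then have unit: "(\<Sum>i<d^M. (cmod (?\<psi> i))\<^sup>2) = 1" unfolding unit_vecs_of_code_def by blast
  have "(\<Sum>K\<leftarrow>Ks. (cmod (ip (d^M) ?\<psi> (mv (d^M) K (mv (d^M) (pauli d \<omega> M x) ?\<psi>))))\<^sup>2) \<le> 1"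
    if x: "x \<in> vecs d (2*M)" for x
  proof -
    let ?\<phi> = "mv (d^M) (pauli d \<omega> M x) ?\<psi>"
    have "complex_of_real (\<Sum>i<d^M. (cmod (?\<phi> i))\<^sup>2)
        = ip (d^M) (Nop (\<lambda>i. int (x i)) ?\<psi>) (Nop (\<lambda>i. int (x i)) ?\<psi>)"
      unfolding ip_self[symmetric] by (rule ip_cong) (use mv_pauli[OF x] in auto)
    also have "\<dots> = complex_of_real 1" unfolding ip_Nop by (simp only: ip_self unit)
    finally have norm: "(\<Sum>i<d^M. (cmod (?\<phi> i))\<^sup>2) = 1" unfolding of_real_eq_iff .
    have "(\<Sum>K\<leftarrow>Ks. (cmod (ip (d^M) ?\<psi> (mv (d^M) K ?\<phi>)))\<^sup>2) \<le> (\<Sum>K\<leftarrow>Ks. \<Sum>i<d^M. (cmod (mv (d^M) K ?\<phi> i))\<^sup>2)"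
      using ip_cauchy_schwarz[of "d^M" ?\<psi>] unfolding unit by (intro sum_list_mono) simp
    also have "\<dots> = (\<Sum>i<d^M. (cmod (?\<phi> i))\<^sup>2)" by (rule tpcp_norm[OF tpcp])
    also have "\<dots> = 1" by (rule norm)
    finally show ?thesis .
  qed
  then have "fid_at d \<omega> P M Ks ?\<psi> \<le> (\<Sum>x\<in>vecs d (2*M). prodP P M x * 1)"
    unfolding fid_at_def using prodP_nonneg[OF P] by (intro sum_mono mult_left_mono) auto
  also have "\<dots> = 1" using total by simp
  finally have "fid_at d \<omega> P M Ks ?\<psi> \<le> 1" .
  moreover have "fidelity (d^M) (chan d \<omega> P M) B Ks \<le> fid_at d \<omega> P M Ks ?\<psi>"
    unfolding fidelity_eq using fid_at_nonneg[OF P] mem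
    by (intro cINF_lower bdd_belowI[of _ 0]) auto
  ultimately show ?thesis by simp
qed

end

section \<open>Symplectic coordinates\<close>

lemma sform_cong:
  assumes "\<And>i. i < 2*n \<Longrightarrow> [x i = x' i] (mod int d)" "\<And>i. i < 2*n \<Longrightarrow> [y i = y' i] (mod int d)"
  shows "[sform n x y = sform n x' y'] (mod int d)"
  unfolding sform_def using assms by (intro cong_sum cong_diff cong_mult) auto

lemma sform_add_left: "sform n (\<lambda>i. x i + y i) z = sform n x z + sform n y z"
  by (simp add: sform_def algebra_simps flip: sum.distrib)

lemma sform_add_right: "sform n z (\<lambda>i. x i + y i) = sform n z x + sform n z y"
  by (simp add: sform_def algebra_simps flip: sum.distrib)

lemma sform_sum_left: "sform n (\<lambda>i. \<Sum>j<N. c j * f j i) y = (\<Sum>j<N. c j * sform n (f j) y)"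
proof -
  have "sform n (\<lambda>i. \<Sum>j<N. c j * f j i) y
     = (\<Sum>i<n. \<Sum>j<N. c j * (f j (2*i) * y (2*i+1) - f j (2*i+1) * y (2*i)))"
    unfolding sform_def sum_distrib_right sum_subtractf[symmetric] by (simp add: algebra_simps)
  also have "\<dots> = (\<Sum>j<N. \<Sum>i<n. c j * (f j (2*i) * y (2*i+1) - f j (2*i+1) * y (2*i)))" by (rule sum.swap)
  finally show ?thesis by (simp add: sform_def sum_distrib_left)
qed

lemma sform_antisym: "sform n x y = - sform n y x"
  by (simp add: sform_def sum_negf[symmetric] mult.commute)

lemma sform_sum_right: "sform n y (\<lambda>i. \<Sum>j<N. c j * f j i) = (\<Sum>j<N. c j * sform n y (f j))"
  using sform_sum_left[where n = n and N = N and c = c and f = f and y = y] by (simp add: sform_antisym[of n y] sum_negf)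

lemma symp_eq_sform: "symp d n x y = sform n (\<lambda>i. int (x i)) (\<lambda>i. int (y i)) mod int d"
  by (simp add: symp_def sform_def)

locale symplectic_basis =
  fixes d n :: nat and g h :: "nat \<Rightarrow> nat \<Rightarrow> nat"
  assumes prime_d: "prime d" and ext: "symplectic_ext d n g h"
begin

definition expand :: "(nat \<Rightarrow> int) \<Rightarrow> (nat \<Rightarrow> int) \<Rightarrow> nat \<Rightarrow> int" where
  "expand w z i = (\<Sum>j<n. w j * int (g j i)) + (\<Sum>j<n. z j * int (h j i))"

lemma d_gt_1: "d > 1" using prime_d prime_gt_1_nat by blast

lemma sform_basis:
  assumes "i < n" "j < n"
  shows "[sform n (\<lambda>l. int (g i l)) (\<lambda>l. int (h j l)) = (if i = j then 1 else 0)] (mod int d)"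
    "[sform n (\<lambda>l. int (h i l)) (\<lambda>l. int (g j l)) = (if i = j then - 1 else 0)] (mod int d)"
    "[sform n (\<lambda>l. int (g i l)) (\<lambda>l. int (g j l)) = 0] (mod int d)"
    "[sform n (\<lambda>l. int (h i l)) (\<lambda>l. int (h j l)) = 0] (mod int d)"
proof -
  have *: "symp d n (g i') (h j') = (if i' = j' then 1 else 0)" "symp d n (g i') (g j') = 0"
    "symp d n (h i') (h j') = 0" if "i' < n" "j' < n" for i' j'
    using ext that unfolding symplectic_ext_def by blast+
  have gh: "[sform n (\<lambda>l. int (g i' l)) (\<lambda>l. int (h j' l)) = (if i' = j' then 1 else 0)] (mod int d)"
    if "i' < n" "j' < n" for i' j'
    using *(1)[OF that] d_gt_1 by (auto simp: symp_eq_sform cong_def)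
  show "[sform n (\<lambda>l. int (g i l)) (\<lambda>l. int (h j l)) = (if i = j then 1 else 0)] (mod int d)"
    by (rule gh[OF assms])
  show "[sform n (\<lambda>l. int (h i l)) (\<lambda>l. int (g j l)) = (if i = j then - 1 else 0)] (mod int d)"
    using gh[OF assms(2,1), THEN cong_minus_minus_iff[THEN iffD2]]
    unfolding sform_antisym[of n "\<lambda>l. int (h i l)"] by (auto split: if_splits)
  show "[sform n (\<lambda>l. int (g i l)) (\<lambda>l. int (g j l)) = 0] (mod int d)"
    "[sform n (\<lambda>l. int (h i l)) (\<lambda>l. int (h j l)) = 0] (mod int d)"
    using *(2,3)[OF assms] by (auto simp: symp_eq_sform cong_def)
qed

lemma sform_g_expand:
  assumes "j < n"
  shows "[sform n (\<lambda>l. int (g j l)) (expand w z) = z j] (mod int d)"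
proof -
  have "[sform n (\<lambda>l. int (g j l)) (expand w z) = (\<Sum>l<n. w l * 0) + (\<Sum>l<n. z l * (if j = l then 1 else 0))] (mod int d)"
    unfolding expand_def sform_add_right sform_sum_right
    using assms by (intro cong_add cong_sum cong_mult cong_refl sform_basis) auto
  also have "(\<Sum>l<n. w l * 0) + (\<Sum>l<n. z l * (if j = l then 1 else 0)) = z j"
    using assms by (simp add: if_distrib[of "\<lambda>t. _ * t"] cong: if_cong)
  finally show ?thesis .
qed

lemma sform_h_expand:
  assumes "j < n"
  shows "[sform n (\<lambda>l. int (h j l)) (expand w z) = - w j] (mod int d)"
proof -
  have "[sform n (\<lambda>l. int (h j l)) (expand w z) = (\<Sum>l<n. w l * (if j = l then - 1 else 0)) + (\<Sum>l<n. z l * 0)] (mod int d)"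
    unfolding expand_def sform_add_right sform_sum_right
    using assms by (intro cong_add cong_sum cong_mult cong_refl sform_basis) auto
  also have "(\<Sum>l<n. w l * (if j = l then - 1 else 0)) + (\<Sum>l<n. z l * 0) = - w j"
    using assms by (simp add: if_distrib[of "\<lambda>t. _ * t"] cong: if_cong)
  finally show ?thesis .
qed

lemma sform_expand:
  "[sform n (expand w z) (expand w' z') = (\<Sum>j<n. w j * z' j - z j * w' j)] (mod int d)"
proof -
  have "sform n (expand w z) (expand w' z') = (\<Sum>j<n. w j * sform n (\<lambda>l. int (g j l)) (expand w' z'))
      + (\<Sum>j<n. z j * sform n (\<lambda>l. int (h j l)) (expand w' z'))"
    unfolding expand_def[of w z] sform_add_left sform_sum_left ..
  also have "[\<dots> = (\<Sum>j<n. w j * z' j) + (\<Sum>j<n. z j * (- w' j))] (mod int d)"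
    by (rule cong_add[OF cong_sum[OF cong_mult[OF cong_refl sform_g_expand]] cong_sum[OF cong_mult[OF cong_refl sform_h_expand]]]) simp_all
  also have "(\<Sum>j<n. w j * z' j) + (\<Sum>j<n. z j * (- w' j)) = (\<Sum>j<n. w j * z' j - z j * w' j)"
    by (simp add: sum_subtractf sum_negf)
  finally show ?thesis .
qed

definition encode :: "(nat \<Rightarrow> nat) \<times> (nat \<Rightarrow> nat) \<Rightarrow> nat \<Rightarrow> nat" where
  "encode wz = (\<lambda>i. if i < 2*n then (\<Sum>j<n. fst wz j * g j i + snd wz j * h j i) mod d else 0)"

lemma encode_cong_expand:
  "i < 2*n \<Longrightarrow> [int (encode (w, z) i) = expand (\<lambda>j. int (w j)) (\<lambda>j. int (z j)) i] (mod int d)"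
  by (simp add: encode_def expand_def zmod_int cong_def sum.distrib)

text \<open>Pairing with the basis vectors recovers the coordinates, which gives injectivity;
  surjectivity follows because both sides have d^(2n) elements. The unique choice in
  \<open>coords\<close> rests on this.\<close>

lemma bij_encode: "bij_betw encode (vecs d n \<times> vecs d n) (vecs d (2*n))"
proof -
  have inj: "inj_on encode (vecs d n \<times> vecs d n)"
  proof (rule inj_onI)
    fix p q assume p: "p \<in> vecs d n \<times> vecs d n" and q: "q \<in> vecs d n \<times> vecs d n" and eq: "encode p = encode q"
    obtain w z where pwz: "p = (w, z)" by (cases p)
    obtain w' z' where qwz: "q = (w', z')" by (cases q)
    let ?e = "expand (\<lambda>j. int (w j)) (\<lambda>j. int (z j))"
    let ?e' = "expand (\<lambda>j. int (w' j)) (\<lambda>j. int (z' j))"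
    have ee: "[?e i = ?e' i] (mod int d)" if i: "i < 2*n" for i
    proof -
      have "encode (w', z') i = encode (w, z) i" using eq unfolding pwz qwz by simp
      with encode_cong_expand[OF i, of w' z'] have "[int (encode (w, z) i) = ?e' i] (mod int d)" by simp
      then show ?thesis by (rule cong_trans[OF cong_sym[OF encode_cong_expand[OF i]]])
    qed
    have "w j = w' j \<and> z j = z' j" for j
    proof (cases "j < n")
      case True
      have "[sform n (\<lambda>l. int (g j l)) ?e = sform n (\<lambda>l. int (g j l)) ?e'] (mod int d)"
        "[sform n (\<lambda>l. int (h j l)) ?e = sform n (\<lambda>l. int (h j l)) ?e'] (mod int d)"
        by (rule sform_cong[OF cong_refl ee]; assumption)+
      then have "[int (z j) = int (z' j)] (mod int d)" and "[- int (w j) = - int (w' j)] (mod int d)"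
        using cong_trans[OF cong_sym[OF sform_g_expand[OF True]] cong_trans[OF _ sform_g_expand[OF True]]]
          cong_trans[OF cong_sym[OF sform_h_expand[OF True]] cong_trans[OF _ sform_h_expand[OF True]]]
        by blast+
      then have "[w j = w' j] (mod d)" "[z j = z' j] (mod d)"
        by (simp_all add: cong_minus_minus_iff cong_int_iff)
      then show ?thesis using p q True unfolding pwz qwz by (auto simp: vecs_def cong_def)
    next
      case False
      then show ?thesis using p q unfolding pwz qwz by (auto simp: vecs_def)
    qed
    then show "p = q" unfolding pwz qwz by auto
  qed
  have "encode ` (vecs d n \<times> vecs d n) \<subseteq> vecs d (2*n)"
    using d_gt_1 by (auto simp: encode_def vecs_def)
  moreover have "card (encode ` (vecs d n \<times> vecs d n)) = card (vecs d (2*n))"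
    by (simp add: card_image[OF inj] card_cartesian_product card_vecs mult_2 power_add)
  ultimately have "encode ` (vecs d n \<times> vecs d n) = vecs d (2*n)"
    by (intro card_subset_eq) auto
  then show ?thesis using inj by (simp add: bij_betw_def)
qed

lemma coords_in_vecs:
  assumes x: "x \<in> vecs d (2*n)"
  shows "coords d n g h x \<in> vecs d n \<times> vecs d n" "encode (coords d n g h x) = x"
proof -
  have "\<exists>!wz. wz \<in> vecs d n \<times> vecs d n \<and> x = encode wz"
  proof (rule ex_ex1I)
    show "\<exists>wz. wz \<in> vecs d n \<times> vecs d n \<and> x = encode wz"
      using bij_betw_imp_surj_on[OF bij_encode] x by blast
    show "wz = wz'" if "wz \<in> vecs d n \<times> vecs d n \<and> x = encode wz" "wz' \<in> vecs d n \<times> vecs d n \<and> x = encode wz'" for wz wz'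
      using inj_onD[OF bij_betw_imp_inj_on[OF bij_encode], of wz wz'] that by simp
  qed
  from theI'[OF this] have "coords d n g h x \<in> vecs d n \<times> vecs d n \<and> x = encode (coords d n g h x)"
    by (simp only: coords_def encode_def mem_Times_iff conj_assoc)
  then show "coords d n g h x \<in> vecs d n \<times> vecs d n" "encode (coords d n g h x) = x" by auto
qed

lemma expand_coords:
  assumes "x \<in> vecs d (2*n)" "i < 2*n"
  shows "[int (x i) = expand (\<lambda>j. int (fst (coords d n g h x) j)) (\<lambda>j. int (snd (coords d n g h x) j)) i] (mod int d)"
  using encode_cong_expand[OF assms(2), of "fst (coords d n g h x)" "snd (coords d n g h x)"]
    coords_in_vecs[OF assms(1)] by simp

end

section \<open>Splitting n m systems into m blocks\<close>

definition block :: "nat \<Rightarrow> nat \<Rightarrow> (nat \<Rightarrow> nat) \<Rightarrow> nat \<Rightarrow> nat" where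
  "block n b x = (\<lambda>i. if i < 2*n then x (2*n*b + i) else 0)"

definition blocks :: "nat \<Rightarrow> nat \<Rightarrow> (nat \<Rightarrow> nat) \<Rightarrow> nat \<Rightarrow> nat \<Rightarrow> nat" where
  "blocks n m x = (\<lambda>b\<in>{..<m}. block n b x)"

lemma block_index: "b < m \<Longrightarrow> i < l \<Longrightarrow> l * b + i < l * m" for l :: nat
proof -
  assume *: "b < m" "i < l"
  then have "l * b + i < l * b + l" by simp
  also have "\<dots> = l * Suc b" by simp
  also have "\<dots> \<le> l * m" using * by (intro mult_le_mono2) simp
  finally show ?thesis .
qed

lemma bij_blocks:
  assumes n: "n > 0"
  shows "bij_betw (blocks n m) (vecs d (2*(n*m))) (PiE {..<m} (\<lambda>_. vecs d (2*n)))"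
proof (rule bij_betw_byWitness[where f' = "\<lambda>f i. if i < 2*n*m then f (i div (2*n)) (i mod (2*n)) else 0"])
  show "\<forall>x\<in>vecs d (2*(n*m)). (\<lambda>i. if i < 2*n*m then blocks n m x (i div (2*n)) (i mod (2*n)) else 0) = x"
    using n by (auto simp: blocks_def block_def vecs_def fun_eq_iff less_mult_imp_div_less mult.commute not_less)
  show "\<forall>f\<in>PiE {..<m} (\<lambda>_. vecs d (2*n)). blocks n m (\<lambda>i. if i < 2*n*m then f (i div (2*n)) (i mod (2*n)) else 0) = f"
  proof
    fix f assume f: "f \<in> PiE {..<m} (\<lambda>_. vecs d (2*n))"
    show "blocks n m (\<lambda>i. if i < 2*n*m then f (i div (2*n)) (i mod (2*n)) else 0) = f"
    proof (intro ext)
      fix b i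
      show "blocks n m (\<lambda>i. if i < 2*n*m then f (i div (2*n)) (i mod (2*n)) else 0) b i = f b i"
      proof (cases "b < m")
        case b: True
        have "f b \<in> vecs d (2*n)" using f b by auto
        then show ?thesis using b block_index[OF b, of i "2*n"]
          by (auto simp: blocks_def block_def vecs_def)
      next
        case False
        then show ?thesis using f by (auto simp: blocks_def PiE_def extensional_def)
      qed
    qed
  qed
  show "blocks n m ` vecs d (2*(n*m)) \<subseteq> PiE {..<m} (\<lambda>_. vecs d (2*n))"
    using block_index[of _ m _ "2*n"] by (auto simp: blocks_def block_def vecs_def mult.assoc)
  show "(\<lambda>f i. if i < 2*n*m then f (i div (2*n)) (i mod (2*n)) else 0) ` PiE {..<m} (\<lambda>_. vecs d (2*n)) \<subseteq> vecs d (2*(n*m))"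
  proof (rule image_subsetI)
    fix f assume f: "f \<in> PiE {..<m} (\<lambda>_. vecs d (2*n))"
    have "f (i div (2*n)) (i mod (2*n)) < d" if "i < 2*n*m" for i
    proof -
      have "i div (2*n) < m" using that by (simp add: less_mult_imp_div_less mult.commute)
      then have "f (i div (2*n)) \<in> vecs d (2*n)" using f by auto
      then show ?thesis using n by (simp add: vecs_def)
    qed
    then show "(\<lambda>i. if i < 2*n*m then f (i div (2*n)) (i mod (2*n)) else 0) \<in> vecs d (2*(n*m))"
      by (simp add: vecs_def mult.assoc)
  qed
qed

lemma prodP_blocks: "prodP P (n*m) x = (\<Prod>b<m. prodP P n (blocks n m x b))"
proof -
  have "prodP P (n*m) x = (\<Prod>b<m. \<Prod>i\<in>{b*n..<b*n+n}. P (x (2*i), x (2*i+1)))"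
    unfolding prodP_def by (simp add: prod.nat_group mult.commute)
  also have "\<dots> = (\<Prod>b<m. prodP P n (blocks n m x b))"
  proof (rule prod.cong[OF refl])
    fix b assume b: "b \<in> {..<m}"
    have "(\<Prod>i\<in>{b*n..<b*n+n}. P (x (2*i), x (2*i+1))) = (\<Prod>i\<in>{0..<n}. P (x (2*(i+b*n)), x (2*(i+b*n)+1)))"
      using prod.shift_bounds_nat_ivl[of "\<lambda>i. P (x (2*i), x (2*i+1))" 0 "b*n" n] by (simp add: add.commute)
    also have "\<dots> = prodP P n (blocks n m x b)"
      unfolding prodP_def blocks_def block_def using b
      by (intro prod.cong) (auto simp: algebra_simps)
    finally show "(\<Prod>i\<in>{b*n..<b*n+n}. P (x (2*i), x (2*i+1))) = prodP P n (blocks n m x b)" .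
  qed
  finally show ?thesis .
qed

text \<open>Independence of the blocks: the product of sums expands into a sum over choice
  functions, which are exactly the block decompositions.\<close>

lemma sum_prodP_blocks:
  assumes n: "n > 0" and F: "\<And>b. b < m \<Longrightarrow> F b \<subseteq> vecs d (2*n)"
  shows "sum (prodP P (n*m)) {x \<in> vecs d (2*(n*m)). \<forall>b<m. block n b x \<in> F b} = (\<Prod>b<m. sum (prodP P n) (F b))"
proof -
  have b: "bij_betw (blocks n m) {x \<in> vecs d (2*(n*m)). \<forall>b<m. block n b x \<in> F b} (PiE {..<m} F)"
  proof (rule bij_betw_subset[OF bij_blocks[OF n, of m d]])
    have "blocks n m ` {x \<in> vecs d (2*(n*m)). \<forall>b<m. block n b x \<in> F b}
       = {f \<in> blocks n m ` vecs d (2*(n*m)). \<forall>b<m. f b \<in> F b}"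
      by (auto simp: blocks_def)
    also have "\<dots> = PiE {..<m} F"
      unfolding bij_betw_imp_surj_on[OF bij_blocks[OF n]] 
      by (rule set_eqI, simp only: PiE_iff mem_Collect_eq Ball_def lessThan_iff) (use F in blast)
    finally show "blocks n m ` {x \<in> vecs d (2*(n*m)). \<forall>b<m. block n b x \<in> F b} = PiE {..<m} F" .
  qed auto
  have "finite (F b)" if "b < m" for b using F[OF that] finite_vecs finite_subset by blast
  then have "(\<Prod>b<m. sum (prodP P n) (F b)) = (\<Sum>f\<in>PiE {..<m} F. \<Prod>b<m. prodP P n (f b))"
    by (intro prod_sum_PiE) auto
  also have "\<dots> = sum (prodP P (n*m)) {x \<in> vecs d (2*(n*m)). \<forall>b<m. block n b x \<in> F b}"
    unfolding prodP_blocks by (rule sum.reindex_bij_betw[OF b, symmetric])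
  finally show ?thesis by simp
qed

text \<open>Blocks of length 1 reduce this to the normalisation of P.\<close>

lemma sum_prodP:
  assumes "(\<Sum>u<d. \<Sum>v<d. P (u, v)) = 1"
  shows "sum (prodP P M) (vecs d (2*M)) = 1"
proof -
  have b: "bij_betw (\<lambda>y. (y 0, y 1)) (vecs d 2) ({..<d} \<times> {..<d})"
    by (rule bij_betw_byWitness[where f' = "\<lambda>(u, v) i. if i = 0 then u else if i = 1 then v else 0"])
      (auto simp: vecs_def fun_eq_iff less_2_cases_iff)
  have "sum (prodP P 1) (vecs d (2*1)) = (\<Sum>y\<in>vecs d 2. P (y 0, y 1))"
    by (simp add: prodP_def)
  also have "\<dots> = sum P ({..<d} \<times> {..<d})" by (rule sum.reindex_bij_betw[OF b])
  also have "\<dots> = 1" using assms by (simp add: sum.cartesian_product)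
  finally have one: "sum (prodP P 1) (vecs d (2*1)) = 1" .
  have "block 1 b x \<in> vecs d (2*1)" if "x \<in> vecs d (2*M)" "b < M" for x b
    using that block_index[OF that(2), of _ 2] by (auto simp: vecs_def block_def)
  then have "{x \<in> vecs d (2*(1*M)). \<forall>b<M. block 1 b x \<in> vecs d (2*1)} = vecs d (2*M)" by auto
  then show ?thesis using sum_prodP_blocks[of 1 M "\<lambda>_. vecs d (2*1)" d P] one by simp
qed

lemma sum_lessThan_add: "(\<Sum>j<a + c. f j) = (\<Sum>j<a. f j) + (\<Sum>j<c. f (a + j))" for a c :: nat
  by (induction c) (simp_all add: add.assoc)

lemma sum_lessThan_mult: "(\<Sum>q<l * m. f q) = (\<Sum>b<m. \<Sum>j<l. f (l * b + j))" for l m :: nat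
proof (induction m)
  case (Suc m)
  have "(\<Sum>q<l * Suc m. f q) = (\<Sum>q<l * m + l. f q)" by (simp add: add.commute)
  then show ?case by (simp add: sum_lessThan_add Suc)
qed simp

lemma sform_blocks: "sform (n*m) x y = (\<Sum>b<m. sform n (\<lambda>i. x (2*n*b + i)) (\<lambda>i. y (2*n*b + i)))"
  unfolding sform_def sum_lessThan_mult by (simp add: algebra_simps)

lemma shear_add:
  "shear N S T (\<lambda>q. w q + w' q) (\<lambda>q. z q + z' q) q = shear N S T w z q + shear N S T w' z' q"
  by (simp add: shear_def matvec_def algebra_simps sum.distrib)

lemma shear_diff:
  "shear N S T (\<lambda>q. w q - w' q) (\<lambda>q. z q - z' q) q = shear N S T w z q - shear N S T w' z' q"
  by (simp add: shear_def matvec_def algebra_simps sum.distrib sum_subtractf)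

lemma shear_zero: "shear N S T (\<lambda>_. 0) (\<lambda>_. 0) q = 0"
  by (simp add: shear_def matvec_def)

section \<open>Coordinates of the concatenated code\<close>

locale code_layout = symplectic_basis +
  fixes k m :: nat
  assumes k: "1 \<le> k" "k \<le> n"
begin

abbreviation N :: nat where "N \<equiv> k * m"

lemma n_pos: "n > 0" using k by simp

lemma expand_add: "expand w z i + expand w' z' i = expand (\<lambda>j. w j + w' j) (\<lambda>j. z j + z' j) i"
  by (simp add: expand_def algebra_simps sum.distrib)

lemma expand_eqI: "(\<And>j. j < n \<Longrightarrow> w j = w' j) \<Longrightarrow> (\<And>j. j < n \<Longrightarrow> z j = z' j) \<Longrightarrow> expand w z i = expand w' z' i"
  by (simp add: expand_def)

text \<open>Within block b the first n - k coordinates belong to the inner code; the other k are the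
  entries k b, ..., k b + k - 1 of the long outer vector.\<close>

definition merge :: "(nat \<Rightarrow> nat \<Rightarrow> int) \<Rightarrow> (nat \<Rightarrow> int) \<Rightarrow> nat \<Rightarrow> nat \<Rightarrow> int" where
  "merge \<sigma> w b j = (if j < n - k then \<sigma> b j else w (k * b + (j - (n - k))))"

text \<open>The vector of F^(2nm) with inner g-coordinates \<alpha>, inner h-coordinates \<zeta> and
  outer coordinates (w, z).\<close>

definition emb :: "(nat \<Rightarrow> nat \<Rightarrow> int) \<Rightarrow> (nat \<Rightarrow> nat \<Rightarrow> int) \<Rightarrow> (nat \<Rightarrow> int) \<Rightarrow> (nat \<Rightarrow> int) \<Rightarrow> nat \<Rightarrow> int" where
  "emb \<alpha> \<zeta> w z i = expand (merge \<alpha> w (i div (2*n))) (merge \<zeta> z (i div (2*n))) (i mod (2*n))"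

lemma emb_add:
  "emb \<alpha> \<zeta> w z i + emb \<alpha>' \<zeta>' w' z' i
     = emb (\<lambda>b j. \<alpha> b j + \<alpha>' b j) (\<lambda>b j. \<zeta> b j + \<zeta>' b j) (\<lambda>q. w q + w' q) (\<lambda>q. z q + z' q) i"
  unfolding emb_def expand_add by (rule expand_eqI) (simp_all only: merge_def split: if_split, simp_all)

text \<open>The basis is symplectic in each block, so the form splits into an inner and an outer
  part, and the outer code can be designed inside F^(2N).\<close>

lemma sform_emb:
  "[sform (n*m) (emb \<alpha> \<zeta> w z) (emb \<alpha>' \<zeta>' w' z') =
     (\<Sum>b<m. \<Sum>j<n-k. \<alpha> b j * \<zeta>' b j - \<zeta> b j * \<alpha>' b j) + (\<Sum>q<N. w q * z' q - z q * w' q)] (mod int d)"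
proof -
  let ?F = "\<lambda>b j. merge \<alpha> w b j * merge \<zeta>' z' b j - merge \<zeta> z b j * merge \<alpha>' w' b j"
  have "[sform (n*m) (emb \<alpha> \<zeta> w z) (emb \<alpha>' \<zeta>' w' z') = (\<Sum>b<m. \<Sum>j<n. ?F b j)] (mod int d)"
    unfolding sform_blocks
  proof (rule cong_sum)
    fix b
    have "[sform n (\<lambda>i. emb \<alpha> \<zeta> w z (2*n*b + i)) (\<lambda>i. emb \<alpha>' \<zeta>' w' z' (2*n*b + i))
       = sform n (expand (merge \<alpha> w b) (merge \<zeta> z b)) (expand (merge \<alpha>' w' b) (merge \<zeta>' z' b))] (mod int d)"
      by (rule sform_cong) (simp_all add: emb_def)
    also have "[sform n (expand (merge \<alpha> w b) (merge \<zeta> z b)) (expand (merge \<alpha>' w' b) (merge \<zeta>' z' b))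
       = (\<Sum>j<n. ?F b j)] (mod int d)" by (rule sform_expand)
    finally show "[sform n (\<lambda>i. emb \<alpha> \<zeta> w z (2*n*b + i)) (\<lambda>i. emb \<alpha>' \<zeta>' w' z' (2*n*b + i)) = (\<Sum>j<n. ?F b j)] (mod int d)" .
  qed
  also have "(\<Sum>b<m. \<Sum>j<n. ?F b j) = (\<Sum>b<m. (\<Sum>j<n-k. ?F b j) + (\<Sum>j<k. ?F b (n-k+j)))"
    by (rule sum.cong[OF refl], subst sum_lessThan_add[symmetric]) (use k in simp)
  also have "\<dots> = (\<Sum>b<m. \<Sum>j<n-k. \<alpha> b j * \<zeta>' b j - \<zeta> b j * \<alpha>' b j) + (\<Sum>q<N. w q * z' q - z q * w' q)"
    unfolding sum_lessThan_mult sum.distrib by (simp add: merge_def)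
  finally show ?thesis .
qed

section \<open>Error classes: syndrome and logical part\<close>

definition synd :: "(nat \<Rightarrow> nat) \<Rightarrow> nat \<Rightarrow> nat" where
  "synd y = (\<lambda>i. if i < n - k then snd (coords d n g h y) i else 0)"

text \<open>Pairing with the first n - k vectors g reads off the h-coordinates, hence
  \<open>synd\<close>; the matching g-coordinates are a shift by L and are dropped. Both functions
  are padded with 0 so that they are elements of \<open>vecs\<close>.\<close>

definition logi :: "(nat \<Rightarrow> nat) \<Rightarrow> nat \<Rightarrow> nat" where
  "logi y = (\<lambda>i. if i < 2*k then (if even i then fst (coords d n g h y) else snd (coords d n g h y)) (n - k + i div 2) else 0)"

lemma synd_in_vecs: "y \<in> vecs d (2*n) \<Longrightarrow> synd y \<in> vecs d (n-k)"
  using coords_in_vecs(1)[of y] by (auto simp: synd_def vecs_def mem_Times_iff)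

lemma logi_in_vecs: "y \<in> vecs d (2*n) \<Longrightarrow> logi y \<in> vecs d (2*k)"
  using coords_in_vecs(1)[of y] k by (auto simp: logi_def vecs_def mem_Times_iff)

lemma PL_eq:
  assumes s: "s \<in> vecs d (n-k)" and u: "u \<in> vecs d (2*k)"
  shows "PL d n k P g h (s, u) = sum (prodP P n) {y \<in> vecs d (2*n). synd y = s \<and> logi y = u}"
proof -
  have "(\<forall>i<n-k. snd (coords d n g h y) i = s i) \<longleftrightarrow> synd y = s" for y
    using s by (auto simp: synd_def vecs_def fun_eq_iff)
  moreover have "(\<forall>j<k. fst (coords d n g h y) (n-k+j) = u (2*j) \<and> snd (coords d n g h y) (n-k+j) = u (2*j+1))
     \<longleftrightarrow> logi y = u" (is "?l y \<longleftrightarrow> _") for y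
  proof
    assume l: "?l y"
    show "logi y = u"
    proof
      fix i
      show "logi y i = u i"
      proof (cases "i < 2*k")
        case True
        then show ?thesis using l[rule_format, of "i div 2"]
          by (cases "even i") (auto simp: logi_def)
      qed (use u in \<open>auto simp: logi_def vecs_def\<close>)
    qed
  next
    assume "logi y = u"
    then show "?l y" by (auto simp: logi_def)
  qed
  ultimately show ?thesis by (simp add: PL_def)
qed

text \<open>Position q of the outer vector is entry \<open>q mod k\<close> of block
  \<open>q div k\<close>; within u, even indices hold w and odd ones z.\<close>

definition lw :: "(nat \<Rightarrow> nat \<Rightarrow> nat) \<Rightarrow> nat \<Rightarrow> int" where
  "lw u q = int (u (q div k) (2 * (q mod k)))"

definition lz :: "(nat \<Rightarrow> nat \<Rightarrow> nat) \<Rightarrow> nat \<Rightarrow> int" where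
  "lz u q = int (u (q div k) (2 * (q mod k) + 1))"

text \<open>The representative of an error class whose inner g-coordinates are all 0.\<close>

definition err :: "(nat \<Rightarrow> nat \<Rightarrow> nat) \<times> (nat \<Rightarrow> nat \<Rightarrow> nat) \<Rightarrow> nat \<Rightarrow> int" where
  "err su = emb (\<lambda>_ _. 0) (\<lambda>b j. int (fst su b j)) (lw (snd su)) (lz (snd su))"

definition cls :: "(nat \<Rightarrow> nat) \<Rightarrow> (nat \<Rightarrow> nat \<Rightarrow> nat) \<times> (nat \<Rightarrow> nat \<Rightarrow> nat)" where
  "cls x = (\<lambda>b\<in>{..<m}. synd (block n b x), \<lambda>b\<in>{..<m}. logi (block n b x))"

abbreviation Ss :: "(nat \<Rightarrow> nat \<Rightarrow> nat) set" where "Ss \<equiv> PiE {..<m} (\<lambda>_. vecs d (n-k))"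
abbreviation Us :: "(nat \<Rightarrow> nat \<Rightarrow> nat) set" where "Us \<equiv> PiE {..<m} (\<lambda>_. vecs d (2*k))"

lemma block_in_vecs: "x \<in> vecs d (2*(n*m)) \<Longrightarrow> b < m \<Longrightarrow> block n b x \<in> vecs d (2*n)"
  using bij_betwE[OF bij_blocks[OF n_pos, of m d]] by (auto simp: blocks_def PiE_iff)

lemma cls_in: "x \<in> vecs d (2*(n*m)) \<Longrightarrow> cls x \<in> Ss \<times> Us"
  using block_in_vecs synd_in_vecs logi_in_vecs by (auto simp: cls_def)

lemma finite_Ss: "finite Ss" and finite_Us: "finite Us"
  by (auto intro: finite_PiE)

text \<open>The g-coordinates missing from \<open>err (cls x)\<close> form the family f: an error is
  its representative times an inner stabilizer element.\<close>

lemma err_cls: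
  assumes x: "x \<in> vecs d (2*(n*m))"
  obtains f where "f \<in> Ss"
    "\<And>i. i < 2*(n*m) \<Longrightarrow> [int (x i) = err (cls x) i + emb (\<lambda>b j. int (f b j)) (\<lambda>_ _. 0) (\<lambda>_. 0) (\<lambda>_. 0) i] (mod int d)"
proof
  define c where "c = (\<lambda>b. coords d n g h (block n b x))"
  define f where "f = (\<lambda>b\<in>{..<m}. \<lambda>j. if j < n - k then fst (c b) j else 0)"
  show "f \<in> Ss" using coords_in_vecs(1)[OF block_in_vecs[OF x]]
    unfolding f_def c_def by (auto simp: vecs_def mem_Times_iff)
  fix i assume i: "i < 2*(n*m)"
  define b where "b = i div (2*n)"
  have b: "b < m" using i unfolding b_def by (simp add: less_mult_imp_div_less mult_ac)
  have im: "i mod (2*n) < 2*n" using n_pos by simp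
  have "x i = block n b x (i mod (2*n))" using im by (simp add: block_def b_def)
  then have "[int (x i) = expand (\<lambda>j. int (fst (c b) j)) (\<lambda>j. int (snd (c b) j)) (i mod (2*n))] (mod int d)"
    unfolding c_def using expand_coords[OF block_in_vecs[OF x b] im] by simp
  also have "expand (\<lambda>j. int (fst (c b) j)) (\<lambda>j. int (snd (c b) j)) (i mod (2*n))
     = emb (\<lambda>b j. int (f b j)) (\<lambda>b j. int (fst (cls x) b j)) (lw (snd (cls x))) (lz (snd (cls x))) i"
    unfolding emb_def b_def[symmetric]
  proof (rule expand_eqI)
    fix j assume j: "j < n"
    define j' where "j' = j - (n - k)"
    have j': "j' < k" "\<not> j < n - k \<Longrightarrow> n - k + j' = j" using j k unfolding j'_def by auto
    then have idx: "(k * b + j') div k = b" "(k * b + j') mod k = j'" by simp_all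
    show "int (fst (c b) j) = merge (\<lambda>b j. int (f b j)) (lw (snd (cls x))) b j"
      "int (snd (c b) j) = merge (\<lambda>b j. int (fst (cls x) b j)) (lz (snd (cls x))) b j"
      using b idx j' unfolding merge_def j'_def[symmetric]
      by (auto simp: f_def cls_def lw_def lz_def logi_def synd_def c_def)
  qed
  also have "\<dots> = err (cls x) i + emb (\<lambda>b j. int (f b j)) (\<lambda>_ _. 0) (\<lambda>_. 0) (\<lambda>_. 0) i"
    unfolding err_def emb_add by simp
  finally show "[int (x i) = err (cls x) i + emb (\<lambda>b j. int (f b j)) (\<lambda>_ _. 0) (\<lambda>_. 0) (\<lambda>_. 0) i] (mod int d)" .
qed

definition pL :: "(nat \<times> nat \<Rightarrow> real) \<Rightarrow> (nat \<Rightarrow> nat \<Rightarrow> nat) \<times> (nat \<Rightarrow> nat \<Rightarrow> nat) \<Rightarrow> real" where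
  "pL P su = (\<Prod>b<m. PL d n k P g h (fst su b, snd su b))"

text \<open>\<open>pL P\<close> is the distribution of the class of a random error: split by class,
  then use independence of the blocks.\<close>

lemma sum_prodP_cls:
  assumes J: "J \<subseteq> Ss \<times> Us"
  shows "sum (prodP P (n*m)) {x \<in> vecs d (2*(n*m)). cls x \<in> J} = sum (pL P) J"
proof -
  have finJ: "finite J" using J finite_Ss finite_Us finite_subset by blast
  have "sum (prodP P (n*m)) {x \<in> vecs d (2*(n*m)). cls x \<in> J}
     = (\<Sum>su\<in>J. sum (prodP P (n*m)) {x \<in> {x \<in> vecs d (2*(n*m)). cls x \<in> J}. cls x = su})"
    by (rule sum.group[symmetric]) (use finJ in auto)
  also have "\<dots> = sum (pL P) J"
  proof (rule sum.cong[OF refl])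
    fix su assume su: "su \<in> J"
    obtain s u where [simp]: "su = (s, u)" by (cases su)
    have s: "s b \<in> vecs d (n-k)" and u: "u b \<in> vecs d (2*k)" if "b < m" for b
      using that su J by (auto simp: PiE_iff subset_iff)
    have ext: "s \<in> extensional {..<m}" "u \<in> extensional {..<m}" using su J by (auto simp: PiE_iff subset_iff)
    let ?F = "\<lambda>b. {y \<in> vecs d (2*n). synd y = s b \<and> logi y = u b}"
    have iff: "cls x = su \<longleftrightarrow> (\<forall>b<m. synd (block n b x) = s b \<and> logi (block n b x) = u b)" for x
      using ext by (auto simp: cls_def fun_eq_iff extensional_def restrict_def)
    have "{x \<in> {x \<in> vecs d (2*(n*m)). cls x \<in> J}. cls x = su} = {x \<in> vecs d (2*(n*m)). cls x = su}"
      using su by auto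
    also have "\<dots> = {x \<in> vecs d (2*(n*m)). \<forall>b<m. block n b x \<in> ?F b}"
      unfolding iff using block_in_vecs by auto
    finally have "sum (prodP P (n*m)) {x \<in> {x \<in> vecs d (2*(n*m)). cls x \<in> J}. cls x = su} = (\<Prod>b<m. sum (prodP P n) (?F b))"
      using sum_prodP_blocks[OF n_pos, of m ?F d P] by auto
    also have "\<dots> = pL P su" unfolding pL_def using PL_eq[OF s u] by (intro prod.cong) auto
    finally show "sum (prodP P (n*m)) {x \<in> {x \<in> vecs d (2*(n*m)). cls x \<in> J}. cls x = su} = pL P su" .
  qed
  finally show ?thesis .
qed

text \<open>The entries of t from K on are the only ones that the outer code checks; here they fail
  to distinguish u from u'.\<close>

definition bad :: "nat \<Rightarrow> (nat \<Rightarrow> nat \<Rightarrow> int) \<times> (nat \<Rightarrow> nat \<Rightarrow> int) \<Rightarrow> (nat \<Rightarrow> nat \<Rightarrow> nat) \<Rightarrow> (nat \<Rightarrow> nat \<Rightarrow> nat) \<Rightarrow> bool" where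
  "bad K ST u u' \<longleftrightarrow> (\<forall>q. K \<le> q \<and> q < N \<longrightarrow>
     int d dvd shear N (fst ST) (snd ST) (\<lambda>q. lw u q - lw u' q) (\<lambda>q. lz u q - lz u' q) q)"

lemma bad_sym: "bad K ST u u' \<Longrightarrow> bad K ST u' u"
  unfolding bad_def shear_diff by (simp add: dvd_diff_commute)

text \<open>Distinct u and u' differ at some index i of some block b, that is, in outer position k b
  + i div 2; the parity of i tells whether w or z differs there.\<close>

lemma card_bad:
  assumes K: "K \<le> N" and u: "u \<in> Us" "u' \<in> Us" "u \<noteq> u'"
  shows "real (card {ST \<in> sym_mats d N \<times> sym_mats d N. bad K ST u u'})
     \<le> 2 * real d ^ K / real d ^ N * real (card (sym_mats d N \<times> sym_mats d N))"
proof -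
  obtain b where b: "b < m" "u b \<noteq> u' b" using u by (metis PiE_ext lessThan_iff)
  have ub: "u b \<in> vecs d (2*k)" "u' b \<in> vecs d (2*k)" using u b by auto
  obtain i where i: "u b i \<noteq> u' b i" using b by auto
  then have i2: "i < 2*k" using ub by (metis (mono_tags, lifting) mem_Collect_eq not_le vecs_def)
  then have lt: "u b i < d" "u' b i < d" using ub by (auto simp: vecs_def)
  have nd: "\<not> int d dvd int (u b i) - int (u' b i)"
  proof
    assume "int d dvd int (u b i) - int (u' b i)"
    then have "[int (u b i) = int (u' b i)] (mod int d)" by (simp add: cong_iff_dvd_diff)
    then show False using lt i by (simp add: cong_int_iff cong_def)
  qed
  define q where "q = k * b + i div 2"
  have i3: "i div 2 < k" using i2 by simp
  have q: "q < N" unfolding q_def by (rule block_index[OF b(1) i3])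
  have qd: "q div k = b" "q mod k = i div 2" unfolding q_def using i3 by auto
  have "\<not> int d dvd lw u q - lw u' q \<or> \<not> int d dvd lz u q - lz u' q"
  proof (cases "even i")
    case True
    then show ?thesis using nd by (simp add: lw_def qd)
  next
    case False
    then have "2 * (i div 2) + 1 = i" by simp
    then show ?thesis using nd by (simp add: lz_def qd)
  qed
  then have nz: "\<exists>q<N. \<not> int d dvd lw u q - lw u' q \<or> \<not> int d dvd lz u q - lz u' q" using q by blast
  show ?thesis
    using card_shear_vanishing[OF prime_d K nz] unfolding bad_def by (simp add: case_prod_unfold mem_Times_iff)
qed

end

section \<open>Concatenated codes\<close>

context code_layout begin

lemma PL_nonneg:
  assumes "\<forall>u<d. \<forall>v<d. P (u, v) \<ge> 0"
  shows "PL d n k P g h su \<ge> 0"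
  unfolding PL_def using prodP_nonneg[OF assms] by (intro sum_nonneg) auto

lemma sum_PL:
  assumes total: "(\<Sum>u<d. \<Sum>v<d. P (u, v)) = 1"
  shows "sum (PL d n k P g h) (vecs d (n-k) \<times> vecs d (2*k)) = 1"
proof -
  have "sum (PL d n k P g h) (vecs d (n-k) \<times> vecs d (2*k))
     = (\<Sum>su\<in>vecs d (n-k) \<times> vecs d (2*k). sum (prodP P n) {y \<in> vecs d (2*n). (synd y, logi y) = su})"
    by (intro sum.cong refl) (auto simp: PL_eq)
  also have "\<dots> = sum (prodP P n) (vecs d (2*n))"
    by (rule sum.group) (use synd_in_vecs logi_in_vecs in auto)
  finally show ?thesis using sum_prodP[OF total] by simp
qed

lemma sum_pL:
  assumes total: "(\<Sum>u<d. \<Sum>v<d. P (u, v)) = 1"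
  shows "sum (pL P) (Ss \<times> Us) = 1"
proof -
  have "{x \<in> vecs d (2*(n*m)). cls x \<in> Ss \<times> Us} = vecs d (2*(n*m))" using cls_in by blast
  then show ?thesis using sum_prodP_cls[of "Ss \<times> Us" P] sum_prodP[OF total, of "n*m"] by simp
qed

text \<open>Gallager's function is multiplicative for product distributions: sums over choice
  functions turn into products, once for u and once for s.\<close>

lemma sum_pL_powr:
  assumes P: "\<forall>u<d. \<forall>v<d. P (u, v) \<ge> 0"
  shows "(\<Sum>s\<in>Ss. (\<Sum>u\<in>Us. pL P (s, u) powr \<sigma>) powr \<tau>)
     = (\<Sum>s\<in>vecs d (n-k). (\<Sum>u\<in>vecs d (2*k). PL d n k P g h (s, u) powr \<sigma>) powr \<tau>) ^ m"
proof -
  let ?A = "\<lambda>s. \<Sum>u\<in>vecs d (2*k). PL d n k P g h (s, u) powr \<sigma>"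
  have "(\<Sum>u\<in>Us. pL P (s, u) powr \<sigma>) = (\<Prod>b<m. ?A (s b))" for s
  proof -
    have "(\<Sum>u\<in>Us. pL P (s, u) powr \<sigma>) = (\<Sum>u\<in>Us. \<Prod>b<m. PL d n k P g h (s b, u b) powr \<sigma>)"
      unfolding pL_def using PL_nonneg[OF P] by (simp add: prod_powr_distrib)
    also have "\<dots> = (\<Prod>b<m. ?A (s b))" by (rule prod_sum_PiE[symmetric]) auto
    finally show ?thesis .
  qed
  then have "(\<Sum>s\<in>Ss. (\<Sum>u\<in>Us. pL P (s, u) powr \<sigma>) powr \<tau>) = (\<Sum>s\<in>Ss. \<Prod>b<m. ?A (s b) powr \<tau>)"
    by (simp add: prod_powr_distrib sum_nonneg)
  also have "\<dots> = (\<Prod>b<m. \<Sum>s\<in>vecs d (n-k). ?A s powr \<tau>)" by (rule prod_sum_PiE[symmetric]) auto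
  finally show ?thesis by simp
qed

end

section \<open>The error exponent\<close>

text \<open>The given code makes the set of fidelities nonempty and the bound 1 makes it bounded, as
  the real supremum requires.\<close>

lemma fidelity_le_Fstar:
  fixes \<omega> :: complex
  assumes d: "prime d" and \<omega>: "\<omega> ^ d = 1" "\<forall>j. 0 < j \<and> j < d \<longrightarrow> \<omega> ^ j \<noteq> 1"
    and P: "\<forall>u<d. \<forall>v<d. P (u, v) \<ge> 0" and total: "(\<Sum>u<d. \<Sum>v<d. P (u, v)) = 1"
    and code: "orthonormal (d^M) B" "is_tpcp_kraus (d^M) Ks" "length B > 0" "log (real d) (real (length B)) \<ge> K"
  shows "fidelity (d^M) (chan d \<omega> P M) B Ks \<le> Fstar d \<omega> P M K" "Fstar d \<omega> P M K \<le> 1"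
proof -
  have pg: "pauli_group d \<omega>" using d \<omega> by unfold_locales
  let ?F = "{fidelity (d^M) (chan d \<omega> P M) B Ks | B Ks.
      orthonormal (d^M) B \<and> is_tpcp_kraus (d^M) Ks \<and> length B > 0 \<and> log (real d) (real (length B)) \<ge> K}"
  have le: "f \<le> 1" if "f \<in> ?F" for f
    using that pauli_group.fidelity_le_1[OF pg P sum_prodP[OF total]] by auto
  have mem: "fidelity (d^M) (chan d \<omega> P M) B Ks \<in> ?F" using code by blast
  show "fidelity (d^M) (chan d \<omega> P M) B Ks \<le> Fstar d \<omega> P M K"
    unfolding Fstar_def by (rule cSup_upper[OF mem bdd_aboveI[OF le]])
  show "Fstar d \<omega> P M K \<le> 1"
    unfolding Fstar_def by (rule cSup_least) (use mem le in auto)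
qed

text \<open>The logarithmic bound is asked for positive \<epsilon> only, since \<open>log\<close> at
  0 is a junk value. If the supremum is 1 the exponent is infinite; otherwise \<epsilon> >= 1 - F >
  0.\<close>

lemma err_exp_ge:
  assumes d: "d > 1" and M: "M > 0" and F: "Fstar d \<omega> P M (R' * real M) \<le> 1"
    and \<epsilon>: "1 - \<epsilon> \<le> Fstar d \<omega> P M (R' * real M)" and log: "\<epsilon> > 0 \<Longrightarrow> log (real d) \<epsilon> \<le> - real M * x"
  shows "ereal x \<le> err_exp d \<omega> P R' M"
proof (cases "Fstar d \<omega> P M (R' * real M) = 1")
  case True
  then show ?thesis by (simp add: err_exp_def)
next
  case False
  define F where "F = Fstar d \<omega> P M (R' * real M)"
  have pos: "0 < 1 - F" "1 - F \<le> \<epsilon>" using False F \<epsilon> unfolding F_def by auto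
  then have "log (real d) (1 - F) \<le> log (real d) \<epsilon>" using d by simp
  also have "\<dots> \<le> - real M * x" using log pos by simp
  finally have "x \<le> - log (real d) (1 - F) / real M" using M by (simp add: field_simps)
  then show ?thesis using False unfolding err_exp_def Let_def F_def by simp
qed

text \<open>The whole space with the identity recovery is an admissible code because R' <= 1, so the
  supremum is at least 0.\<close>

lemma err_exp_nonneg:
  fixes \<omega> :: complex
  assumes d: "prime d" and \<omega>: "\<omega> ^ d = 1" "\<forall>j. 0 < j \<and> j < d \<longrightarrow> \<omega> ^ j \<noteq> 1"
    and P: "\<forall>u<d. \<forall>v<d. P (u, v) \<ge> 0" and total: "(\<Sum>u<d. \<Sum>v<d. P (u, v)) = 1"
    and R': "R' \<le> 1" and M: "M > 0"
  shows "0 \<le> err_exp d \<omega> P R' M"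
proof -
  define B :: "cvec list" where "B = map (\<lambda>a i. if i = a then 1 else 0) [0..<d^M]"
  define Ks :: "cmat list" where "Ks = [\<lambda>i j. if i = j then 1 else 0]"
  have d1: "d > 1" using d prime_gt_1_nat by blast
  have on: "orthonormal (d^M) B"
    unfolding orthonormal_def B_def by (auto simp: if_distrib[of cnj] if_distrib[of "\<lambda>t. t * _"] cong: if_cong)
  have tp: "is_tpcp_kraus (d^M) Ks"
    unfolding is_tpcp_kraus_def Ks_def mmul_def adj_def
    by (auto simp: if_distrib[of cnj] if_distrib[of "\<lambda>t. t * _"] cong: if_cong)
  have len: "length B = d^M" by (simp add: B_def)
  have lg: "log (real d) (real (length B)) \<ge> R' * real M"
    using d1 R' M by (simp add: len log_nat_power)
  have pos: "length B > 0" using len d1 by simp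
  note F = fidelity_le_Fstar[OF d \<omega> P total on tp pos lg]
  have "0 \<le> fidelity (d^M) (chan d \<omega> P M) B Ks"
    using first_in_unit_vecs[OF on pos] by (intro fidelity_ge) (auto intro: fid_at_nonneg[OF P])
  then have "1 - 1 \<le> Fstar d \<omega> P M (R' * real M)" using F(1) by simp
  then have "ereal 0 \<le> err_exp d \<omega> P R' M" by (rule err_exp_ge[OF d1 M F(2)]) simp
  then show ?thesis by (simp add: zero_ereal_def)
qed

theorem theorem2:
  fixes d n k :: nat and \<omega> :: complex and P :: "nat \<times> nat \<Rightarrow> real"
    and L :: "(nat \<Rightarrow> nat) set" and g h :: "nat \<Rightarrow> nat \<Rightarrow> nat" and R' :: real
  assumes "prime d"
    and "\<omega> ^ d = 1" and "\<forall>j. 0 < j \<and> j < d \<longrightarrow> \<omega> ^ j \<noteq> 1"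
    and "\<forall>u<d. \<forall>v<d. P (u, v) \<ge> 0" and "(\<Sum>u<d. \<Sum>v<d. P (u, v)) = 1"
    and "1 \<le> k" and "k \<le> n"
    and "is_subspace d (2*n) L" and "self_orthogonal d n L"
    and "L = fspan d (2*n) g (n-k)" and "lin_indep d (2*n) g (n-k)"
    and "symplectic_ext d n g h"
    and "0 \<le> R'" and "R' \<le> 1"
  shows "limsup (err_exp d \<omega> P R')
           \<ge> E_nk d n k (R' * real n / real k) (PL d n k P g h) / ereal (real n)"
proof -
  note prob = assms(1-5)
  have n0: "n > 0" and d1: "d > 1" using assms(6,7) prime_gt_1_nat[OF assms(1)] by auto
  have layout: "code_layout d n g h k" using assms by unfold_locales
  have random_code: "\<exists>B Ks. orthonormal (d^(n*m)) B \<and> is_tpcp_kraus (d^(n*m)) Ks \<and> length B = d^K \<and>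
     1 - (2 * real d ^ K / real d ^ (k * m)) powr \<rho> *
       (\<Sum>s\<in>vecs d (n-k). (\<Sum>u\<in>vecs d (2*k). PL d n k P g h (s, u) powr (1 / (1 + \<rho>))) powr (1 + \<rho>)) ^ m
     \<le> fidelity (d^(n*m)) (chan d \<omega> P (n*m)) B Ks"
    if K: "K \<le> k * m" and \<rho>: "0 \<le> \<rho>" "\<rho> \<le> 1" for K m \<rho>
  proof -
    interpret code_layout d n g h k m by (rule layout)
    \<comment> \<open>The part without randomness: for fixed shears, any set J of classes in which
      equal syndromes never go with confusable logical parts is correctable.\<close>
    have code_exists: "\<exists>B Ks. orthonormal (d^(n*m)) B \<and> is_tpcp_kraus (d^(n*m)) Ks \<and> length B = d^K \<and>
       sum (pL P) J \<le> fidelity (d^(n*m)) (chan d \<omega> P (n*m)) B Ks"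
      if ST: "S \<in> sym_mats d N" "T \<in> sym_mats d N" and J: "J \<subseteq> Ss \<times> Us"
      and good: "\<And>s u u'. (s, u) \<in> J \<Longrightarrow> (s, u') \<in> J \<Longrightarrow> u \<noteq> u' \<Longrightarrow> \<not> bad K (S, T) u u'" for S T J
    proof -
      have pg: "pauli_group d \<omega>" using prob by unfold_locales
      define stab where "stab = (\<lambda>f :: nat \<Rightarrow> nat \<Rightarrow> nat. emb (\<lambda>b j. int (f b j)) (\<lambda>_ _. 0) (\<lambda>_. 0) (\<lambda>_. 0))"
      \<comment> \<open>\<open>tw q\<close> is column q of 1 + T S. Paired with -S e_q, it
        represents the linear functional that takes (w, z) to entry q of the shear; this uses the
        symmetry of both matrices.\<close>
      define tw where "tw = (\<lambda>q r. (if r = q then 1 else 0) + matvec N T (\<lambda>r. S r q) r)"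
      define test where "test = (\<lambda>q. emb (\<lambda>_ _. 0) (\<lambda>_ _. 0) (tw q) (\<lambda>r. - S r q))"
        \<comment> \<open>the symplectic form with test q reads off entry q of z + S (w + T z)\<close>
      define \<Lambda> where "\<Lambda> = stab ` Ss \<union> test ` {..<N}"
      define yv where "yv = (\<lambda>t :: nat \<Rightarrow> nat. emb (\<lambda>_ _. 0) (\<lambda>_ _. 0) (\<lambda>r. - matvec N T (\<lambda>r. int (t r)) r) (\<lambda>r. int (t r)))"
        \<comment> \<open>w is chosen so that w + T z vanishes and the shear returns t\<close>
      have symS: "S i j = S j i" and symT: "T i j = T j i" for i j using ST by (auto simp: sym_mats_def)
      have stab: "[sform (n*m) (stab f) (emb \<alpha> \<zeta> w z) = (\<Sum>b<m. \<Sum>j<n-k. int (f b j) * \<zeta> b j)] (mod int d)" for f \<alpha> \<zeta> w z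
        using sform_emb[of "\<lambda>b j. int (f b j)" "\<lambda>_ _. 0" "\<lambda>_. 0" "\<lambda>_. 0" \<alpha> \<zeta> w z] unfolding stab_def by simp
      have test: "[sform (n*m) (test q) (emb \<alpha> \<zeta> w z) = shear N S T w z q] (mod int d)" if q: "q < N" for q \<alpha> \<zeta> w z
      proof -
        have "tw q r * z r - - S r q * w r = (if r = q then z r else 0) + (S r q * w r + (\<Sum>s<N. T r s * S s q * z r))" for r
          by (simp add: tw_def matvec_def distrib_right sum_distrib_right)
        then have "(\<Sum>r<N. tw q r * z r - - S r q * w r) = (\<Sum>r<N. (if r = q then z r else 0))
            + ((\<Sum>r<N. S r q * w r) + (\<Sum>r<N. \<Sum>s<N. T r s * S s q * z r))"
          by (simp only: sum.distrib)
        also have "(\<Sum>r<N. \<Sum>s<N. T r s * S s q * z r) = (\<Sum>s<N. \<Sum>r<N. T r s * S s q * z r)" by (rule sum.swap)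
        also have "\<dots> = (\<Sum>s<N. S q s * (\<Sum>r<N. T s r * z r))"
        proof (rule sum.cong[OF refl])
          fix s
          have "T r s * S s q * z r = S q s * (T s r * z r)" for r
            by (simp only: symS[of s q] symT[of r s] mult_ac)
          then show "(\<Sum>r<N. T r s * S s q * z r) = S q s * (\<Sum>r<N. T s r * z r)"
            by (simp only: sum_distrib_left)
        qed
        also have "(\<Sum>r<N. S r q * w r) = (\<Sum>s<N. S q s * w s)" by (simp add: symS[of q])
        also have "(\<Sum>r<N. (if r = q then z r else 0)) = z q" using q by simp
        also have "z q + ((\<Sum>s<N. S q s * w s) + (\<Sum>s<N. S q s * (\<Sum>r<N. T s r * z r))) = shear N S T w z q"
          unfolding shear_def matvec_def by (simp add: distrib_left sum.distrib)
        finally have eq: "(\<Sum>r<N. tw q r * z r - - S r q * w r) = shear N S T w z q" .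
        show ?thesis
          using sform_emb[of "\<lambda>_ _. 0" "\<lambda>_ _. 0" "tw q" "\<lambda>r. - S r q" \<alpha> \<zeta> w z]
          unfolding eq by (simp add: test_def)
      qed
      \<comment> \<open>For the test vector p, w + T z is e_p + T S e_p - T S e_p = e_p, so t = -S
        e_p + S e_p = 0. Tests read shears, hence they are mutually orthogonal.\<close>
      have shear_test: "shear N S T (tw p) (\<lambda>r. - S r p) q = 0" if "p < N" for p q
      proof -
        have "tw p j + matvec N T (\<lambda>r. - S r p) j = (if j = p then 1 else 0)" for j
          by (simp add: tw_def matvec_def sum_negf)
        then show ?thesis using that unfolding shear_def
          by (simp add: matvec_def if_distrib[of "\<lambda>t. _ * t"] cong: if_cong)
      qed
      have shear_y: "shear N S T (\<lambda>r. - matvec N T (\<lambda>r. int (t r)) r) (\<lambda>r. int (t r)) q = int (t q)" for t q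
        by (simp add: shear_def matvec_def)
      have \<Lambda>_fin: "finite \<Lambda>" unfolding \<Lambda>_def using finite_Ss by simp
      have \<Lambda>_orth: "int d dvd sform (n*m) a b" if ab: "a \<in> \<Lambda>" "b \<in> \<Lambda>" for a b
      proof -
        \<comment> \<open>One description for both kinds of elements: no inner h-coordinates and
          vanishing shear, which is all that \<open>stab\<close> and \<open>test\<close> can
          see.\<close>
        have "\<exists>\<alpha> w z. b = emb \<alpha> (\<lambda>_ _. 0) w z \<and> (\<forall>q<N. shear N S T w z q = 0)"
          using ab(2) shear_test shear_zero unfolding \<Lambda>_def stab_def test_def by blast
        then obtain \<alpha> w z where b: "b = emb \<alpha> (\<lambda>_ _. 0) w z" "\<And>q. q < N \<Longrightarrow> shear N S T w z q = 0" by blast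
        show ?thesis
        proof (cases "a \<in> stab ` Ss")
          case True
          then obtain f where "a = stab f" by blast
          then show ?thesis using stab[of f \<alpha> "\<lambda>_ _. 0" w z] unfolding b(1) by (simp add: cong_0_iff)
        next
          case False
          then obtain q where "q < N" "a = test q" using ab(1) unfolding \<Lambda>_def by blast
          then show ?thesis using test[of q \<alpha> "\<lambda>_ _. 0" w z] b(2)[of q] unfolding b(1) by (simp add: cong_0_iff)
        qed
      qed
      have dvd_cong: "int d dvd A' - B'" if "[A = A'] (mod int d)" "[B = B'] (mod int d)" "int d dvd A - B" for A A' B B'
        using that by (meson cong_diff cong_dvd_iff)
      have less_eqI: "a = b" if "int d dvd int a - int b" "a < d" "b < d" for a b
        using that by (metis cong_iff_dvd_diff cong_int_iff cong_less_modulus_unique_nat)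
      have ysep: "\<exists>a\<in>\<Lambda>. \<not> int d dvd sform (n*m) a (yv t) - sform (n*m) a (yv t')"
        if t: "t \<in> vecs d K" "t' \<in> vecs d K" "t \<noteq> t'" for t t'
      proof (rule ccontr)
        assume *: "\<not> ?thesis"
        have "t q = t' q" for q
        proof (cases "q < K")
          case True
          then have q: "q < N" using K by simp
          then have "test q \<in> \<Lambda>" unfolding \<Lambda>_def by blast
          then have dv: "int d dvd sform (n*m) (test q) (yv t) - sform (n*m) (test q) (yv t')" using * by blast
          have "int d dvd int (t q) - int (t' q)"
            using dvd_cong[OF test[OF q] test[OF q] dv[unfolded yv_def]] unfolding shear_y .
          then show ?thesis by (rule less_eqI) (use t True in \<open>auto simp: vecs_def\<close>)
        next
          case False
          then show ?thesis using t by (auto simp: vecs_def)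
        qed
        then show False using t by blast
      qed
      \<comment> \<open>By contradiction: if no check separates, the inner stabilizers force equal
        syndromes, and then the tests from K on make u and u' confusable, which \<open>good\<close>
        excludes.\<close>
      have esep: "\<exists>a\<in>\<Lambda>. \<not> int d dvd sform (n*m) a (\<lambda>i. err e i + yv t i) - sform (n*m) a (\<lambda>i. err e' i + yv t' i)"
        if e: "e \<in> J" "e' \<in> J" "e \<noteq> e'" and t: "t \<in> vecs d K" "t' \<in> vecs d K" for e e' t t'
      proof (rule ccontr)
        assume *: "\<not> ?thesis"
        obtain s u where su: "e = (s, u)" by (cases e)
        obtain s' u' where su': "e' = (s', u')" by (cases e')
        have mem: "s \<in> Ss" "u \<in> Us" "s' \<in> Ss" "u' \<in> Us" using e J su su' by auto
        have emb: "(\<lambda>i. err (s, u) i + yv t i) = emb (\<lambda>b j. 0 + 0) (\<lambda>b j. int (s b j) + 0)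
             (\<lambda>q. lw u q + - matvec N T (\<lambda>r. int (t r)) q) (\<lambda>q. lz u q + int (t q))" for s u t
          unfolding err_def yv_def emb_add by (simp only: fst_conv snd_conv)
        have "s b j = s' b j" if b: "b < m" for b j
        proof (cases "j < n - k")
          case j: True
          \<comment> \<open>The stabilizer element equal to g_j in block b and trivial elsewhere; it
            isolates one entry of the syndrome.\<close>
          define f :: "nat \<Rightarrow> nat \<Rightarrow> nat" where "f = (\<lambda>b'\<in>{..<m}. \<lambda>j'. if b' = b \<and> j' = j then 1 else 0)"
          have "f \<in> Ss" unfolding f_def vecs_def using j d_gt_1 by auto
          then have "stab f \<in> \<Lambda>" unfolding \<Lambda>_def by blast
          then have dv: "int d dvd sform (n*m) (stab f) (\<lambda>i. err e i + yv t i) - sform (n*m) (stab f) (\<lambda>i. err e' i + yv t' i)"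
            using * by blast
          have sm: "(\<Sum>b'<m. \<Sum>j'<n-k. int (f b' j') * (int (r b' j') + 0)) = int (r b j)" for r :: "nat \<Rightarrow> nat \<Rightarrow> nat"
          proof -
            have "(\<Sum>b'<m. \<Sum>j'<n-k. int (f b' j') * (int (r b' j') + 0))
              = (\<Sum>b'<m. \<Sum>j'<n-k. if b' = b then (if j' = j then int (r b j) else 0) else 0)"
              by (intro sum.cong refl) (simp add: f_def)
            also have "\<dots> = (\<Sum>b'<m. if b' = b then (\<Sum>j'<n-k. if j' = j then int (r b j) else 0) else 0)"
              by (intro sum.cong[OF refl]) simp
            also have "\<dots> = int (r b j)" using b j by simp
            finally show ?thesis .
          qed
          have "int d dvd int (s b j) - int (s' b j)"
            using dvd_cong[OF stab stab dv[unfolded su su' emb]] unfolding sm .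
          moreover have "s b \<in> vecs d (n-k)" "s' b \<in> vecs d (n-k)" using mem b by auto
          ultimately show ?thesis using less_eqI j by (auto simp: vecs_def)
        next
          case False
          have "s b \<in> vecs d (n-k)" "s' b \<in> vecs d (n-k)" using mem b by auto
          then show ?thesis using False by (auto simp: vecs_def)
        qed
        then have ss: "s = s'" using mem by (intro PiE_ext[of s _ _ s']) auto
        have "bad K (S, T) u u'"
          unfolding bad_def
        proof (intro allI impI)
          fix q assume q: "K \<le> q \<and> q < N"
          then have qN: "q < N" by simp
          then have "test q \<in> \<Lambda>" unfolding \<Lambda>_def by blast
          then have dv: "int d dvd sform (n*m) (test q) (\<lambda>i. err e i + yv t i) - sform (n*m) (test q) (\<lambda>i. err e' i + yv t' i)"
            using * by blast
          \<comment> \<open>The code vectors contribute nothing to the checks from K on, so only the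
            difference of the logical parts remains.\<close>
          have "t q = 0" "t' q = 0" using t q by (auto simp: vecs_def)
          then show "int d dvd shear N (fst (S, T)) (snd (S, T)) (\<lambda>q. lw u q - lw u' q) (\<lambda>q. lz u q - lz u' q) q"
            using dvd_cong[OF test[OF qN] test[OF qN] dv[unfolded su su' emb]]
            unfolding shear_add shear_y shear_diff by simp
        qed
        then show False using good[of s u u'] e su su' ss by blast
      qed
      define G where "G = {x \<in> vecs d (2*(n*m)). cls x \<in> J}"
      \<comment> \<open>Every error with class in J is correctable: it differs from its
        representative by \<open>stab f\<close>, which is orthogonal to all code translates.\<close>
      have G: "\<exists>e\<in>J. \<exists>a\<in>\<Lambda>. (\<forall>i<2*(n*m). [int (x i) = err e i + a i] (mod int d)) \<and>
          (\<forall>t\<in>vecs d K. int d dvd sform (n*m) a (yv t))" if x: "x \<in> G" for x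
      proof -
        have xv: "x \<in> vecs d (2*(n*m))" and xJ: "cls x \<in> J" using x unfolding G_def by auto
        obtain f where f: "f \<in> Ss" "\<And>i. i < 2*(n*m) \<Longrightarrow> [int (x i) = err (cls x) i + stab f i] (mod int d)"
          using err_cls[OF xv] unfolding stab_def by blast
        have "int d dvd sform (n*m) (stab f) (yv t)" for t
          using stab[of f "\<lambda>_ _. 0" "\<lambda>_ _. 0"] unfolding yv_def by (simp add: cong_0_iff)
        moreover have "stab f \<in> \<Lambda>" using f(1) unfolding \<Lambda>_def by blast
        ultimately show ?thesis using f(2) xJ by blast
      qed
      have finJ: "finite J" using J finite_Ss finite_Us finite_subset by blast
      have "(\<lambda>_. 0) \<in> vecs d K" using d_gt_1 by (simp add: vecs_def)
      then have ne: "vecs d K \<noteq> {}" by blast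
      have Gsum: "sum (prodP P (n*m)) G = sum (pL P) J" unfolding G_def by (rule sum_prodP_cls[OF J])
      have sub: "G \<subseteq> vecs d (2*(n*m))" unfolding G_def by blast
      show ?thesis
        using pauli_group.stabilizer_code[OF pg assms(4) \<Lambda>_fin \<Lambda>_orth finite_vecs ne finJ ysep esep sub G]
        unfolding Gsum card_vecs .
    qed
    let ?\<Omega> = "sym_mats d N \<times> sym_mats d N"
    let ?c = "2 * real d ^ K / real d ^ N"
    have d0: "d > 0" using d_gt_1 by simp
    have ne: "?\<Omega> \<noteq> {}" using zero_in_sym_mats[OF d0, of N] by blast
    have cpos: "?c > 0" using d0 by simp
    have nonneg: "pL P x \<ge> 0" for x unfolding pL_def using PL_nonneg[OF assms(4)] by (intro prod_nonneg) auto
    have fin\<Omega>: "finite ?\<Omega>" using finite_sym_mats by blast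
    have "\<exists>ST\<in>?\<Omega>. sum (pL P) {(s, u) \<in> Ss \<times> Us. \<exists>u'\<in>Us. u' \<noteq> u \<and> pL P (s, u) \<le> pL P (s, u') \<and> bad K ST u u'}
        \<le> ?c powr \<rho> * (\<Sum>s\<in>Ss. (\<Sum>u\<in>Us. pL P (s, u) powr (1 / (1 + \<rho>))) powr (1 + \<rho>))"
      by (rule random_coding[OF finite_Ss finite_Us fin\<Omega> ne nonneg cpos \<rho> card_bad[OF K]])
    then obtain ST where ST: "ST \<in> ?\<Omega>"
      and le: "sum (pL P) {(s, u) \<in> Ss \<times> Us. \<exists>u'\<in>Us. u' \<noteq> u \<and> pL P (s, u) \<le> pL P (s, u') \<and> bad K ST u u'}
        \<le> ?c powr \<rho> * (\<Sum>s\<in>Ss. (\<Sum>u\<in>Us. pL P (s, u) powr (1 / (1 + \<rho>))) powr (1 + \<rho>))"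
      by (rule bexE)
    define F where "F = {(s, u) \<in> Ss \<times> Us. \<exists>u'\<in>Us. u' \<noteq> u \<and> pL P (s, u) \<le> pL P (s, u') \<and> bad K ST u u'}"
    \<comment> \<open>Of two confusable logical parts with the same syndrome, one that is not the
      more likely lies in F; the non-strict comparison settles ties.\<close>
    have good: "\<not> bad K (fst ST, snd ST) u u'"
      if "(s, u) \<in> Ss \<times> Us - F" "(s, u') \<in> Ss \<times> Us - F" "u \<noteq> u'" for s u u'
    proof
      assume "bad K (fst ST, snd ST) u u'"
      then have b: "bad K ST u u'" "bad K ST u' u" using bad_sym by simp_all
      have mem: "s \<in> Ss" "u \<in> Us" "u' \<in> Us" and nF: "(s, u) \<notin> F" "(s, u') \<notin> F" using that by auto
      show False
      proof (cases "pL P (s, u) \<le> pL P (s, u')")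
        case True
        have "(s, u) \<in> F" unfolding F_def mem_Collect_eq case_prod_conv
          by (intro conjI SigmaI bexI[of _ u']) (use mem b True that(3) in simp_all)
        then show False using nF by simp
      next
        case False
        have "(s, u') \<in> F" unfolding F_def mem_Collect_eq case_prod_conv
          by (intro conjI SigmaI bexI[of _ u]) (use mem b False that(3) in simp_all)
        then show False using nF by simp
      qed
    qed
    have mem: "fst ST \<in> sym_mats d N" "snd ST \<in> sym_mats d N" using ST by auto
    have "sum (pL P) (Ss \<times> Us - F) = 1 - sum (pL P) F"
      using sum_diff[of "Ss \<times> Us" F "pL P"] sum_pL[OF assms(5)] finite_Ss finite_Us unfolding F_def by auto
    also have "\<dots> \<ge> 1 - ?c powr \<rho> * (\<Sum>s\<in>Ss. (\<Sum>u\<in>Us. pL P (s, u) powr (1 / (1 + \<rho>))) powr (1 + \<rho>))"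
      using le unfolding F_def by simp
    finally have *: "1 - ?c powr \<rho> * (\<Sum>s\<in>Ss. (\<Sum>u\<in>Us. pL P (s, u) powr (1 / (1 + \<rho>))) powr (1 + \<rho>))
       \<le> sum (pL P) (Ss \<times> Us - F)" .
    have "\<exists>B Ks. orthonormal (d^(n*m)) B \<and> is_tpcp_kraus (d^(n*m)) Ks \<and> length B = d^K \<and>
       sum (pL P) (Ss \<times> Us - F) \<le> fidelity (d^(n*m)) (chan d \<omega> P (n*m)) B Ks"
      by (rule code_exists[OF mem Diff_subset good])
    then obtain B Ks where code: "orthonormal (d^(n*m)) B \<and> is_tpcp_kraus (d^(n*m)) Ks \<and> length B = d^K \<and>
       sum (pL P) (Ss \<times> Us - F) \<le> fidelity (d^(n*m)) (chan d \<omega> P (n*m)) B Ks"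
      by (elim exE)
    show ?thesis
      by (rule exI[of _ B], rule exI[of _ Ks])
        (use code order_trans[OF *[unfolded sum_pL_powr[OF assms(4)]]] in simp)
  qed
  let ?Q = "PL d n k P g h"
  define a where "a = real k - R' * real n"
  define Zf where "Zf = (\<lambda>\<rho>. \<Sum>s\<in>vecs d (n-k). (\<Sum>u\<in>vecs d (2*k). ?Q (s, u) powr (1 / (1 + \<rho>))) powr (1 + \<rho>))"
  have a_eq: "real k - real k * (R' * real n / real k) = a" using assms(6) by (simp add: a_def)
  have Q_nonneg: "?Q x \<ge> 0" for x by (rule code_layout.PL_nonneg[OF layout assms(4)])
  have Q_sum: "sum ?Q (vecs d (n-k) \<times> vecs d (2*k)) = 1" by (rule code_layout.sum_PL[OF layout assms(5)])
  obtain \<rho> where \<rho>: "0 \<le> \<rho>" "\<rho> \<le> 1" "a \<le> 0 \<longrightarrow> \<rho> = 0"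
    and E: "E_nk d n k (R' * real n / real k) ?Q \<le> ereal (\<rho> * a - log (real d) (Zf \<rho>))"
    using gallager_exponent[OF finite_vecs finite_vecs Q_nonneg Q_sum, of "real d" a] d1
    unfolding E_nk_def Let_def a_eq Zf_def by auto
  define G where "G = \<rho> * a - log (real d) (Zf \<rho>)"
  have "E_nk d n k (R' * real n / real k) ?Q / ereal (real n) \<le> ereal G / ereal (real n)"
    using E n0 unfolding G_def by (intro ereal_divide_right_mono) auto
  also have "\<dots> = ereal (G / real n)" using n0 by simp
  also have "\<dots> \<le> limsup (err_exp d \<omega> P R')"
  proof (cases "a \<le> 0")
    \<comment> \<open>Here \<rho> = 0, and the double sum at \<rho> = 0 is the total probability, so
      the claimed bound is 0.\<close>
    case True
    have "Zf 0 = (\<Sum>s\<in>vecs d (n-k). \<Sum>u\<in>vecs d (2*k). ?Q (s, u))"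
      unfolding Zf_def using Q_nonneg by (simp add: sum_nonneg)
    also have "\<dots> = 1" using Q_sum by (simp add: sum.cartesian_product)
    finally have "G = 0" using True \<rho>(3) by (simp add: G_def)
    moreover have "0 \<le> limsup (err_exp d \<omega> P R')"
    proof (rule le_Limsup)
      show "\<forall>\<^sub>F M in sequentially. 0 \<le> err_exp d \<omega> P R' M"
        using eventually_gt_at_top[of 0] by eventually_elim (rule err_exp_nonneg[OF prob assms(14)])
    qed simp
    ultimately show ?thesis by (simp add: zero_ereal_def)
  next
    case False
    \<comment> \<open>Cost in the exponent of the factor 2 (\<open>log (real d) 2\<close>) and of
      rounding K up (at most 1), both scaled by \<rho>.\<close>
    define c where "c = \<rho> * (log (real d) 2 + 1)"
    have bound: "ereal (G / real n - c / real n / real (Suc l)) \<le> err_exp d \<omega> P R' (n * Suc l)" for l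
    proof -
      define m where "m = Suc l"
      have m0: "m > 0" by (simp add: m_def)
      \<comment> \<open>Rounded up so that the code has the required rate; K still fits into k m
        because a > 0 and k m is an integer.\<close>
      define K where "K = nat \<lceil>R' * real n * real m\<rceil>"
      have K_ge: "R' * real n * real m \<le> real K" unfolding K_def by linarith
      have K_less: "real K < R' * real n * real m + 1"
        using assms(13) unfolding K_def by (simp add: ceiling_less_iff) linarith
      have "R' * real n * real m \<le> real k * real m"
        using False by (intro mult_right_mono) (auto simp: a_def)
      then have "\<lceil>R' * real n * real m\<rceil> \<le> int (k * m)" by (simp add: ceiling_le_iff)
      then have K: "K \<le> k * m" unfolding K_def by (simp only: nat_le_iff)
      define \<epsilon> where "\<epsilon> = (2 * real d ^ K / real d ^ (k * m)) powr \<rho> * Zf \<rho> ^ m"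
      obtain B Ks where code: "orthonormal (d^(n*m)) B" "is_tpcp_kraus (d^(n*m)) Ks" "length B = d^K"
        and fid: "1 - \<epsilon> \<le> fidelity (d^(n*m)) (chan d \<omega> P (n*m)) B Ks"
        using random_code[OF K \<rho>(1,2)] unfolding \<epsilon>_def Zf_def by blast
      have pos: "length B > 0" using code(3) d1 by simp
      have lg: "R' * real (n*m) \<le> log (real d) (real (length B))"
        using K_ge d1 by (simp add: code(3) log_nat_power mult.assoc)
      note F = fidelity_le_Fstar[OF prob code(1,2) pos lg]
      have "ereal (G / real n - c / real n / real m) \<le> err_exp d \<omega> P R' (n*m)"
      proof (rule err_exp_ge[OF d1 _ F(2)])
        show "0 < n * m" using n0 by (simp add: m_def)
        show "1 - \<epsilon> \<le> Fstar d \<omega> P (n*m) (R' * real (n*m))" using fid F(1) by simp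
        assume \<epsilon>: "\<epsilon> > 0"
        have Z0: "Zf \<rho> \<ge> 0" unfolding Zf_def by (simp add: sum_nonneg)
        \<comment> \<open>Positivity of \<epsilon> excludes \<open>Zf \<rho> = 0\<close>, so the
          logarithm of the product may be split.\<close>
        moreover have "Zf \<rho> \<noteq> 0" using \<epsilon> unfolding \<epsilon>_def by (auto simp: m_def)
        ultimately have Z: "Zf \<rho> > 0" by simp
        have "log (real d) \<epsilon> = \<rho> * (log (real d) 2 + real K - real (k * m)) + real m * log (real d) (Zf \<rho>)"
          unfolding \<epsilon>_def using Z d1
          by (simp add: log_mult log_divide log_powr log_nat_power)
        also have "\<dots> \<le> \<rho> * (log (real d) 2 + (R' * real n * real m + 1) - real (k * m)) + real m * log (real d) (Zf \<rho>)"
          using K_less \<rho>(1) by (intro add_mono mult_left_mono) auto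
        also have "\<dots> = c - real m * G" unfolding c_def G_def a_def by (simp add: algebra_simps)
        also have "\<dots> = - real (n*m) * (G / real n - c / real n / real m)"
          using n0 m0 by (simp add: field_simps)
        finally show "log (real d) \<epsilon> \<le> - real (n*m) * (G / real n - c / real n / real m)" .
      qed
      then show ?thesis unfolding m_def .
    qed
    have "(\<lambda>l. G / real n - c / real n / real (Suc l)) \<longlonglongrightarrow> G / real n - 0"
      by (intro tendsto_diff tendsto_const LIMSEQ_Suc[OF lim_const_over_n])
    then have "(\<lambda>l. ereal (G / real n - c / real n / real (Suc l))) \<longlonglongrightarrow> ereal (G / real n)"
      by simp
    then have "ereal (G / real n) = limsup (\<lambda>l. ereal (G / real n - c / real n / real (Suc l)))"
      by (intro lim_imp_Limsup[symmetric]) auto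
    also have "\<dots> \<le> limsup (err_exp d \<omega> P R' \<circ> (\<lambda>l. n * Suc l))"
      by (rule Limsup_mono, rule always_eventually, rule allI) (simp only: comp_def bound)
    \<comment> \<open>Passing to the lengths n (l + 1) can only lower a limsup.\<close>
    also have "\<dots> \<le> limsup (err_exp d \<omega> P R')"
      by (rule limsup_subseq_mono) (use n0 in \<open>auto simp: strict_mono_def\<close>)
    finally show ?thesis .
  qed
  finally show ?thesis .
qed

end
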